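(* Let $u\in\{0,1\}^+$ be a nonempty finite binary word. Then $\mu(u)\leq 3$ if and only if $u$ is a factor of a double Sturmian word.
   Context: For a finite word $u=u_1u_2\cdots u_n$ over an alphabet $\mathbb{A}$ and $1\le i\le j\le n$, write $u[i,j]=u_iu_{i+1}\cdots u_j$, and let $\mathcal{S}(n)=\{(i,j)\mid 1\le i\le j\le n\}$. Let $\mathrm{alph}(u)$ be the set of letters occurring in $u$. A set $S\subseteq\mathcal{S}(n)$ palindromically generates $u\in\mathbb{A}^n$ if (1) $u[i,j]$ is a palindrome for every $(i,j)\in S$, and (2) for every nonempty set $\mathbb{B}$ and every $v\in\mathbb{B}^n$ such that $v[i,j]$ is a palindrome for all $(i,j)\in S$, there is a map $c\colon\mathrm{alph}(u)\to\mathbb{B}$ whose extension to a morphism of words satisfies $c(u)=v$. Define $\mu(u)=\inf\{\#S\mid S\subseteq\mathcal{S}(|u|)\text{ palindromically generates }u\}$, with $\inf\emptyset=+\infty$. An infinite word $x\in\{0,1\}^{\mathbb N}$ is Sturmian if it has exactly $m+1$ distinct factors of each length $m\ge1$. For $A\subseteq\{0,1\}$, the doubling morphism $d_A\colon\{0,1\}^*\to\{0,1\}^*$ is given by $d_A(a)=aa$ if $a\in A$ and $d_A(a)=a$ if $a\notin A$ (extended to infinite words letterwise). An infinite word $y\in\{0,1\}^{\mathbb N}$ is double Sturmian if $y$ is a suffix of $d_A(x)$ for some Sturmian word $x$ and some $A\subseteq\{0,1\}$. *)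

theory Defs
  imports "HOL-Library.Stream" "HOL-Library.Extended_Nat"
begin

(* Positions are counted from 1: subword u i j is u_i u_(i+1) ... u_j. *)
definition subword :: "'a list \<Rightarrow> nat \<Rightarrow> nat \<Rightarrow> 'a list" where
  "subword u i j = take (Suc j - i) (drop (i - 1) u)"

definition positions :: "nat \<Rightarrow> (nat \<times> nat) set" where
  "positions n = {(i, j). 1 \<le> i \<and> i \<le> j \<and> j \<le> n}"

definition palindrome :: "'a list \<Rightarrow> bool" where
  "palindrome w \<longleftrightarrow> rev w = w"

definition palindromic_at :: "(nat \<times> nat) set \<Rightarrow> 'a list \<Rightarrow> bool" where
  "palindromic_at S u \<longleftrightarrow> (\<forall>(i, j)\<in>S. palindrome (subword u i j))"

definition encodes_all_over :: "'b set \<Rightarrow> (nat \<times> nat) set \<Rightarrow> 'a list \<Rightarrow> bool" where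
  "encodes_all_over B S u \<longleftrightarrow>
     (\<forall>v\<in>lists B. length v = length u \<longrightarrow> palindromic_at S v \<longrightarrow>
        (\<exists>c. c ` set u \<subseteq> B \<and> map c u = v))"

(* A definition cannot quantify over all types, so the alphabets B range over the
   nonempty sets of natural numbers. By pal_generates_any_alphabet below this already
   gives the condition for the nonempty sets B of every type. *)
definition pal_generates :: "(nat \<times> nat) set \<Rightarrow> 'a list \<Rightarrow> bool" where
  "pal_generates S u \<longleftrightarrow>
     palindromic_at S u \<and> (\<forall>B :: nat set. B \<noteq> {} \<longrightarrow> encodes_all_over B S u)"

lemma subword_map: "subword (map f u) i j = map f (subword u i j)"
  by (simp add: subword_def take_map drop_map)

lemma palindromic_at_map: "palindromic_at S v \<Longrightarrow> palindromic_at S (map f v)"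
  by (fastforce simp: palindromic_at_def palindrome_def subword_map rev_map)

lemma pal_generates_any_alphabet:
  fixes B :: "'b set"
  assumes "pal_generates S u"
  shows "encodes_all_over B S u"
  unfolding encodes_all_over_def
proof (intro ballI impI)
  fix v assume v: "v \<in> lists B" "length v = length u" "palindromic_at S v"
  obtain f :: "'b \<Rightarrow> nat" where f: "inj_on f (set v)"
    using finite_imp_inj_to_nat_seg[of "set v"] by auto
  have "encodes_all_over (UNIV :: nat set) S u"
    using assms by (auto simp: pal_generates_def)
  moreover have "palindromic_at S (map f v)"
    using v(3) by (rule palindromic_at_map)
  ultimately obtain c where c: "map c u = map f v"
    using v(2) unfolding encodes_all_over_def by fastforce
  let ?c = "inv_into (set v) f \<circ> c"
  have "map ?c u = map (inv_into (set v) f) (map f v)"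
    by (simp flip: c)
  also have "\<dots> = v"
    using f by (simp add: map_idI)
  finally have eq: "map ?c u = v" .
  have "?c ` set u = set (map ?c u)"
    by simp
  also have "\<dots> \<subseteq> B"
    unfolding eq using v(1) by auto
  finally show "\<exists>c. c ` set u \<subseteq> B \<and> map c u = v"
    using eq by blast
qed

(* In enat the infimum of the empty set is infinity. *)
definition pal_mu :: "'a list \<Rightarrow> enat" where
  "pal_mu u = Inf {enat (card S) | S. S \<subseteq> positions (length u) \<and> pal_generates S u}"

definition factor_of :: "'a list \<Rightarrow> 'a stream \<Rightarrow> bool" where
  "factor_of u x \<longleftrightarrow> (\<exists>k. u = stake (length u) (sdrop k x))"

(* Binary letters are booleans: False stands for 0 and True for 1. *)
definition sturmian :: "bool stream \<Rightarrow> bool" where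
  "sturmian x \<longleftrightarrow> (\<forall>m\<ge>1. card {w. length w = m \<and> factor_of w x} = m + 1)"

definition doubling :: "bool set \<Rightarrow> bool list \<Rightarrow> bool list" where
  "doubling A w = concat (map (\<lambda>a. if a \<in> A then [a, a] else [a]) w)"

definition doubling_inf :: "bool set \<Rightarrow> bool stream \<Rightarrow> bool stream" where
  "doubling_inf A x = flat (smap (\<lambda>a. doubling A [a]) x)"

lemma doubling_inf_shift: "doubling_inf A (w @- x) = doubling A w @- doubling_inf A x"
  by (induction w) (auto simp: doubling_inf_def doubling_def)

definition double_sturmian :: "bool stream \<Rightarrow> bool" where
  "double_sturmian y \<longleftrightarrow> (\<exists>x A k. sturmian x \<and> y = sdrop k (doubling_inf A x))"

end

(*
  A set of palindromes acts on the positions of a word by partial reflections, and it generates the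
  word iff the letter classes are exactly the classes of this action.

  Three palindromes to double Sturmian word: some palindrome touches the right end, and the word can
  be extended until that palindrome is the whole word; then one of the other two touches an end as
  well, so that the word is a window of an N-periodic bi-infinite word with a reflection symmetry
  i -> e - i.  The third palindrome is a reflection of Z/N defined off T consecutive positions, the
  holes.  The product of the two reflections is the translation by d, and the class of a hole is its
  translation orbit up to the first return to the holes.  Hence a letter class contains at most two
  holes, so T <= 4, and the orbit is explicit: the letters are read off a rotation i -> i * s modulo N
  through an arc of length s, through an arc of length 2 * s, which doubles one letter, or through an
  arc of length s with both letters doubled.  A rational rotation agrees on a window with an irrational one,
  whose coding is Sturmian.

  Double Sturmian word to three palindromes: Sturmian words are balanced, so their windows are coded by
  rotations i -> i * s modulo N with s and N coprime.  The codings with doubled letters are the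
  periodic words above, and their classes are visibly generated by the two reflections.  A large
  window is then generated by itself and two of its palindromic prefixes, and generation by three
  palindromes passes to factors.
*)
theory Submission
  imports Defs "HOL-Number_Theory.Cong" "HOL-Analysis.Kronecker_Approximation_Theorem"
    "HOL-Analysis.Continuum_Not_Denumerable"
begin

text \<open>Two exceptions hide behind the claim that palindromes touch the ends. If none touches
  the right end, the last letter occurs only once; if, after the extension, neither of the other two
  touches an end, the two outermost positions form a class of their own. Both words are coded by an
  arc of length 1.

  The numbers of holes come from the arcs. In the coordinate \<open>t = i * s\<close> modulo
  \<open>N\<close>, with the arc [0, w), the reflections \<open>t -> w - 1 - t\<close> and
  \<open>t -> w - t\<close> preserve the arc, except that the second exchanges 0 and w. Their
  product is \<open>t -> t + 1\<close>, which has to be cut exactly at these two points. The point w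
  is the position 1 if w = s and 2 if w = 2 * s, so the consecutive holes are 0, 1 or 0, 1, 2; in
  the latter case position 1 cuts the arc too, and the first reflection rejoins its halves. Doubling
  both letters splits each position in two, hence four holes. Conversely, the first return time to
  the holes becomes the \<open>s\<close> of the rotation; the other return patterns give residue
  classes modulo a gcd or contradict the minimality of return times.\<close>

section \<open>Words as functions on the integers\<close>

(* The short name cong_def is taken by a fact about codatatypes. *)
lemmas cong_iff_mod_eq = unique_euclidean_semiring_class.cong_def

definition mirror_on :: "int \<Rightarrow> int \<Rightarrow> (int \<Rightarrow> 'a) \<Rightarrow> bool" where
  "mirror_on a b v \<longleftrightarrow> (\<forall>i. a \<le> i \<longrightarrow> i \<le> b \<longrightarrow> v (a + b - i) = v i)"

lemma mirror_onD: "mirror_on a b v \<Longrightarrow> a \<le> i \<Longrightarrow> i \<le> b \<Longrightarrow> v (a + b - i) = v i"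
  by (simp add: mirror_on_def)

lemma mirror_on_cong: "(\<And>i. a \<le> i \<Longrightarrow> i \<le> b \<Longrightarrow> v i = w i) \<Longrightarrow> mirror_on a b v = mirror_on a b w"
  unfolding mirror_on_def by (smt (verit))

lemma mirror_on_inner:
  assumes "mirror_on a b v" "a \<le> c" "a + b = c + d"
  shows "mirror_on c d v"
  using assms unfolding mirror_on_def by (smt (verit))

text \<open>Conjugation of one reflection by another: inside a palindromic [a, r] a palindrome can
  be exchanged for its mirror image without changing the system of constraints.\<close>

lemma mirror_on_reflect:
  assumes "mirror_on a r w" "a \<le> c" "d \<le> r"
  shows "mirror_on c d w \<longleftrightarrow> mirror_on (a + r - d) (a + r - c) w"
proof -
  have *: "mirror_on (a + r - d) (a + r - c) w" if s: "mirror_on c d w" and cd: "a \<le> c" "d \<le> r" for c d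
    unfolding mirror_on_def
  proof (intro allI impI)
    fix i assume i: "a + r - d \<le> i" "i \<le> a + r - c"
    have "w i = w (a + r - i)" using mirror_onD[OF assms(1), of i] i cd by simp
    also have "\<dots> = w (c + d - (a + r - i))" using mirror_onD[OF s, of "a + r - i"] i by simp
    also have "\<dots> = w (a + r - (c + d - (a + r - i)))"
      using mirror_onD[OF assms(1), of "c + d - (a + r - i)"] i cd by simp
    finally show "w (a + r - d + (a + r - c) - i) = w i" by (simp add: algebra_simps)
  qed
  show ?thesis using *[of c d] *[of "a + r - d" "a + r - c"] assms by auto
qed

text \<open>Generation as an inclusion of kernels: a word \<open>v\<close> is a letter-to-letter
  image of \<open>x\<close> exactly when it is constant on the letter classes of \<open>x\<close>.
  Natural numbers suffice as test alphabet, since only the partition of the positions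
  counts.\<close>

definition determines :: "(int \<times> int) set \<Rightarrow> int set \<Rightarrow> (int \<Rightarrow> 'a) \<Rightarrow> bool" where
  "determines S I x \<longleftrightarrow> (\<forall>(a, b)\<in>S. mirror_on a b x) \<and>
     (\<forall>v :: int \<Rightarrow> nat. (\<forall>(a, b)\<in>S. mirror_on a b v) \<longrightarrow>
        (\<forall>i\<in>I. \<forall>j\<in>I. x i = x j \<longrightarrow> v i = v j))"

lemma determinesD:
  fixes v :: "int \<Rightarrow> nat"
  assumes "determines S I x" "\<forall>(a, b)\<in>S. mirror_on a b v" "i \<in> I" "j \<in> I" "x i = x j"
  shows "v i = v j"
  using assms unfolding determines_def by blast

lemma determinesI:
  assumes "\<forall>(a, b)\<in>S. mirror_on a b x"
    and "\<And>v :: int \<Rightarrow> nat. \<And>i j. \<forall>(a, b)\<in>S. mirror_on a b v \<Longrightarrow> i \<in> I \<Longrightarrow> j \<in> I \<Longrightarrow> x i = x j \<Longrightarrow> v i = v j"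
  shows "determines S I x"
  using assms unfolding determines_def by blast

definition three_gen :: "int \<Rightarrow> int \<Rightarrow> (int \<Rightarrow> 'a) \<Rightarrow> bool" where
  "three_gen l r x \<longleftrightarrow> (\<exists>S. finite S \<and> card S \<le> 3 \<and> (\<forall>(a, b)\<in>S. l \<le> a \<and> b \<le> r) \<and>
     determines S {l..r} x)"

lemma three_gen_mirror:
  assumes "three_gen l r x"
  shows "three_gen (- r) (- l) (\<lambda>i. x (- i))"
proof -
  obtain S where S: "finite S" "card S \<le> 3" "\<forall>(a, b)\<in>S. l \<le> a \<and> b \<le> r" "determines S {l..r} x"
    using assms unfolding three_gen_def by blast
  define S' where "S' = (\<lambda>(a, b). (- b, - a)) ` S"
  have sym: "mirror_on (- b) (- a) (\<lambda>i. v (- i)) = mirror_on a b v" for a b and v :: "int \<Rightarrow> 'c"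
    unfolding mirror_on_def
  proof (intro iffI allI impI)
    fix i assume "\<forall>i\<ge>- b. i \<le> - a \<longrightarrow> v (- (- b + - a - i)) = v (- i)" "a \<le> i" "i \<le> b"
    then show "v (a + b - i) = v i" by (auto dest!: spec[of _ "- i"] simp: algebra_simps)
  next
    fix i assume "\<forall>i\<ge>a. i \<le> b \<longrightarrow> v (a + b - i) = v i" "- b \<le> i" "i \<le> - a"
    then show "v (- (- b + - a - i)) = v (- i)" by (auto dest!: spec[of _ "- i"] simp: algebra_simps)
  qed
  have "determines S' {- r..- l} (\<lambda>i. x (- i))"
  proof (rule determinesI)
    fix v :: "int \<Rightarrow> nat" and i j
    assume v: "\<forall>(a, b)\<in>S'. mirror_on a b v" and ij: "i \<in> {- r..- l}" "j \<in> {- r..- l}" "x (- i) = x (- j)"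
    have "\<forall>(a, b)\<in>S. mirror_on a b (\<lambda>i. v (- i))"
      using v sym[of _ _ "\<lambda>i. v (- i)"] by (auto simp: S'_def)
    from determinesD[OF S(4) this, of "- i" "- j"] ij have "v (- (- i)) = v (- (- j))"
      by simp
    then show "v i = v j" by simp
  qed (use S(4) sym[of _ _ x] in \<open>auto simp: S'_def determines_def\<close>)
  moreover have "card S' \<le> 3" using S(1,2) card_image_le[of S "\<lambda>(a, b). (- b, - a)"] by (simp add: S'_def)
  ultimately show ?thesis
    unfolding three_gen_def using S(1,3) by (intro exI[of _ S']) (auto simp: S'_def)
qed

lemma mirror_on_shift: "mirror_on (a - h) (b - h) (\<lambda>i. v (i + h)) = mirror_on a b v"
  unfolding mirror_on_def
proof (intro iffI allI impI)
  fix i assume "\<forall>i\<ge>a - h. i \<le> b - h \<longrightarrow> v (a - h + (b - h) - i + h) = v (i + h)" "a \<le> i" "i \<le> b"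
  then show "v (a + b - i) = v i" by (auto dest!: spec[of _ "i - h"] simp: algebra_simps)
next
  fix i assume "\<forall>i\<ge>a. i \<le> b \<longrightarrow> v (a + b - i) = v i" "a - h \<le> i" "i \<le> b - h"
  then show "v (a - h + (b - h) - i + h) = v (i + h)"
    by (auto dest!: spec[of _ "i + h"] simp: algebra_simps)
qed

lemma three_gen_shift:
  assumes "three_gen l r x"
  shows "three_gen (l - k) (r - k) (\<lambda>i. x (i + k))"
proof -
  obtain S where S: "finite S" "card S \<le> 3" "\<forall>(a, b)\<in>S. l \<le> a \<and> b \<le> r" "determines S {l..r} x"
    using assms unfolding three_gen_def by blast
  define S' where "S' = (\<lambda>(a, b). (a - k, b - k)) ` S"
  have "determines S' {l - k..r - k} (\<lambda>i. x (i + k))"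
  proof (rule determinesI)
    fix v :: "int \<Rightarrow> nat" and i j
    assume v: "\<forall>(a, b)\<in>S'. mirror_on a b v" and ij: "i \<in> {l - k..r - k}" "j \<in> {l - k..r - k}" "x (i + k) = x (j + k)"
    have "\<forall>(a, b)\<in>S. mirror_on a b (\<lambda>i. v (i - k))"
      using v mirror_on_shift[of _ k _ "\<lambda>i. v (i - k)"] by (auto simp: S'_def)
    from determinesD[OF S(4) this, of "i + k" "j + k"] ij have "v (i + k - k) = v (j + k - k)"
      by simp
    then show "v i = v j" by simp
  qed (use S(4) mirror_on_shift[of _ k _ x] in \<open>auto simp: S'_def determines_def\<close>)
  moreover have "card S' \<le> 3" using S(1,2) card_image_le[of S "\<lambda>(a, b). (a - k, b - k)"] by (simp add: S'_def)
  ultimately show ?thesis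
    unfolding three_gen_def using S(1,3) by (intro exI[of _ S']) (auto simp: S'_def)
qed

text \<open>If several palindromes end at \<open>r\<close>, the longest one carries the others to the left,
  where they no longer touch \<open>r\<close>.  The longest one then links \<open>r\<close> to a single position.\<close>

lemma three_gen_trim:
  assumes "three_gen l r x"
  shows "three_gen l (r - 1) x"
proof -
  obtain S where S: "finite S" "card S \<le> 3" "\<forall>(a, b)\<in>S. l \<le> a \<and> b \<le> r" "determines S {l..r} x"
    using assms unfolding three_gen_def by blast
  \<comment> \<open>Empty intervals are dropped so that the longest palindrome ending at
    \<open>r\<close> really contains \<open>r\<close>.\<close>
  define S0 where "S0 = {(a, b)\<in>S. a \<le> b}"
  have sub: "S0 \<subseteq> S" by (auto simp: S0_def)
  then have S0: "finite S0" "card S0 \<le> 3" "S0 \<subseteq> S"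
    using S(1,2) card_mono[of S S0] finite_subset[of S0 S] by auto
  have empty: "mirror_on a b v" if "b < a" for a b :: int and v :: "int \<Rightarrow> 'c"
    using that by (simp add: mirror_on_def)
  have pal: "(\<forall>(a, b)\<in>S0. mirror_on a b v) \<longleftrightarrow> (\<forall>(a, b)\<in>S. mirror_on a b v)" for v :: "int \<Rightarrow> 'c"
  proof
    assume *: "\<forall>(a, b)\<in>S0. mirror_on a b v"
    show "\<forall>(a, b)\<in>S. mirror_on a b v"
    proof clarify
      fix a b assume "(a, b) \<in> S"
      then show "mirror_on a b v" using * empty[of b a v] by (cases "a \<le> b") (auto simp: S0_def)
    qed
  qed (use sub in auto)
  have D: "determines S0 {l..r} x"
    using S(4) unfolding determines_def pal by simp
  show ?thesis
  proof (cases "\<exists>a. (a, r) \<in> S0")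
    case False
    then have "\<forall>(a, b)\<in>S0. l \<le> a \<and> b \<le> r - 1"
      using S(3) S0(3) by (metis (no_types, lifting) case_prodD case_prodI2 order_le_less subsetD zle_diff1_eq)
    moreover have "determines S0 {l..r - 1} x" using D by (auto simp: determines_def)
    ultimately show ?thesis unfolding three_gen_def using S0 by blast
  next
    case True
    define M where "M = {a. (a, r) \<in> S0}"
    have "M \<subseteq> fst ` S0" by (force simp: M_def)
    then have finM: "finite M" using S0(1) finite_surj by blast
    define a0 where "a0 = Min M"
    have a0: "(a0, r) \<in> S0" and a0le: "\<And>a. (a, r) \<in> S0 \<Longrightarrow> a0 \<le> a"
      using True finM Min_in[OF finM] by (auto simp: a0_def M_def)
    have a0r: "a0 \<le> r" "l \<le> a0" using a0 S(3) S0(3) by (auto simp: S0_def)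
    define f where "f = (\<lambda>(a, b). if b = r then (a0, a0 + r - a) else (a, b))"
    \<comment> \<open>The longest palindrome loses both of its ends; only the link between
      \<open>a0\<close> and \<open>r\<close> is lost.\<close>
    define S' where "S' = insert (a0 + 1, r - 1) (f ` (S0 - {(a0, r)}))"
    have fin: "finite S'" using S0(1) by (simp add: S'_def)
    have "card S' \<le> Suc (card (f ` (S0 - {(a0, r)})))"
      unfolding S'_def by (simp add: card_insert_if S0(1))
    also have "\<dots> \<le> Suc (card (S0 - {(a0, r)}))" using S0(1) by (simp add: card_image_le)
    also have "\<dots> = card S0" using a0 S0(1) by (metis card_Suc_Diff1)
    finally have card: "card S' \<le> 3" using S0(2) by simp
    have bnd: "\<forall>(a, b)\<in>S'. l \<le> a \<and> b \<le> r - 1"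
    proof (clarify)
      fix a b assume ab: "(a, b) \<in> S'"
      then consider "(a, b) = (a0 + 1, r - 1)" | a' where "(a', r) \<in> S0" "a' \<noteq> a0" "a = a0" "b = a0 + r - a'"
        | "(a, b) \<in> S0" "b \<noteq> r"
        unfolding S'_def f_def by (auto split: if_splits) metis
      then show "l \<le> a \<and> b \<le> r - 1"
      proof cases
        case 2
        then show ?thesis using a0le[of a'] a0r by auto
      next
        case 3
        then show ?thesis using S(3) S0(3) by fastforce
      qed (use a0r in auto)
    qed
    have sym_iff: "(\<forall>(a, b)\<in>S0. mirror_on a b v) \<longleftrightarrow> mirror_on a0 r v \<and> (\<forall>(a, b)\<in>f ` (S0 - {(a0, r)}). mirror_on a b v)"
      for v :: "int \<Rightarrow> 'c"
    proof -
      have *: "mirror_on a b v \<longleftrightarrow> (case f (a, b) of (a, b) \<Rightarrow> mirror_on a b v)"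
        if "mirror_on a0 r v" "(a, b) \<in> S0" for a b
        using mirror_on_reflect[OF that(1), of a b] a0le[of a] that(2) by (auto simp: f_def)
      have "(\<forall>p\<in>S0. case p of (a, b) \<Rightarrow> mirror_on a b v) \<longleftrightarrow>
          mirror_on a0 r v \<and> (\<forall>p\<in>S0 - {(a0, r)}. case p of (a, b) \<Rightarrow> mirror_on a b v)"
        using a0 by blast
      also have "\<dots> \<longleftrightarrow> mirror_on a0 r v \<and> (\<forall>p\<in>S0 - {(a0, r)}. case f p of (a, b) \<Rightarrow> mirror_on a b v)"
        using * by (intro conj_cong ball_cong refl) auto
      finally show ?thesis by simp
    qed
    have "determines S' {l..r - 1} x"
    proof (rule determinesI)
      have "mirror_on a0 r x \<and> (\<forall>(a, b)\<in>f ` (S0 - {(a0, r)}). mirror_on a b x)"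
        using D sym_iff[of x] unfolding determines_def by simp
      then show "\<forall>(a, b)\<in>S'. mirror_on a b x"
        using mirror_on_inner[of a0 r x "a0 + 1" "r - 1"] by (simp add: S'_def)
    next
      fix v :: "int \<Rightarrow> nat" and i j
      assume v: "\<forall>(a, b)\<in>S'. mirror_on a b v" and ij: "i \<in> {l..r - 1}" "j \<in> {l..r - 1}" "x i = x j"
      \<comment> \<open>The trimmed system leaves the value at \<open>r\<close> free. Copying it
        from \<open>a0\<close> restores the longest palindrome; if that is the single position
        \<open>r\<close>, nothing has to be restored.\<close>
      define w where "w = (if a0 = r then v else v(r := v a0))"
      have eq: "w i = v i" if "i < r" for i using that by (simp add: w_def)
      have "mirror_on (a0 + 1) (r - 1) v" using v by (simp add: S'_def)
      then have "mirror_on a0 r w"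
        unfolding mirror_on_def w_def
        by (smt (verit, best) fun_upd_apply)
      moreover have "mirror_on a b w" if "(a, b) \<in> f ` (S0 - {(a0, r)})" for a b
      proof -
        have "(a, b) \<in> S'" using that by (simp add: S'_def)
        then have "b < r" "mirror_on a b v" using bnd v by auto
        then show ?thesis using mirror_on_cong[of a b w v] eq by simp
      qed
      ultimately have "\<forall>(a, b)\<in>S0. mirror_on a b w" using sym_iff[of w] by blast
      from determinesD[OF D this, of i j] ij have "w i = w j" by simp
      then show "v i = v j" using eq ij by simp
    qed
    then show ?thesis unfolding three_gen_def using fin card bnd by blast
  qed
qed

lemma three_gen_subinterval:
  assumes "three_gen l r x" "l \<le> l'" "r' \<le> r"
  shows "three_gen l' r' x"
proof -
  have right: "three_gen l (r - int k) x" if "three_gen l r x" for l r k and x :: "int \<Rightarrow> 'a"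
  proof (induction k)
    case (Suc k)
    then show ?case using three_gen_trim[of l "r - int k"] by (simp add: algebra_simps)
  qed (use that in simp)
  have "three_gen l r' x" using right[OF assms(1), of "nat (r - r')"] assms(3) by simp
  from three_gen_mirror[OF this] have "three_gen (- r') (- l') (\<lambda>i. x (- i))"
    using right[of "- r'" "- l" _ "nat (l' - l)"] assms(2) by simp
  from three_gen_mirror[OF this] show ?thesis by simp
qed

section \<open>Translation between lists and functions on the integers\<close>

lemma palindrome_iff_nth:
  "palindrome w \<longleftrightarrow> (\<forall>k<length w. w ! (length w - Suc k) = w ! k)"
  unfolding palindrome_def by (auto simp: list_eq_iff_nth_eq rev_nth)

lemma palindrome_subword_iff:
  assumes "1 \<le> i" "i \<le> j" "j \<le> length u"
  shows "palindrome (subword u i j) \<longleftrightarrow> mirror_on (int i) (int j) (\<lambda>k. u ! nat (k - 1))"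
proof -
  have len: "length (subword u i j) = Suc j - i" using assms by (simp add: subword_def)
  have nth: "subword u i j ! k = u ! (i - 1 + k)" if "k < Suc j - i" for k
    using that assms by (simp add: subword_def)
  have "palindrome (subword u i j) \<longleftrightarrow> (\<forall>k<Suc j - i. u ! (j - 1 - k) = u ! (i - 1 + k))"
    unfolding palindrome_iff_nth len using nth assms
    by (intro all_cong) (auto simp: Suc_diff_le intro!: arg_cong2[where f = "(=)"] arg_cong2[where f = nth])
  also have "\<dots> \<longleftrightarrow> mirror_on (int i) (int j) (\<lambda>k. u ! nat (k - 1))"
    unfolding mirror_on_def
  proof (intro iffI allI impI)
    fix k assume *: "\<forall>k<Suc j - i. u ! (j - 1 - k) = u ! (i - 1 + k)" and k: "int i \<le> k" "k \<le> int j"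
    have "nat (int i + int j - k - 1) = j - 1 - (nat k - i)" "nat (k - 1) = i - 1 + (nat k - i)"
      using k assms by linarith+
    then show "u ! nat (int i + int j - k - 1) = u ! nat (k - 1)"
      using * k assms by (metis Suc_le_eq diff_less_mono le_nat_iff nat_le_iff not_less_eq nat_int_comparison(3) int_nat_eq order_trans nat_le_iff le_imp_less_Suc)
  next
    fix k assume *: "\<forall>k\<ge>int i. k \<le> int j \<longrightarrow> u ! nat (int i + int j - k - 1) = u ! nat (k - 1)"
      and k: "k < Suc j - i"
    have "nat (int i + int j - int (i + k) - 1) = j - 1 - k" "nat (int (i + k) - 1) = i - 1 + k"
      using k assms by linarith+
    then show "u ! (j - 1 - k) = u ! (i - 1 + k)"
      using *[rule_format, of "int (i + k)"] k by simp
  qed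
  finally show ?thesis .
qed

text \<open>A strict bound on an infimum has a witness; writing the bound as \<open>< 4\<close>,
  which is possible in \<open>enat\<close>, turns the infimum into an actual generating set.\<close>

lemma pal_mu_le_3_iff_ex:
  "pal_mu u \<le> 3 \<longleftrightarrow> (\<exists>S\<subseteq>positions (length u). card S \<le> 3 \<and> pal_generates S u)"
proof -
  have "pal_mu u \<le> 3 \<longleftrightarrow> pal_mu u < 4"
    by (cases "pal_mu u") (auto simp: numeral_eq_enat)
  also have "\<dots> \<longleftrightarrow> (\<exists>S\<subseteq>positions (length u). card S \<le> 3 \<and> pal_generates S u)"
  proof
    assume "pal_mu u < 4"
    then obtain S where "S \<subseteq> positions (length u)" "pal_generates S u" "enat (card S) < 4"
      unfolding pal_mu_def Inf_less_iff by blast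
    then show "\<exists>S\<subseteq>positions (length u). card S \<le> 3 \<and> pal_generates S u"
      by (intro exI[of _ S]) (auto simp: numeral_eq_enat)
  next
    assume "\<exists>S\<subseteq>positions (length u). card S \<le> 3 \<and> pal_generates S u"
    then obtain S where "S \<subseteq> positions (length u)" "pal_generates S u" "card S \<le> 3"
      by blast
    moreover from this have "enat (card S) < 4" by (simp add: numeral_eq_enat)
    ultimately show "pal_mu u < 4" unfolding pal_mu_def Inf_less_iff by blast
  qed
  finally show ?thesis .
qed

lemma pal_mu_le_3_iff:
  "pal_mu u \<le> 3 \<longleftrightarrow> three_gen 1 (int (length u)) (\<lambda>i. u ! nat (i - 1))"
proof
  let ?n = "length u"
  assume "pal_mu u \<le> 3"
  then obtain S where S: "S \<subseteq> positions ?n" "card S \<le> 3" and gen: "pal_generates S u"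
    unfolding pal_mu_le_3_iff_ex by blast
  have "positions ?n \<subseteq> {..?n} \<times> {..?n}" by (auto simp: positions_def)
  then have fin: "finite S" using S(1) by (meson finite_SigmaI finite_atMost finite_subset)
  define S' where "S' = (\<lambda>(a, b). (int a, int b)) ` S"
  have pal: "palindromic_at S v \<longleftrightarrow> (\<forall>(a, b)\<in>S'. mirror_on a b (\<lambda>i. v ! nat (i - 1)))"
    if "length v = ?n" for v :: "'c list"
  proof -
    have "palindrome (subword v a b) \<longleftrightarrow> mirror_on (int a) (int b) (\<lambda>i. v ! nat (i - 1))"
      if "(a, b) \<in> S" for a b
      using that S(1) \<open>length v = ?n\<close> by (intro palindrome_subword_iff) (auto simp: positions_def)
    then show ?thesis unfolding palindromic_at_def S'_def by auto
  qed
  have "determines S' {1..int ?n} (\<lambda>i. u ! nat (i - 1))"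
  proof (rule determinesI)
    show "\<forall>(a, b)\<in>S'. mirror_on a b (\<lambda>i. u ! nat (i - 1))"
      using gen pal[of u] by (simp add: pal_generates_def)
  next
    fix v :: "int \<Rightarrow> nat" and i j
    assume v: "\<forall>(a, b)\<in>S'. mirror_on a b v" and ij: "i \<in> {1..int ?n}" "j \<in> {1..int ?n}" "u ! nat (i - 1) = u ! nat (j - 1)"
    define vl where "vl = map (\<lambda>k. v (int k + 1)) [0..<?n]"
    have vl: "vl ! nat (i - 1) = v i" if "1 \<le> i" "i \<le> int ?n" for i
    proof -
      have "nat (i - 1) < ?n" using that by linarith
      then show ?thesis using that by (simp add: vl_def)
    qed
    have "mirror_on a b (\<lambda>i. vl ! nat (i - 1))" if "(a, b) \<in> S'" for a b
    proof -
      have "1 \<le> a" "b \<le> int ?n" using that S(1) by (auto simp: S'_def positions_def)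
      then show ?thesis using mirror_on_cong[of a b "\<lambda>i. vl ! nat (i - 1)" v] vl v that by auto
    qed
    then have "palindromic_at S vl" using pal[of vl] by (auto simp: vl_def)
    moreover have "encodes_all_over (UNIV :: nat set) S u"
      using gen by (simp add: pal_generates_def)
    moreover have "vl \<in> lists UNIV" "length vl = ?n" by (auto simp: vl_def)
    ultimately obtain c where "map c u = vl"
      unfolding encodes_all_over_def by blast
    then have "vl ! k = c (u ! k)" if "k < ?n" for k using that by (metis nth_map)
    moreover have "nat (i - 1) < ?n" "nat (j - 1) < ?n" using ij by auto
    ultimately have "vl ! nat (i - 1) = vl ! nat (j - 1)" using ij by simp
    then show "v i = v j" using ij vl by simp
  qed
  moreover have "card S' \<le> 3" using S(2) fin card_image_le[of S "\<lambda>(a, b). (int a, int b)"] by (simp add: S'_def)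
  ultimately show "three_gen 1 (int ?n) (\<lambda>i. u ! nat (i - 1))"
    unfolding three_gen_def using fin S(1) by (intro exI[of _ S']) (auto simp: S'_def positions_def)
next
  let ?n = "length u"
  assume "three_gen 1 (int ?n) (\<lambda>i. u ! nat (i - 1))"
  then obtain S where S: "finite S" "card S \<le> 3" "\<forall>(a, b)\<in>S. 1 \<le> a \<and> b \<le> int ?n"
    and D: "determines S {1..int ?n} (\<lambda>i. u ! nat (i - 1))"
    unfolding three_gen_def by blast
  \<comment> \<open>Empty intervals impose nothing and have no counterpart among the
    \<open>positions\<close>.\<close>
  define S' where "S' = (\<lambda>(a, b). (nat a, nat b)) ` {(a, b)\<in>S. a \<le> b}"
  have "card S' \<le> card {(a, b)\<in>S. a \<le> b}"
    unfolding S'_def by (intro card_image_le finite_subset[OF _ S(1)]) auto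
  also have "\<dots> \<le> card S" using S(1) by (intro card_mono) auto
  finally have card: "card S' \<le> 3" using S(2) by simp
  have sub: "S' \<subseteq> positions ?n" using S(3) by (fastforce simp: S'_def positions_def)
  have pal: "palindromic_at S' v \<longleftrightarrow> (\<forall>(a, b)\<in>S. mirror_on a b (\<lambda>i. v ! nat (i - 1)))"
    if "length v = ?n" for v :: "'c list"
  proof -
    have *: "palindrome (subword v (nat a) (nat b)) \<longleftrightarrow> mirror_on a b (\<lambda>i. v ! nat (i - 1))"
      if "(a, b) \<in> S" "a \<le> b" for a b
    proof -
      have "1 \<le> a" "b \<le> int ?n" using S(3) that by auto
      then show ?thesis
        using palindrome_subword_iff[of "nat a" "nat b" v] that \<open>length v = ?n\<close> by simp
    qed
    have **: "mirror_on a b (\<lambda>i. v ! nat (i - 1))" if "\<not> a \<le> b" for a b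
      using that by (simp add: mirror_on_def)
    have "palindromic_at S' v \<longleftrightarrow> (\<forall>(a, b)\<in>{(a, b)\<in>S. a \<le> b}. mirror_on a b (\<lambda>i. v ! nat (i - 1)))"
      unfolding palindromic_at_def S'_def using * by auto
    then show ?thesis using ** by auto
  qed
  have "encodes_all_over B S' u" for B :: "nat set"
    unfolding encodes_all_over_def
  proof (intro ballI impI)
    fix v assume v: "v \<in> lists B" "length v = ?n" "palindromic_at S' v"
    have vv: "v ! p = v ! q" if "p < ?n" "q < ?n" "u ! p = u ! q" for p q
    proof -
      have *: "\<forall>(a, b)\<in>S. mirror_on a b (\<lambda>i. v ! nat (i - 1))" using v(3) pal[OF v(2)] by simp
      have "\<forall>i\<in>{1..int ?n}. \<forall>j\<in>{1..int ?n}. u ! nat (i - 1) = u ! nat (j - 1) \<longrightarrow> v ! nat (i - 1) = v ! nat (j - 1)"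
        using D * unfolding determines_def by blast
      from this[rule_format, of "int p + 1" "int q + 1"] show ?thesis using that by simp
    qed
    \<comment> \<open>Any position carrying the letter will do: by \<open>vv\<close> the value does
      not depend on the choice.\<close>
    define c where "c = (\<lambda>l. v ! (SOME p. p < ?n \<and> u ! p = l))"
    have "map c u = v"
    proof (rule nth_equalityI)
      fix p assume p: "p < length (map c u)"
      have "(SOME q. q < ?n \<and> u ! q = u ! p) < ?n \<and> u ! (SOME q. q < ?n \<and> u ! q = u ! p) = u ! p"
        by (rule someI[of _ p]) (use p in auto)
      then have "c (u ! p) = v ! p" unfolding c_def using p by (intro vv) auto
      then show "map c u ! p = v ! p" using p by simp
    qed (simp add: v)
    moreover from this have "c ` set u \<subseteq> B" using v(1) by (metis in_lists_conv_set list.set_map subsetI)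
    ultimately show "\<exists>c. c ` set u \<subseteq> B \<and> map c u = v" by blast
  qed
  moreover have "palindromic_at S' u" using D pal[of u] by (simp add: determines_def)
  ultimately show "pal_mu u \<le> 3"
    unfolding pal_mu_le_3_iff_ex pal_generates_def using card sub by blast
qed

section \<open>Periodic words with a reflection symmetry\<close>

definition pattern :: "int \<Rightarrow> int \<Rightarrow> int \<Rightarrow> int \<Rightarrow> (int \<Rightarrow> 'a) \<Rightarrow> bool" where
  "pattern N e a b v \<longleftrightarrow> (\<forall>i. v (i + N) = v i) \<and> (\<forall>i. v (e - i) = v i) \<and> mirror_on a b v"

text \<open>The bi-infinite counterpart of \<open>determines\<close>: \<open>y\<close> is the freest
  word with these symmetries, so its letter classes are exactly the classes of positions that the
  symmetries identify.\<close>

definition generic :: "int \<Rightarrow> int \<Rightarrow> int \<Rightarrow> int \<Rightarrow> (int \<Rightarrow> 'a) \<Rightarrow> bool" where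
  "generic N e a b y \<longleftrightarrow> pattern N e a b y \<and>
     (\<forall>v :: int \<Rightarrow> nat. pattern N e a b v \<longrightarrow> (\<forall>i j. y i = y j \<longrightarrow> v i = v j))"

lemma period_mult:
  fixes v :: "int \<Rightarrow> 'a"
  assumes "\<And>i. v (i + N) = v i"
  shows "v (i + k * N) = v i"
proof -
  have *: "v (i + int m * N) = v i" for m i
  proof (induction m)
    case (Suc m)
    have "v (i + int (Suc m) * N) = v ((i + int m * N) + N)" by (simp add: algebra_simps)
    then show ?case using Suc assms by simp
  qed simp
  show ?thesis
  proof (cases "k \<ge> 0")
    case True
    then show ?thesis using *[of i "nat k"] by simp
  next
    case False
    then show ?thesis using *[of "i + k * N" "nat (- k)"] by (simp add: algebra_simps)
  qed
qed

lemma period_cong: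
  fixes v :: "int \<Rightarrow> 'a"
  assumes "\<And>i. v (i + N) = v i" "[i = j] (mod N)"
  shows "v i = v j"
proof -
  obtain k where "j = i + N * k" using assms(2) by (auto simp: cong_iff_lin)
  then show ?thesis using period_mult[of v N i k] assms(1) by (simp add: mult.commute)
qed

text \<open>The reflections of two palindromes with the same left end whose lengths differ by
  \<open>N\<close> compose to the translation by \<open>N\<close>. So \<open>v\<close> has period
  \<open>N\<close> on the window, and as a full period fits into the window, the periodic
  continuation inherits the reflection on the whole line.\<close>

lemma fold_periodic:
  fixes v :: "int \<Rightarrow> 'a"
  assumes whole: "mirror_on l r v" and pre: "mirror_on l (r - N) v" and N: "1 \<le> N" "N \<le> r - l + 1"
  defines "w \<equiv> \<lambda>i. v (l + (i - l) mod N)"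
  shows "l \<le> i \<Longrightarrow> i \<le> r \<Longrightarrow> w i = v i"
    and "w (i + N) = w i"
    and "w (l + r - i) = w i"
proof -
  have step: "v (i - N) = v i" if "l + N \<le> i" "i \<le> r" for i
    using mirror_onD[OF whole, of i] mirror_onD[OF pre, of "l + r - i"] that N
    by (simp add: algebra_simps)
  have steps: "v (i + int k * N) = v i" if "l \<le> i" "i + int k * N \<le> r" for i k
    using that(2)
  proof (induction k)
    case (Suc k)
    have "0 \<le> int k * N" using N by simp
    then have "l + N \<le> i + int (Suc k) * N" using that(1) by (simp add: algebra_simps)
    from step[OF this Suc.prems] have "v (i + int (Suc k) * N) = v (i + int k * N)"
      by (simp add: algebra_simps)
    moreover have "i + int k * N \<le> r" using Suc.prems N by (simp add: algebra_simps)
    ultimately show ?case using Suc.IH by simp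
  qed simp
  have agree: "w i = v i" if "l \<le> i" "i \<le> r" for i
  proof -
    have "0 \<le> (i - l) div N" using that N by (simp add: pos_imp_zdiv_nonneg_iff)
    then have eq: "l + (i - l) mod N + int (nat ((i - l) div N)) * N = i"
      by (simp add: algebra_simps)
    have "l \<le> l + (i - l) mod N" using N by simp
    from steps[OF this, of "nat ((i - l) div N)"] show ?thesis
      unfolding w_def using eq that by simp
  qed
  then show "l \<le> i \<Longrightarrow> i \<le> r \<Longrightarrow> w i = v i" .
  have per: "w (i + N) = w i" for i
    unfolding w_def using mod_add_self2[of "i - l" N] by (simp add: algebra_simps)
  then show "w (i + N) = w i" .
  define i0 where "i0 = l + (i - l) mod N"
  have i0: "l \<le> i0" "i0 \<le> r"
    using N pos_mod_bound[of N "i - l"] pos_mod_sign[of N "i - l"] unfolding i0_def by linarith+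
  have "[i = i0] (mod N)" by (simp add: i0_def cong_iff_mod_eq mod_simps)
  then have "[l + r - i = l + r - i0] (mod N)" by (intro cong_diff cong_refl)
  then have "w (l + r - i) = w (l + r - i0)" using period_cong[of w N] per by blast
  also have "\<dots> = v (l + r - i0)" using i0 by (intro agree) auto
  also have "\<dots> = v i0" using mirror_onD[OF whole] i0 by blast
  finally show "w (l + r - i) = w i" by (simp add: w_def i0_def)
qed

text \<open>A pattern on the line satisfies the three constraints on the window, and every position
  has a representative modulo \<open>N\<close> inside the window; so freeness on the window gives
  freeness on the line.\<close>

lemma generic_of_determines:
  assumes D: "determines {(l, r), (l, r - N), (a, b)} {l..r} x"
    and N: "1 \<le> N" "N \<le> r - l + 1" and ab: "l \<le> a" "b \<le> r"
  obtains y where "generic N (l + r) a b y" "\<And>i. l \<le> i \<Longrightarrow> i \<le> r \<Longrightarrow> y i = x i"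
proof -
  define y where "y = (\<lambda>i. x (l + (i - l) mod N))"
  have sym: "mirror_on l r x" "mirror_on l (r - N) x" "mirror_on a b x"
    using D by (auto simp: determines_def)
  have y: "y (i + N) = y i" "y (l + r - i) = y i" "l \<le> i \<Longrightarrow> i \<le> r \<Longrightarrow> y i = x i" for i
    unfolding y_def using fold_periodic[OF sym(1,2) N] by auto
  have "mirror_on a b y" using mirror_on_cong[of a b y x] y(3) ab sym(3) by auto
  then have "pattern N (l + r) a b y" using y by (simp add: pattern_def)
  moreover have "v i = v j" if v: "pattern N (l + r) a b v" and ij: "y i = y j" for v :: "int \<Rightarrow> nat" and i j
  proof -
    have vv: "v (i + N) = v i" "v (l + r - i) = v i" for i using v by (auto simp: pattern_def)
    have "v (l + (r - N) - i) = v i" for i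
    proof -
      have "[l + (r - N) - i = l + r - i] (mod N)" by (simp add: cong_iff_dvd_diff)
      then show ?thesis using period_cong[of v N] vv by metis
    qed
    then have "\<forall>(c, d)\<in>{(l, r), (l, r - N), (a, b)}. mirror_on c d v"
      using v vv by (auto simp: pattern_def mirror_on_def)
    moreover have "l + (i - l) mod N \<in> {l..r}" for i
      using N pos_mod_bound[of N "i - l"] pos_mod_sign[of N "i - l"] by (smt (verit) atLeastAtMost_iff)
    ultimately have "v (l + (i - l) mod N) = v (l + (j - l) mod N)"
      using determinesD[OF D] ij unfolding y_def by blast
    moreover have "[l + (i - l) mod N = i] (mod N)" for i by (simp add: cong_iff_mod_eq mod_simps)
    ultimately show ?thesis using period_cong[of v N] vv(1) by metis
  qed
  ultimately show ?thesis using that y(3) unfolding generic_def by blast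
qed

lemma three_gen_of_generic:
  assumes G: "generic N e a b y" and N: "1 \<le> N"
  shows "three_gen l' r' y"
proof -
  \<comment> \<open>A crude size: with the left end \<open>M\<close> periods before
    \<open>a\<close>, the target interval, the translated palindrome and a full period all fit into
    the window.\<close>
  define M where "M = \<bar>a\<bar> + \<bar>b\<bar> + \<bar>e\<bar> + \<bar>l'\<bar> + \<bar>r'\<bar> + N"
  have "M * 1 \<le> M * N" using N by (intro mult_left_mono) (auto simp: M_def)
  then have MN: "M \<le> M * N" by simp
  \<comment> \<open>The translate of [a, b] by \<open>- M * N\<close> starts at the left end of the
    window, and \<open>l + r = e\<close> makes \<open>i -> e - i\<close> the reflection of the whole
    window.\<close>
  define l where "l = a - M * N"
  define r where "r = e - l"
  have bnds: "l \<le> l'" "r' \<le> r" "b - M * N \<le> r" "N \<le> r - l + 1"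
    using MN M_def N unfolding l_def r_def by linarith+
  have P: "pattern N e a b y" and ker: "\<And>v :: int \<Rightarrow> nat. \<And>i j. pattern N e a b v \<Longrightarrow> y i = y j \<Longrightarrow> v i = v j"
    using G unfolding generic_def by blast+
  have shift: "mirror_on l (b - M * N) v \<longleftrightarrow> mirror_on a b v" if per: "\<And>i. v (i + N) = v i" for v :: "int \<Rightarrow> 'c"
  proof -
    have m: "v (i - M * N) = v i" for i using period_mult[of v N i "- M"] per by simp
    show ?thesis
      unfolding mirror_on_def l_def
    proof (intro iffI allI impI)
      fix i assume "\<forall>i\<ge>a - M * N. i \<le> b - M * N \<longrightarrow> v (a - M * N + (b - M * N) - i) = v i" "a \<le> i" "i \<le> b"
      then have "v (a - M * N + (b - M * N) - (i - M * N)) = v (i - M * N)"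
        by (metis diff_right_mono)
      then show "v (a + b - i) = v i" using m[of "a + b - i"] m[of i] by (simp add: algebra_simps)
    next
      fix i assume "\<forall>i\<ge>a. i \<le> b \<longrightarrow> v (a + b - i) = v i" "a - M * N \<le> i" "i \<le> b - M * N"
      then have "v (a + b - (i + M * N)) = v (i + M * N)"
        by (metis diff_le_eq le_diff_eq)
      then show "v (a - M * N + (b - M * N) - i) = v i"
        using m[of "a + b - (i + M * N)"] m[of "i + M * N"] by (simp add: algebra_simps)
    qed
  qed
  have "determines {(l, r), (l, r - N), (l, b - M * N)} {l..r} y"
  proof (rule determinesI)
    have per: "y (i + N) = y i" and sym: "y (e - i) = y i" for i using P by (auto simp: pattern_def)
    have "y (l + (r - N) - i) = y i" for i
    proof -
      have "[l + (r - N) - i = e - i] (mod N)" by (simp add: cong_iff_dvd_diff r_def)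
      then show ?thesis using period_cong[of y N] per sym by metis
    qed
    moreover have "mirror_on l (b - M * N) y" using shift[of y] per P by (simp add: pattern_def)
    ultimately show "\<forall>(c, d)\<in>{(l, r), (l, r - N), (l, b - M * N)}. mirror_on c d y"
      using sym by (auto simp: mirror_on_def r_def)
  next
    fix v :: "int \<Rightarrow> nat" and i j
    assume v: "\<forall>(c, d)\<in>{(l, r), (l, r - N), (l, b - M * N)}. mirror_on c d v"
      and ij: "i \<in> {l..r}" "j \<in> {l..r}" "y i = y j"
    define w where "w = (\<lambda>i. v (l + (i - l) mod N))"
    have w: "w (i + N) = w i" "w (l + r - i) = w i" "l \<le> i \<Longrightarrow> i \<le> r \<Longrightarrow> w i = v i" for i
      unfolding w_def using fold_periodic[of l r v N] v N bnds by auto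
    have "mirror_on l (b - M * N) w"
      using mirror_on_cong[of l "b - M * N" w v] w(3) v bnds by auto
    then have "pattern N e a b w"
      using w shift[of w] by (simp add: pattern_def r_def)
    then have "w i = w j" using ker ij by blast
    then show "v i = v j" using w(3) ij by simp
  qed
  moreover have "card {(l, r), (l, r - N), (l, b - M * N)} \<le> 3"
    by (auto simp: card_insert_if)
  ultimately have "three_gen l r y"
    unfolding three_gen_def using bnds N
    by (intro exI[of _ "{(l, r), (l, r - N), (l, b - M * N)}"]) auto
  then show ?thesis using three_gen_subinterval bnds by blast
qed

text \<open>A palindrome touching an end can be reflected into a prefix, and a palindromic prefix
  that is \<open>N\<close> letters short of a palindromic word yields the period
  \<open>N\<close>.\<close>

lemma generic_of_touching:
  assumes D: "determines {(1, n), (a, b), (c, d)} {1..n} x"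
    and cd: "1 \<le> c" "d \<le> n"
    and touch: "a = 1 \<and> 1 \<le> b \<and> b < n \<or> 1 < a \<and> a \<le> n \<and> b = n"
  obtains N e y where "1 \<le> N" "generic N e c d y" "\<And>i. 1 \<le> i \<Longrightarrow> i \<le> n \<Longrightarrow> y i = x i"
proof -
  have "\<exists>b'. 1 \<le> b' \<and> b' < n \<and> determines {(1, n), (1, b'), (c, d)} {1..n} x"
    using touch
  proof
    assume t: "1 < a \<and> a \<le> n \<and> b = n"
    have "mirror_on a b v \<longleftrightarrow> mirror_on 1 (n + 1 - a) v" if "mirror_on 1 n v" for v :: "int \<Rightarrow> 'c"
      using mirror_on_reflect[OF that, of a b] t by (simp add: algebra_simps)
    then have *: "(\<forall>(c, d)\<in>{(1, n), (a, b), (c, d)}. mirror_on c d v) \<longleftrightarrow>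
        (\<forall>(c, d)\<in>{(1, n), (1, n + 1 - a), (c, d)}. mirror_on c d v)" for v :: "int \<Rightarrow> 'c"
      by auto
    have "determines {(1, n), (1, n + 1 - a), (c, d)} {1..n} x"
      using D by (simp only: determines_def *)
    then show ?thesis using t by (intro exI[of _ "n + 1 - a"]) auto
  qed (use D in blast)
  then obtain b' where b': "1 \<le> b'" "b' < n" and D': "determines {(1, n), (1, n - (n - b')), (c, d)} {1..n} x"
    by auto
  obtain y where "generic (n - b') (1 + n) c d y" "\<And>i. 1 \<le> i \<Longrightarrow> i \<le> n \<Longrightarrow> y i = x i"
    using generic_of_determines[OF D' _ _ cd] b' by auto
  then show ?thesis using that[of "n - b'" "1 + n" y] b' by auto
qed

lemma card_le_3E:
  assumes "finite S" "card S \<le> 3" "A \<in> S"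
  obtains B C where "S = {A, B, C}"
proof -
  have c: "card (S - {A}) \<le> 2" using assms by simp
  have f: "finite (S - {A})" using assms by simp
  consider "card (S - {A}) = 0" | "card (S - {A}) = 1" | "card (S - {A}) = 2" using c by linarith
  then show ?thesis
  proof cases
    case 1
    then have "S - {A} = {}" using f by (metis card_0_eq)
    then have "S = {A, A, A}" using assms(3) by auto
    then show ?thesis using that by blast
  next
    case 2
    then obtain B where "S - {A} = {B}" using card_1_singletonE by blast
    then have "S = {A, B, B}" using assms(3) by auto
    then show ?thesis using that by blast
  next
    case 3
    then obtain B C where "S - {A} = {B, C}" using card_2_iff by metis
    then have "S = {A, B, C}" using assms(3) by auto
    then show ?thesis using that by blast
  qed
qed

text \<open>The exceptional alternatives come from test words. If no palindrome ends at the last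
  position, its indicator satisfies all constraints. If, after unfolding the word across [a, n], the
  other two palindromes avoid the ends, the indicator of both ends does.\<close>

lemma three_gen_cases:
  assumes "three_gen 1 n x" "1 \<le> n"
  obtains (isolated) "\<And>i. 1 \<le> i \<Longrightarrow> i < n \<Longrightarrow> x i \<noteq> x n"
  | (ends) m y where "n \<le> m" "\<And>i. 1 \<le> i \<Longrightarrow> i \<le> n \<Longrightarrow> y i = x i"
      "\<And>i. 1 \<le> i \<Longrightarrow> i \<le> m \<Longrightarrow> y i = y 1 \<longleftrightarrow> i = 1 \<or> i = m"
  | (periodic) N e a b y where "1 \<le> N" "generic N e a b y" "\<And>i. 1 \<le> i \<Longrightarrow> i \<le> n \<Longrightarrow> y i = x i"
proof -
  obtain S where S: "finite S" "card S \<le> 3" "\<forall>(a, b)\<in>S. 1 \<le> a \<and> b \<le> n" and D: "determines S {1..n} x"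
    using assms unfolding three_gen_def by blast
  show ?thesis
  proof (cases "\<exists>a\<le>n. (a, n) \<in> S")
    case False
    define v where "v = (\<lambda>i. if i = n then 1 else 0 :: nat)"
    have "mirror_on a b v" if "(a, b) \<in> S" for a b
    proof -
      have "b \<le> n" "b < n \<or> n < a" using that False S(3) by (auto simp: not_less le_less)
      then show ?thesis by (auto simp: mirror_on_def v_def)
    qed
    then have "x i \<noteq> x n" if "1 \<le> i" "i < n" for i
      using determinesD[OF D, of v i n] that by (auto simp: v_def)
    then show ?thesis using isolated by blast
  next
    case True
    then obtain a where a: "(a, n) \<in> S" "a \<le> n" by blast
    have a1: "1 \<le> a" using S(3) a(1) by blast
    obtain B C where BC: "S = {(a, n), B, C}" using card_le_3E[OF S(1,2) a(1)] .
    obtain b1 b2 c1 c2 where bc: "B = (b1, b2)" "C = (c1, c2)" by (metis surj_pair)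
    have bnd: "1 \<le> b1" "b2 \<le> n" "1 \<le> c1" "c2 \<le> n" using S(3) BC bc by auto
    \<comment> \<open>Reflecting the positions before \<open>a\<close> in the centre of [a, n]
      lengthens the word, and the palindrome now extends over all of [1, m].\<close>
    define m where "m = n + a - 1"
    have nm: "n \<le> m" using a1 by (simp add: m_def)
    define y where "y = (\<lambda>i. if i \<le> n then x i else x (a + n - i))"
    have yx: "y i = x i" if "i \<le> n" for i using that by (simp add: y_def)
    have xs: "mirror_on a n x" "mirror_on b1 b2 x" "mirror_on c1 c2 x"
      using D BC bc by (auto simp: determines_def)
    have whole: "mirror_on 1 m y"
      unfolding mirror_on_def
    proof (intro allI impI)
      fix i assume i: "1 \<le> i" "i \<le> m"
      consider "i < a" | "a \<le> i" "i \<le> n" | "n < i" by linarith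
      then show "y (1 + m - i) = y i"
      proof cases
        case 2
        then show ?thesis using mirror_onD[OF xs(1), of i] by (simp add: y_def m_def algebra_simps)
      qed (use a i in \<open>auto simp: y_def m_def algebra_simps\<close>)
    qed
    have D': "determines {(1, m), (b1, b2), (c1, c2)} {1..m} y"
    proof (rule determinesI)
      have "mirror_on b1 b2 y" "mirror_on c1 c2 y"
        using xs mirror_on_cong[of b1 b2 y x] mirror_on_cong[of c1 c2 y x] yx bnd by auto
      then show "\<forall>(a, b)\<in>{(1, m), (b1, b2), (c1, c2)}. mirror_on a b y" using whole by simp
    next
      fix v :: "int \<Rightarrow> nat" and i j
      assume v: "\<forall>(a, b)\<in>{(1, m), (b1, b2), (c1, c2)}. mirror_on a b v"
        and ij: "i \<in> {1..m}" "j \<in> {1..m}" "y i = y j"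
      define fold where "fold = (\<lambda>i. if i \<le> n then i else a + n - i)"
      have fold: "fold i \<in> {1..n}" "x (fold i) = y i" "v (fold i) = v i" if "i \<in> {1..m}" for i
        using that mirror_onD[of 1 m v i] v a by (auto simp: fold_def y_def m_def algebra_simps)
      have "mirror_on a n v" using mirror_on_inner[of 1 m v a n] v a1 by (simp add: m_def)
      then have "\<forall>(a, b)\<in>S. mirror_on a b v" using v BC bc by simp
      from determinesD[OF D this] show "v i = v j" using fold ij by metis
    qed
    \<comment> \<open>The whole interval does not count as touching: its reflection only exchanges
      the two ends, which the indicator of both ends tolerates. Empty intervals do not count
      either.\<close>
    define touches where "touches = (\<lambda>a b. a = 1 \<and> 1 \<le> b \<and> b < m \<or> 1 < a \<and> a \<le> m \<and> b = m)"
    show ?thesis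
    proof (cases "touches b1 b2 \<or> touches c1 c2")
      case True
      then obtain N e z p q where z: "1 \<le> N" "generic N e p q z" "\<And>i. 1 \<le> i \<Longrightarrow> i \<le> m \<Longrightarrow> z i = y i"
      proof
        assume "touches b1 b2"
        then show ?thesis
          using generic_of_touching[OF D'] that bnd nm unfolding touches_def by (smt (verit, best))
      next
        assume t: "touches c1 c2"
        have "determines {(1, m), (c1, c2), (b1, b2)} {1..m} y" using D' by (simp add: insert_commute)
        then show ?thesis
          using generic_of_touching[of m c1 c2 b1 b2 y] that t bnd nm unfolding touches_def by (smt (verit, best))
      qed
      then show ?thesis using periodic[OF z(1,2)] yx nm by auto
    next
      case False
      define v where "v = (\<lambda>i. if i = 1 \<or> i = m then 1 else 0 :: nat)"
      have *: "mirror_on p q v" if "\<not> touches p q" "1 \<le> p" "q \<le> m" for p q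
        using that unfolding mirror_on_def v_def touches_def by auto
      have "\<not> touches 1 m" by (simp add: touches_def)
      then have vs: "\<forall>(a, b)\<in>{(1, m), (b1, b2), (c1, c2)}. mirror_on a b v"
        using *[of 1 m] *[of b1 b2] *[of c1 c2] False bnd nm by auto
      have m1: "1 \<le> m" using nm assms(2) by simp
      have "y 1 = y m" using mirror_onD[OF whole, of m] m1 by simp
      moreover have "v i = v 1" if "1 \<le> i" "i \<le> m" "y i = y 1" for i
        using determinesD[OF D' vs, of i 1] that m1 by simp
      ultimately have "y i = y 1 \<longleftrightarrow> i = 1 \<or> i = m" if "1 \<le> i" "i \<le> m" for i
        using that by (fastforce simp: v_def split: if_splits)
      then show ?thesis using ends[OF nm] yx by blast
    qed
  qed
qed

section \<open>Reflections of the cyclic group with holes\<close>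

text \<open>A pattern translated so that its palindrome fills the residues \<open>T\<close>, ...,
  \<open>N - 1\<close>. The reflection \<open>i -> T - 1 - i\<close> also permutes the other
  residues 0, ..., \<open>T - 1\<close>, the holes, but imposes nothing there.\<close>

definition punctured :: "int \<Rightarrow> int \<Rightarrow> int \<Rightarrow> (int \<Rightarrow> 'a) \<Rightarrow> bool" where
  "punctured N T e v \<longleftrightarrow> (\<forall>i. v (i + N) = v i) \<and> (\<forall>i. v (e - i) = v i) \<and>
     (\<forall>i. T \<le> i mod N \<longrightarrow> v (T - 1 - i) = v i)"

definition punctured_generic :: "int \<Rightarrow> int \<Rightarrow> int \<Rightarrow> (int \<Rightarrow> 'a) \<Rightarrow> bool" where
  "punctured_generic N T e y \<longleftrightarrow> punctured N T e y \<and>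
     (\<forall>v :: int \<Rightarrow> nat. punctured N T e v \<longrightarrow> (\<forall>i j. y i = y j \<longrightarrow> v i = v j))"

lemma punctured_iff_pattern:
  assumes "0 \<le> T" "T \<le> N" "1 \<le> N"
  shows "punctured N T e v \<longleftrightarrow> pattern N e (T - N) (- 1) v"
proof -
  have "(\<forall>i. T \<le> i mod N \<longrightarrow> v (T - 1 - i) = v i) \<longleftrightarrow> mirror_on (T - N) (- 1) v"
    if per: "\<And>i. v (i + N) = v i"
  proof
    assume *: "\<forall>i. T \<le> i mod N \<longrightarrow> v (T - 1 - i) = v i"
    show "mirror_on (T - N) (- 1) v"
      unfolding mirror_on_def
    proof (intro allI impI)
      fix i assume i: "T - N \<le> i" "i \<le> - 1"
      have "i mod N = (i + N) mod N" by simp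
      also have "\<dots> = i + N" using i assms by (intro mod_pos_pos_trivial) auto
      finally have "v (T - 1 - i) = v i" using * i by simp
      then show "v (T - N + - 1 - i) = v i" using per[of "T - N + - 1 - i"] by (simp add: algebra_simps)
    qed
  next
    assume m: "mirror_on (T - N) (- 1) v"
    show "\<forall>i. T \<le> i mod N \<longrightarrow> v (T - 1 - i) = v i"
    proof (intro allI impI)
      fix i assume i: "T \<le> i mod N"
      have "i mod N < N" using assms by simp
      then have "v (T - N + - 1 - (i mod N - N)) = v (i mod N - N)"
        using mirror_onD[OF m, of "i mod N - N"] i by simp
      moreover have "T - N + - 1 - (i mod N - N) = T - 1 - i mod N" by simp
      moreover have "[T - 1 - i mod N = T - 1 - i] (mod N)" "[i mod N - N = i] (mod N)"
        by (simp_all add: cong_iff_mod_eq mod_simps)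
      ultimately show "v (T - 1 - i) = v i" using period_cong[of v N] per by metis
    qed
  qed
  then show ?thesis unfolding punctured_def pattern_def by blast
qed

lemma punctured_generic_iff:
  assumes "0 \<le> T" "T \<le> N" "1 \<le> N"
  shows "punctured_generic N T e y \<longleftrightarrow> generic N e (T - N) (- 1) y"
  unfolding punctured_generic_def generic_def punctured_iff_pattern[OF assms] ..

lemma ex_reverse:
  fixes \<kappa> :: int
  shows "(\<exists>k. 0 \<le> k \<and> k < \<kappa> \<and> P (c - (k + 1) * d)) \<longleftrightarrow> (\<exists>k. 0 \<le> k \<and> k < \<kappa> \<and> P (c - \<kappa> * d + k * d))"
proof -
  have eq: "c - (\<kappa> - 1 - k + 1) * d = c - \<kappa> * d + k * d" "c - \<kappa> * d + (\<kappa> - 1 - k) * d = c - (k + 1) * d" for k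
    by (simp_all add: algebra_simps)
  show ?thesis
  proof (intro iffI; elim exE conjE)
    fix k assume "0 \<le> k" "k < \<kappa>" "P (c - (k + 1) * d)"
    then show "\<exists>k. 0 \<le> k \<and> k < \<kappa> \<and> P (c - \<kappa> * d + k * d)"
      by (intro exI[of _ "\<kappa> - 1 - k"] conjI) (linarith | simp only: eq)+
  next
    fix k assume "0 \<le> k" "k < \<kappa>" "P (c - \<kappa> * d + k * d)"
    then show "\<exists>k. 0 \<le> k \<and> k < \<kappa> \<and> P (c - (k + 1) * d)"
      by (intro exI[of _ "\<kappa> - 1 - k"] conjI) (linarith | simp only: eq)+
  qed
qed

text \<open>The letter class of a hole \<open>j\<close> is traced by the orbit of \<open>j\<close> under the translation by
  \<open>d\<close>, the product of the two reflections, up to its first return to the holes.\<close>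

lemma first_return:
  fixes y :: "int \<Rightarrow> 'a"
  assumes G: "punctured_generic N T e y" and T: "1 \<le> T" "T \<le> N" and j: "0 \<le> j" "j < T"
    and d_def: "d = T - 1 - e"
  obtains \<kappa> where "1 \<le> \<kappa>" "\<kappa> \<le> N" "(j + \<kappa> * d) mod N < T"
    "\<And>k. 1 \<le> k \<Longrightarrow> k < \<kappa> \<Longrightarrow> T \<le> (j + k * d) mod N"
    "\<And>i. y i = y j \<longleftrightarrow> (\<exists>k. 0 \<le> k \<and> k < \<kappa> \<and> [i = j + k * d] (mod N)) \<or>
      (\<exists>k. 0 \<le> k \<and> k < \<kappa> \<and> [i = T - 1 - j - \<kappa> * d + k * d] (mod N))"
    "\<And>i. 0 \<le> i \<Longrightarrow> i < T \<Longrightarrow> y i = y j \<longleftrightarrow> i = j \<or> i = (T - 1 - j - \<kappa> * d) mod N"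
proof -
  have N: "1 \<le> N" using T by simp
  have jN: "j mod N = j" using j T by simp
  define P where "P = (\<lambda>k :: nat. 1 \<le> k \<and> (j + int k * d) mod N < T)"
  \<comment> \<open>At time \<open>N\<close> the orbit is back at the hole \<open>j\<close>, so a
    first return exists.\<close>
  have PN: "P (nat N)" using N j jN by (simp add: P_def)
  define \<kappa> where "\<kappa> = int (Least P)"
  have "P (Least P)" using PN by (rule LeastI)
  then have \<kappa>: "1 \<le> \<kappa>" "(j + \<kappa> * d) mod N < T" by (auto simp: \<kappa>_def P_def)
  have "Least P \<le> nat N" using PN by (rule Least_le)
  then have \<kappa>N: "\<kappa> \<le> N" using N by (simp add: \<kappa>_def)
  have min: "T \<le> (j + k * d) mod N" if "1 \<le> k" "k < \<kappa>" for k
  proof -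
    have "\<not> P (nat k)" using not_less_Least[of "nat k" P] that by (simp add: \<kappa>_def zless_nat_conj nat_less_iff)
    moreover have "1 \<le> nat k" using that by simp
    ultimately show ?thesis using that by (simp add: P_def)
  qed
  \<comment> \<open>The orbit before its return, together with its image under
    \<open>i -> e - i\<close>. The other reflection would leave \<open>W\<close> only at
    \<open>j\<close> and at the mirror image of the return point, and both of these are
    holes.\<close>
  define W where "W = (\<lambda>i. \<exists>k. 0 \<le> k \<and> k < \<kappa> \<and>
        ([i = j + k * d] (mod N) \<or> [i = T - 1 - j - (k + 1) * d] (mod N)))"
  have hole_refl: "(T - 1 - i) mod N < T" if "i mod N < T" for i
  proof -
    have "0 \<le> i mod N" using N by simp
    have "(T - 1 - i) mod N = (T - 1 - i mod N) mod N" by (simp add: mod_simps)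
    also have "\<dots> = T - 1 - i mod N" using that T \<open>0 \<le> i mod N\<close> by (intro mod_pos_pos_trivial) auto
    finally show ?thesis using \<open>0 \<le> i mod N\<close> by simp
  qed
  have hole_refl': "T \<le> (T - 1 - i) mod N" if "T \<le> i mod N" for i
    using hole_refl[of "T - 1 - i"] that by fastforce
  have Wper: "W i = W i'" if "[i = i'] (mod N)" for i i'
    unfolding W_def using that by (metis cong_sym cong_trans)
  have We: "W (e - i)" if "W i" for i
  proof -
    from that(1) obtain k where k: "0 \<le> k" "k < \<kappa>" "[i = j + k * d] (mod N) \<or> [i = T - 1 - j - (k + 1) * d] (mod N)"
      unfolding W_def by blast
    have "[e - i = e - (j + k * d)] (mod N) \<or> [e - i = e - (T - 1 - j - (k + 1) * d)] (mod N)"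
      using k(3) cong_diff[OF cong_refl[of e N]] by blast
    moreover have "e - (j + k * d) = T - 1 - j - (k + 1) * d" "e - (T - 1 - j - (k + 1) * d) = j + k * d"
      by (simp_all add: d_def algebra_simps)
    ultimately show ?thesis unfolding W_def using k(1,2) by metis
  qed
  have WT: "W (T - 1 - i)" if "W i" "T \<le> i mod N" for i
  proof -
    from that(1) obtain k where k: "0 \<le> k" "k < \<kappa>" "[i = j + k * d] (mod N) \<or> [i = T - 1 - j - (k + 1) * d] (mod N)"
      unfolding W_def by blast
    from k(3) show ?thesis
    proof
      assume c: "[i = j + k * d] (mod N)"
      have "k \<noteq> 0" using c that(2) jN j by (auto simp: cong_iff_mod_eq)
      moreover have "[T - 1 - i = T - 1 - (j + k * d)] (mod N)" using c by (intro cong_diff) auto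
      ultimately show ?thesis
        unfolding W_def using k by (intro exI[of _ "k - 1"]) (auto simp: algebra_simps)
    next
      assume c: "[i = T - 1 - j - (k + 1) * d] (mod N)"
      then have "[T - 1 - i = T - 1 - (T - 1 - j - (k + 1) * d)] (mod N)" by (intro cong_diff) auto
      then have c': "[T - 1 - i = j + (k + 1) * d] (mod N)" by (simp add: algebra_simps)
      have "k + 1 \<noteq> \<kappa>"
        using hole_refl'[OF that(2)] c' \<kappa>(2) by (auto simp: cong_iff_mod_eq)
      then show ?thesis unfolding W_def using k c' by (intro exI[of _ "k + 1"]) auto
    qed
  qed
  \<comment> \<open>This indicator has all the symmetries, so the class of \<open>j\<close> in the
    generic \<open>y\<close> cannot exceed \<open>W\<close>.\<close>
  define v where "v = (\<lambda>i. if W i then 1 else 0 :: nat)"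
  have "punctured N T e v"
    unfolding punctured_def
  proof (intro conjI allI impI)
    fix i
    show "v (i + N) = v i" using Wper[of "i + N" i] by (simp add: v_def cong_iff_mod_eq)
    show "v (e - i) = v i" using We[of i] We[of "e - i"] by (auto simp: v_def)
    show "v (T - 1 - i) = v i" if "T \<le> i mod N"
      using WT[of i] WT[of "T - 1 - i"] that hole_refl' by (auto simp: v_def)
  qed
  then have ker: "v i = v i'" if "y i = y i'" for i i'
    using G that unfolding punctured_generic_def by blast
  have Wj: "W j" unfolding W_def using \<kappa> by (intro exI[of _ 0]) auto
  have ye: "y (e - i) = y i" and yT: "T \<le> i mod N \<Longrightarrow> y (T - 1 - i) = y i" and yper: "y (i + N) = y i" for i
    using G unfolding punctured_generic_def punctured_def by auto
  have orb: "y (j + int k * d) = y j" if "int k < \<kappa>" for k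
    using that
  proof (induction k)
    case (Suc k)
    have "T \<le> (j + int (Suc k) * d) mod N" using min Suc.prems by auto
    from yT[OF this] ye[of "T - 1 - (j + int (Suc k) * d)"]
    have "y (e - (T - 1 - (j + int (Suc k) * d))) = y (j + int (Suc k) * d)" by simp
    moreover have "e - (T - 1 - (j + int (Suc k) * d)) = j + int k * d"
      by (simp add: d_def algebra_simps)
    ultimately have "y (j + int (Suc k) * d) = y (j + int k * d)" by (simp only:)
    then show ?case using Suc by simp
  qed simp
  have orb': "y (j + k * d) = y j" if "0 \<le> k" "k < \<kappa>" for k using orb[of "nat k"] that by simp
  have cls: "y i = y j \<longleftrightarrow> W i" for i
  proof
    assume "y i = y j"
    then show "W i" using ker[of i j] Wj by (auto simp: v_def split: if_splits)
  next
    assume "W i"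
    then obtain k where k: "0 \<le> k" "k < \<kappa>" "[i = j + k * d] (mod N) \<or> [i = T - 1 - j - (k + 1) * d] (mod N)"
      unfolding W_def by blast
    have "e - (T - 1 - j - (k + 1) * d) = j + k * d" by (simp add: d_def algebra_simps)
    then have "y (T - 1 - j - (k + 1) * d) = y j" using ye[of "T - 1 - j - (k + 1) * d"] orb'[OF k(1,2)] by (simp only:)
    then show "y i = y j" using k(3) orb'[OF k(1,2)] period_cong[of y N i, OF yper] by metis
  qed
  have holes: "y i = y j \<longleftrightarrow> i = j \<or> i = (T - 1 - j - \<kappa> * d) mod N" if i: "0 \<le> i" "i < T" for i
  proof -
    have iN: "i mod N = i" using i T by simp
    have "W i \<longleftrightarrow> i = j \<or> i = (T - 1 - j - \<kappa> * d) mod N"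
    proof
      assume "W i"
      then obtain k where k: "0 \<le> k" "k < \<kappa>" "[i = j + k * d] (mod N) \<or> [i = T - 1 - j - (k + 1) * d] (mod N)"
        unfolding W_def by blast
      from k(3) show "i = j \<or> i = (T - 1 - j - \<kappa> * d) mod N"
      proof
        assume c: "[i = j + k * d] (mod N)"
        then have "(j + k * d) mod N < T" using iN i by (simp add: cong_iff_mod_eq)
        then have "k = 0" using min[of k] k by force
        then show ?thesis using c iN jN by (simp add: cong_iff_mod_eq)
      next
        assume c: "[i = T - 1 - j - (k + 1) * d] (mod N)"
        then have "[T - 1 - i = T - 1 - (T - 1 - j - (k + 1) * d)] (mod N)" by (intro cong_diff) auto
        then have "[T - 1 - i = j + (k + 1) * d] (mod N)" by (simp add: algebra_simps)
        then have "(j + (k + 1) * d) mod N < T" using hole_refl[of i] iN i by (simp add: cong_iff_mod_eq)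
        then have "k + 1 = \<kappa>" using min[of "k + 1"] k by force
        then show ?thesis using c iN by (auto simp: cong_iff_mod_eq)
      qed
    next
      assume "i = j \<or> i = (T - 1 - j - \<kappa> * d) mod N"
      then show "W i"
      proof
        assume "i = (T - 1 - j - \<kappa> * d) mod N"
        then show ?thesis unfolding W_def using \<kappa> by (intro exI[of _ "\<kappa> - 1"]) (auto simp: cong_iff_mod_eq)
      qed (use Wj in simp)
    qed
    then show ?thesis using cls by simp
  qed
  have "y i = y j \<longleftrightarrow> (\<exists>k. 0 \<le> k \<and> k < \<kappa> \<and> [i = j + k * d] (mod N)) \<or>
      (\<exists>k. 0 \<le> k \<and> k < \<kappa> \<and> [i = T - 1 - j - \<kappa> * d + k * d] (mod N))" for i
    unfolding cls W_def ex_reverse[of \<kappa> "\<lambda>x. [i = x] (mod N)", symmetric] by blast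
  then show ?thesis using \<kappa>(1) \<kappa>N \<kappa>(2) min holes by (intro that[of \<kappa>])
qed

section \<open>Arithmetic progressions modulo \<open>N\<close>\<close>

lemma multiples_mod:
  fixes d N \<kappa> i :: int
  assumes "[\<kappa> * d = 0] (mod N)" "1 \<le> \<kappa>"
  shows "(\<exists>k. 0 \<le> k \<and> k < \<kappa> \<and> [i = k * d] (mod N)) \<longleftrightarrow> gcd d N dvd i"
proof
  assume "\<exists>k. 0 \<le> k \<and> k < \<kappa> \<and> [i = k * d] (mod N)"
  then obtain k where "[i = k * d] (mod N)" by blast
  then have "gcd d N dvd i - k * d" by (meson cong_iff_dvd_diff dvd_trans gcd_dvd2)
  moreover have "gcd d N dvd k * d" by simp
  ultimately show "gcd d N dvd i" using dvd_diffD by (metis dvd_diff_commute zdvd_zdiffD)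
next
  assume "gcd d N dvd i"
  then obtain c where c: "i = gcd d N * c" by blast
  obtain a b where ab: "a * d + b * N = gcd d N" using bezout_int by metis
  have "[c * (a * d) = c * gcd d N] (mod N)"
    unfolding ab[symmetric] by (simp add: cong_iff_dvd_diff algebra_simps)
  then have i: "[i = (a * c) * d] (mod N)" using c by (simp add: cong_sym algebra_simps)
  define m where "m = (a * c) mod \<kappa>"
  define q where "q = (a * c) div \<kappa>"
  have ac: "a * c = m + q * \<kappa>" by (simp add: m_def q_def)
  have "[m * d + q * (\<kappa> * d) = m * d + q * 0] (mod N)"
    using assms(1) by (rule cong_add[OF cong_refl cong_mult[OF cong_refl]])
  moreover have "(a * c) * d = m * d + q * (\<kappa> * d)" unfolding ac by (simp only: distrib_right mult.assoc)
  ultimately have "[i = m * d] (mod N)" using i cong_trans by fastforce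
  then show "\<exists>k. 0 \<le> k \<and> k < \<kappa> \<and> [i = k * d] (mod N)"
    using assms(2) by (intro exI[of _ m]) (auto simp: m_def)
qed

lemma multiples_mod_shift:
  fixes d N \<kappa> i :: int
  assumes "[\<kappa> * d = 0] (mod N)" "1 \<le> \<kappa>"
  shows "(\<exists>k. 0 \<le> k \<and> k < \<kappa> \<and> [i = p + k * d] (mod N)) \<longleftrightarrow> gcd d N dvd i - p"
proof -
  have "[i = p + k * d] (mod N) \<longleftrightarrow> [i - p = k * d] (mod N)" for k
    by (simp add: cong_iff_dvd_diff algebra_simps)
  then show ?thesis using multiples_mod[OF assms] by presburger
qed

text \<open>Multiplication by \<open>\<kappa>\<close>, the inverse of \<open>d\<close>, straightens
  a progression of step \<open>d\<close> into the arc [0, w). This is how a return time becomes the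
  angle of a rotation.\<close>

lemma unit_multiples_mod:
  fixes d N \<kappa> i :: int
  assumes "[\<kappa> * d = 1] (mod N)" "0 \<le> w" "w \<le> N" "1 \<le> N"
  shows "(\<exists>k. 0 \<le> k \<and> k < w \<and> [i = k * d] (mod N)) \<longleftrightarrow> (i * \<kappa>) mod N < w"
proof
  assume "\<exists>k. 0 \<le> k \<and> k < w \<and> [i = k * d] (mod N)"
  then obtain k where k: "0 \<le> k" "k < w" "[i = k * d] (mod N)" by blast
  have "[i * \<kappa> = k * d * \<kappa>] (mod N)" using k(3) by (intro cong_mult) auto
  moreover have "[k * (\<kappa> * d) = k * 1] (mod N)" using assms(1) by (intro cong_mult) auto
  ultimately have "[i * \<kappa> = k] (mod N)" by (simp add: cong_trans mult.assoc mult.commute mult.left_commute)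
  then show "(i * \<kappa>) mod N < w" using k assms by (simp add: cong_iff_mod_eq)
next
  assume a: "(i * \<kappa>) mod N < w"
  have "[(i * \<kappa>) mod N * d = i * \<kappa> * d] (mod N)" by (simp add: cong_iff_mod_eq mod_simps)
  moreover have "[i * (\<kappa> * d) = i * 1] (mod N)" using assms(1) by (intro cong_mult) auto
  ultimately have "[i = (i * \<kappa>) mod N * d] (mod N)"
    by (metis cong_sym cong_trans mult.assoc mult.right_neutral)
  then show "\<exists>k. 0 \<le> k \<and> k < w \<and> [i = k * d] (mod N)"
    using a assms by (intro exI[of _ "(i * \<kappa>) mod N"]) auto
qed

section \<open>Codings of rotations\<close>

text \<open>The three clauses correspond to no letter, one letter and both letters being doubled.\<close>

definition coded :: "(int \<Rightarrow> bool) \<Rightarrow> bool" where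
  "coded y \<longleftrightarrow>
     (\<exists>a N s t. 0 < s \<and> s \<le> N \<and> (\<forall>i. y i = a \<longleftrightarrow> (t + i * s) mod N < s)) \<or>
     (\<exists>a N s t. 0 < s \<and> 2 * s \<le> N \<and> (\<forall>i. y i = a \<longleftrightarrow> (t + i * s) mod N < 2 * s)) \<or>
     (\<exists>a N s t h. 0 < s \<and> s \<le> N \<and> (\<forall>i. y i = a \<longleftrightarrow> (t + (i + h) div 2 * s) mod N < s))"

lemma coded_single:
  assumes "0 < s" "s \<le> N" "\<And>i. y i = a \<longleftrightarrow> (t + i * s) mod N < s"
  shows "coded y"
  unfolding coded_def by (rule disjI1, rule exI[of _ a], rule exI[of _ N], rule exI[of _ s], rule exI[of _ t]) (intro conjI allI assms)

lemma coded_double: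
  assumes "0 < s" "2 * s \<le> N" "\<And>i. y i = a \<longleftrightarrow> (t + i * s) mod N < 2 * s"
  shows "coded y"
  unfolding coded_def
  by (rule disjI2, rule disjI1, rule exI[of _ a], rule exI[of _ N], rule exI[of _ s], rule exI[of _ t])
    (intro conjI allI assms)

lemma coded_both:
  assumes "0 < s" "s \<le> N" "\<And>i. y i = a \<longleftrightarrow> (t + (i + h) div 2 * s) mod N < s"
  shows "coded y"
  unfolding coded_def
  by (rule disjI2, rule disjI2, rule exI[of _ a], rule exI[of _ N], rule exI[of _ s], rule exI[of _ t], rule exI[of _ h])
    (intro conjI allI assms)

lemma coded_shift:
  assumes "coded (\<lambda>i. y (i + p))"
  shows "coded y"
proof -
  have eq: "t + (i - p) * s = (t - p * s) + i * s" for t i s :: int by (simp add: algebra_simps)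
  have y: "y i = a \<longleftrightarrow> P (i - p)" if "\<forall>i. y (i + p) = a \<longleftrightarrow> P i" for P i a
    using that[rule_format, of "i - p"] by simp
  from assms[unfolded coded_def] show ?thesis
  proof (elim disjE exE conjE)
    fix a N s t assume *: "0 < s" "s \<le> N" "\<forall>i. y (i + p) = a \<longleftrightarrow> (t + i * s) mod N < s"
    show ?thesis using y[OF *(3)] by (intro coded_single[OF *(1,2), of y a "t - p * s"]) (simp add: eq)
  next
    fix a N s t assume *: "0 < s" "2 * s \<le> N" "\<forall>i. y (i + p) = a \<longleftrightarrow> (t + i * s) mod N < 2 * s"
    show ?thesis using y[OF *(3)] by (intro coded_double[OF *(1,2), of y a "t - p * s"]) (simp add: eq)
  next
    fix a N s t h assume *: "0 < s" "s \<le> N" "\<forall>i. y (i + p) = a \<longleftrightarrow> (t + (i + h) div 2 * s) mod N < s"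
    show ?thesis using y[OF *(3)] by (intro coded_both[OF *(1,2), of y a t "h - p"]) (simp add: algebra_simps)
  qed
qed

lemma coded_dvd:
  assumes "\<And>i. y i = a \<longleftrightarrow> g dvd i - p" "1 \<le> g"
  shows "coded y"
proof (rule coded_single)
  show "y i = a \<longleftrightarrow> (- p + i * 1) mod g < 1" for i
  proof -
    have "(- p + i * 1) mod g = (i - p) mod g" "0 \<le> (i - p) mod g" using assms(2) by simp_all
    then show ?thesis unfolding assms(1) dvd_eq_mod_eq_0 by linarith
  qed
qed (use assms in auto)

lemma coded_dvd_pair:
  assumes y: "\<And>i. y i = a \<longleftrightarrow> g dvd i - p \<or> g dvd i - (p + 1)" and g: "1 \<le> g"
  shows "coded y"
\<comment> \<open>For \<open>g = 1\<close> an arc of length 2 does not fit on the circle; every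
  letter is then \<open>a\<close>.\<close>
proof (cases "g = 1")
  case True
  then show ?thesis using y by (intro coded_dvd[of y a 1 p]) auto
next
  case False
  have "g dvd i - p \<or> g dvd i - (p + 1) \<longleftrightarrow> (i - p) mod g < 2" for i
  proof -
    have "g dvd i - (p + 1) \<longleftrightarrow> (i - p) mod g = 1 mod g"
      by (simp add: mod_eq_dvd_iff diff_diff_eq)
    moreover have "1 mod g = 1" using False g by simp
    moreover have "0 \<le> (i - p) mod g" using g by simp
    ultimately show ?thesis by (auto simp: dvd_eq_mod_eq_0)
  qed
  then show ?thesis
    using y g False by (intro coded_double[of 1 g y a "- p"]) auto
qed

text \<open>Without holes the classes are the orbits of a dihedral group: positions are identified
  iff they agree, up to \<open>i -> e - i\<close>, modulo the gcd of \<open>f - e\<close> and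
  \<open>N\<close>. As \<open>y\<close> is binary, one class determines it.\<close>

lemma coded_dihedral:
  fixes y :: "int \<Rightarrow> bool"
  assumes N: "1 \<le> N" and y: "\<And>i. y (i + N) = y i" "\<And>i. y (e - i) = y i" "\<And>i. y (f - i) = y i"
    and ker: "\<And>v :: int \<Rightarrow> nat. \<And>i j. (\<And>i. v (i + N) = v i) \<Longrightarrow> (\<And>i. v (e - i) = v i) \<Longrightarrow>
      (\<And>i. v (f - i) = v i) \<Longrightarrow> y i = y j \<Longrightarrow> v i = v j"
  shows "coded y"
proof -
  define g where "g = gcd (f - e) N"
  have g: "1 \<le> g" using N by (simp add: g_def int_one_le_iff_zero_less)
  have gN: "g dvd N" and gd: "g dvd f - e" by (simp_all add: g_def)
  have yd: "y (i + (f - e)) = y i" for i using y(2)[of i] y(3)[of "e - i"] by (simp add: algebra_simps)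
  have yg: "y i = y i'" if "g dvd i - i'" for i i'
  proof -
    obtain a b where ab: "a * (f - e) + b * N = g" using bezout_int unfolding g_def by metis
    obtain c where "i - i' = g * c" using \<open>g dvd i - i'\<close> by blast
    then have "i = i' + (a * c) * (f - e) + (b * c) * N"
      using ab by (simp add: algebra_simps flip: ab)
    then show ?thesis using period_mult[of y "f - e", OF yd] period_mult[of y N, OF y(1)] by simp
  qed
  \<comment> \<open>A position at the centre of the reflection: its mirror image is itself or the
    next position, so its class is one residue or two adjacent ones.\<close>
  define j where "j = e div 2"
  define W where "W = (\<lambda>i. g dvd i - j \<or> g dvd i - (e - j))"
  define v where "v = (\<lambda>i. if W i then 1 else 0 :: nat)"
  have Wg: "W i = W i'" if "g dvd i - i'" for i i'
  proof -
    have "g dvd i - x \<longleftrightarrow> g dvd i' - x" for x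
      using dvd_add_right_iff[of g "i - i'" "i' - x"] that by (simp add: algebra_simps)
    then show ?thesis by (simp add: W_def)
  qed
  have We: "W (e - i) = W i" for i
  proof -
    have "g dvd e - i - j \<longleftrightarrow> g dvd i - (e - j)"
      using dvd_minus_iff[of g "i - (e - j)"] by (simp add: algebra_simps)
    moreover have "g dvd e - i - (e - j) \<longleftrightarrow> g dvd i - j"
      using dvd_minus_iff[of g "i - j"] by (simp add: algebra_simps)
    ultimately show ?thesis unfolding W_def by blast
  qed
  have "v (i + N) = v i" "v (e - i) = v i" "v (f - i) = v i" for i
    using Wg[of "i + N" i] We[of i] Wg[of "f - i" "e - i"] gN gd by (simp_all add: v_def)
  then have ker': "v i = v j" if "y i = y j" for i using ker[of v i j] that by blast
  have cls: "y i = y j \<longleftrightarrow> W i" for i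
  proof
    assume "y i = y j"
    from ker'[OF this] have "v i = 1" by (simp add: v_def W_def)
    then show "W i" by (simp add: v_def split: if_splits)
  next
    assume "W i"
    then show "y i = y j" unfolding W_def using yg y(2)[of j] by metis
  qed
  have "e - j = j \<or> e - j = j + 1" by (simp add: j_def) presburger
  then show ?thesis
  proof
    assume "e - j = j"
    then show ?thesis using cls g by (intro coded_dvd[of y "y j" g j]) (auto simp: W_def)
  next
    assume "e - j = j + 1"
    then show ?thesis using cls g by (intro coded_dvd_pair[of y "y j" g j]) (auto simp: W_def)
  qed
qed

lemma coded_one_hole:
  assumes G: "punctured_generic N 1 e y" and N: "1 \<le> N"
  shows "coded y"
proof -
  define d where "d = 1 - 1 - e"
  have g: "1 \<le> gcd d N" using N by (simp add: int_one_le_iff_zero_less)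
  obtain \<kappa> where \<kappa>: "1 \<le> \<kappa>" "\<kappa> \<le> N" "(0 + \<kappa> * d) mod N < 1"
    "\<And>k. 1 \<le> k \<Longrightarrow> k < \<kappa> \<Longrightarrow> 1 \<le> (0 + k * d) mod N"
    "\<And>i. y i = y 0 \<longleftrightarrow> (\<exists>k. 0 \<le> k \<and> k < \<kappa> \<and> [i = 0 + k * d] (mod N)) \<or>
      (\<exists>k. 0 \<le> k \<and> k < \<kappa> \<and> [i = 1 - 1 - 0 - \<kappa> * d + k * d] (mod N))"
    "\<And>i. 0 \<le> i \<Longrightarrow> i < 1 \<Longrightarrow> y i = y 0 \<longleftrightarrow> i = 0 \<or> i = (1 - 1 - 0 - \<kappa> * d) mod N"
    by (rule first_return[OF G _ N _ _ d_def, of 0]) simp_all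
  have "(\<kappa> * d) mod N = 0" using \<kappa>(3) pos_mod_sign[of N "0 + \<kappa> * d"] N by (simp add: order_antisym)
  then have z: "[\<kappa> * d = 0] (mod N)" by (simp add: cong_iff_mod_eq)
  have "[i = 1 - 1 - 0 - \<kappa> * d + k * d] (mod N) \<longleftrightarrow> [i = 0 + k * d] (mod N)" for i k
  proof -
    have "[1 - 1 - 0 - \<kappa> * d + k * d = 1 - 1 - 0 - 0 + k * d] (mod N)"
      using z by (intro cong_add cong_diff cong_refl)
    then show ?thesis by (simp add: cong_iff_mod_eq)
  qed
  then have "y i = y 0 \<longleftrightarrow> gcd d N dvd i - 0" for i
    by (simp only: \<kappa>(5) multiples_mod_shift[OF z \<kappa>(1)] disj_absorb)
  then show ?thesis using g by (rule coded_dvd)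
qed

lemma coded_two_holes:
  assumes G: "punctured_generic N 2 e y" and N: "2 \<le> N"
  shows "coded y"
proof -
  define d where "d = 2 - 1 - e"
  have g: "1 \<le> gcd d N" using N by (simp add: int_one_le_iff_zero_less)
  obtain \<kappa> where \<kappa>: "1 \<le> \<kappa>" "\<kappa> \<le> N" "(0 + \<kappa> * d) mod N < 2"
    "\<And>k. 1 \<le> k \<Longrightarrow> k < \<kappa> \<Longrightarrow> 2 \<le> (0 + k * d) mod N"
    "\<And>i. y i = y 0 \<longleftrightarrow> (\<exists>k. 0 \<le> k \<and> k < \<kappa> \<and> [i = 0 + k * d] (mod N)) \<or>
      (\<exists>k. 0 \<le> k \<and> k < \<kappa> \<and> [i = 2 - 1 - 0 - \<kappa> * d + k * d] (mod N))"
    "\<And>i. 0 \<le> i \<Longrightarrow> i < 2 \<Longrightarrow> y i = y 0 \<longleftrightarrow> i = 0 \<or> i = (2 - 1 - 0 - \<kappa> * d) mod N"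
    by (rule first_return[OF G _ N _ _ d_def, of 0]) simp_all
  \<comment> \<open>Hole 0 returns to itself, which gives residue classes, or to hole 1; then
    \<open>\<kappa>\<close> inverts \<open>d\<close> and both orbit segments start at 0.\<close>
  have "(\<kappa> * d) mod N = 0 \<or> (\<kappa> * d) mod N = 1" using \<kappa>(3) N pos_mod_sign[of N "\<kappa> * d"] unfolding add_0 by linarith
  then consider "[\<kappa> * d = 0] (mod N)" | "[\<kappa> * d = 1] (mod N)" using N by (auto simp: cong_iff_mod_eq)
  then show ?thesis
  proof cases
    case 1
    have "[i = 2 - 1 - 0 - \<kappa> * d + k * d] (mod N) \<longleftrightarrow> [i = 1 + k * d] (mod N)" for i k
    proof -
      have "[2 - 1 - 0 - \<kappa> * d + k * d = 2 - 1 - 0 - 0 + k * d] (mod N)"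
        using 1 by (intro cong_add cong_diff cong_refl)
      then show ?thesis by (simp add: cong_iff_mod_eq)
    qed
    then have "y i = y 0 \<longleftrightarrow> gcd d N dvd i - 0 \<or> gcd d N dvd i - (0 + 1)" for i
      unfolding add_0[of 1]
      by (simp only: \<kappa>(5) multiples_mod_shift[OF 1 \<kappa>(1)])
    then show ?thesis using g by (rule coded_dvd_pair)
  next
    case 2
    have *: "[i = 2 - 1 - 0 - \<kappa> * d + k * d] (mod N) \<longleftrightarrow> [i = k * d] (mod N)" for i k
    proof -
      have "[2 - 1 - 0 - \<kappa> * d + k * d = 2 - 1 - 0 - 1 + k * d] (mod N)"
        using 2 by (intro cong_add cong_diff cong_refl)
      then show ?thesis by (simp add: cong_iff_mod_eq)
    qed
    have "0 \<le> \<kappa>" "1 \<le> N" using \<kappa>(1) N by auto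
    note unit = unit_multiples_mod[OF 2 this(1) \<kappa>(2) this(2)]
    have "y i = y 0 \<longleftrightarrow> (0 + i * \<kappa>) mod N < \<kappa>" for i
      by (simp only: \<kappa>(5) * add_0 unit disj_absorb)
    then show ?thesis using \<kappa> by (intro coded_single[of \<kappa> N y "y 0" 0]) auto
  qed
qed

text \<open>The hole to follow is the middle one: it is fixed by \<open>i -> 2 - i\<close>, so its
  two orbit segments are adjacent and, unless it returns to itself, form one progression of length
  \<open>2 * \<kappa>\<close>.\<close>

lemma coded_three_holes:
  assumes G: "punctured_generic N 3 e y" and N: "3 \<le> N"
  shows "coded y"
proof -
  define d where "d = 3 - 1 - e"
  have g: "1 \<le> gcd d N" using N by (simp add: int_one_le_iff_zero_less)
  obtain \<kappa> where \<kappa>: "1 \<le> \<kappa>" "\<kappa> \<le> N" "(1 + \<kappa> * d) mod N < 3"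
    "\<And>k. 1 \<le> k \<Longrightarrow> k < \<kappa> \<Longrightarrow> 3 \<le> (1 + k * d) mod N"
    "\<And>i. y i = y 1 \<longleftrightarrow> (\<exists>k. 0 \<le> k \<and> k < \<kappa> \<and> [i = 1 + k * d] (mod N)) \<or>
      (\<exists>k. 0 \<le> k \<and> k < \<kappa> \<and> [i = 3 - 1 - 1 - \<kappa> * d + k * d] (mod N))"
    "\<And>i. 0 \<le> i \<Longrightarrow> i < 3 \<Longrightarrow> y i = y 1 \<longleftrightarrow> i = 1 \<or> i = (3 - 1 - 1 - \<kappa> * d) mod N"
    by (rule first_return[OF G _ N _ _ d_def, of 1]) simp_all
  have "(1 + \<kappa> * d) mod N = 0 \<or> (1 + \<kappa> * d) mod N = 1 \<or> (1 + \<kappa> * d) mod N = 2"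
    using \<kappa>(3) N pos_mod_sign[of N "1 + \<kappa> * d"] by linarith
  then have "[1 + \<kappa> * d = 0] (mod N) \<or> [1 + \<kappa> * d = 1] (mod N) \<or> [1 + \<kappa> * d = 2] (mod N)"
    using N by (auto simp: cong_iff_mod_eq)
  then consider (zero) "[\<kappa> * d = 0] (mod N)" | (pos) "[\<kappa> * d = 1] (mod N)" | (neg) "[\<kappa> * d = - 1] (mod N)"
    by (auto simp: cong_iff_dvd_diff algebra_simps)
  then show ?thesis
  proof cases
    case zero
    have "[i = 3 - 1 - 1 - \<kappa> * d + k * d] (mod N) \<longleftrightarrow> [i = 1 + k * d] (mod N)" for i k
    proof -
      have "[3 - 1 - 1 - \<kappa> * d + k * d = 3 - 1 - 1 - 0 + k * d] (mod N)"
        using zero by (intro cong_add cong_diff cong_refl)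
      then show ?thesis by (simp add: cong_iff_mod_eq)
    qed
    then have "y i = y 1 \<longleftrightarrow> gcd d N dvd i - 1" for i
      by (simp only: \<kappa>(5) multiples_mod_shift[OF zero \<kappa>(1)] disj_absorb)
    then show ?thesis using g by (rule coded_dvd)
  next
    case pos
    \<comment> \<open>After \<open>N - \<kappa>\<close> steps the orbit of 1 meets the hole 0.
      Minimality of the return time gives \<open>2 * \<kappa> \<le> N\<close>, which the arc of
      double length requires.\<close>
    have "\<kappa> \<noteq> N" using pos N by (auto simp: cong_iff_mod_eq)
    then have "1 \<le> N - \<kappa>" using \<kappa>(2) by simp
    moreover have "1 + (N - \<kappa>) * d = (1 - \<kappa> * d) + d * N" by (simp add: algebra_simps)
    then have "(1 + (N - \<kappa>) * d) mod N = (1 - \<kappa> * d) mod N" by (metis mod_mult_self1)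
    moreover have "(1 - \<kappa> * d) mod N = (1 - 1) mod N"
      using pos cong_diff[OF cong_refl[of 1 N]] unfolding cong_iff_mod_eq by blast
    ultimately have \<kappa>2: "2 * \<kappa> \<le> N" using \<kappa>(4)[of "N - \<kappa>"] by force
    have "y i = y 1 \<longleftrightarrow> (\<exists>k. 0 \<le> k \<and> k < 2 * \<kappa> \<and> [i - (1 - \<kappa> * d) = k * d] (mod N))" for i
    proof -
      have *: "[i = 1 + k * d] (mod N) \<longleftrightarrow> [i - (1 - \<kappa> * d) = (k + \<kappa>) * d] (mod N)"
        "[i = 3 - 1 - 1 - \<kappa> * d + k * d] (mod N) \<longleftrightarrow> [i - (1 - \<kappa> * d) = k * d] (mod N)" for k
        by (simp_all add: cong_iff_dvd_diff algebra_simps)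
      show ?thesis
        unfolding \<kappa>(5) *
      proof (intro iffI; (elim exE conjE disjE)?)
        fix k assume "0 \<le> k" "k < \<kappa>" "[i - (1 - \<kappa> * d) = (k + \<kappa>) * d] (mod N)"
        then show "\<exists>k. 0 \<le> k \<and> k < 2 * \<kappa> \<and> [i - (1 - \<kappa> * d) = k * d] (mod N)"
          using \<kappa>(1) by (intro exI[of _ "k + \<kappa>"]) auto
      next
        fix k assume "0 \<le> k" "k < \<kappa>" "[i - (1 - \<kappa> * d) = k * d] (mod N)"
        then show "\<exists>k. 0 \<le> k \<and> k < 2 * \<kappa> \<and> [i - (1 - \<kappa> * d) = k * d] (mod N)"
          using \<kappa>(1) by (intro exI[of _ k]) auto
      next
        fix k assume k: "0 \<le> k" "k < 2 * \<kappa>" "[i - (1 - \<kappa> * d) = k * d] (mod N)"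
        show "(\<exists>k. 0 \<le> k \<and> k < \<kappa> \<and> [i - (1 - \<kappa> * d) = (k + \<kappa>) * d] (mod N)) \<or>
          (\<exists>k. 0 \<le> k \<and> k < \<kappa> \<and> [i - (1 - \<kappa> * d) = k * d] (mod N))"
        proof (cases "k < \<kappa>")
          case False
          then show ?thesis using k by (intro disjI1 exI[of _ "k - \<kappa>"]) auto
        qed (use k in blast)
      qed
    qed
    moreover have "0 \<le> 2 * \<kappa>" "1 \<le> N" using \<kappa>(1) N by auto
    note unit_multiples_mod[OF pos this(1) \<kappa>2 this(2)]
    ultimately have "y i = y 1 \<longleftrightarrow> ((i - (1 - \<kappa> * d)) * \<kappa>) mod N < 2 * \<kappa>" for i
      by (simp only:)
    then have "y i = y 1 \<longleftrightarrow> ((\<kappa> * d - 1) * \<kappa> + i * \<kappa>) mod N < 2 * \<kappa>" for i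
      by (simp add: algebra_simps)
    then show ?thesis using \<kappa> \<kappa>2 by (intro coded_double[of \<kappa> N y "y 1"]) auto
  next
    case neg
    \<comment> \<open>Now \<open>\<kappa>\<close> inverts \<open>- d\<close>, so the progression is
      read backwards from its last element \<open>1 + (\<kappa> - 1) * d\<close>.\<close>
    have pos: "[\<kappa> * - d = 1] (mod N)" using neg by (metis cong_minus_minus_iff minus_minus mult_minus_right)
    have "\<kappa> \<noteq> N" using neg N by (auto simp: cong_iff_mod_eq zmod_minus1)
    then have "1 \<le> N - \<kappa>" using \<kappa>(2) by simp
    moreover have "1 + (N - \<kappa>) * d = (1 - \<kappa> * d) + d * N" by (simp add: algebra_simps)
    then have "(1 + (N - \<kappa>) * d) mod N = (1 - \<kappa> * d) mod N" by (metis mod_mult_self1)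
    moreover have "(1 - \<kappa> * d) mod N = (1 - (- 1)) mod N"
      using neg cong_diff[OF cong_refl[of 1 N]] unfolding cong_iff_mod_eq by blast
    ultimately have \<kappa>2: "2 * \<kappa> \<le> N" using \<kappa>(4)[of "N - \<kappa>"] N by force
    have "y i = y 1 \<longleftrightarrow> (\<exists>k. 0 \<le> k \<and> k < 2 * \<kappa> \<and> [i - (1 + (\<kappa> - 1) * d) = k * - d] (mod N))" for i
    proof -
      have *: "[i = 1 + k * d] (mod N) \<longleftrightarrow> [i - (1 + (\<kappa> - 1) * d) = (\<kappa> - 1 - k) * - d] (mod N)"
        "[i = 3 - 1 - 1 - \<kappa> * d + k * d] (mod N) \<longleftrightarrow> [i - (1 + (\<kappa> - 1) * d) = (2 * \<kappa> - 1 - k) * - d] (mod N)" for k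
        by (simp_all add: cong_iff_dvd_diff algebra_simps)
      show ?thesis
        unfolding \<kappa>(5) *
      proof (intro iffI; (elim exE conjE disjE)?)
        fix k assume "0 \<le> k" "k < \<kappa>" "[i - (1 + (\<kappa> - 1) * d) = (\<kappa> - 1 - k) * - d] (mod N)"
        then show "\<exists>k. 0 \<le> k \<and> k < 2 * \<kappa> \<and> [i - (1 + (\<kappa> - 1) * d) = k * - d] (mod N)"
          using \<kappa>(1) by (intro exI[of _ "\<kappa> - 1 - k"] conjI) auto
      next
        fix k assume "0 \<le> k" "k < \<kappa>" "[i - (1 + (\<kappa> - 1) * d) = (2 * \<kappa> - 1 - k) * - d] (mod N)"
        then show "\<exists>k. 0 \<le> k \<and> k < 2 * \<kappa> \<and> [i - (1 + (\<kappa> - 1) * d) = k * - d] (mod N)"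
          using \<kappa>(1) by (intro exI[of _ "2 * \<kappa> - 1 - k"] conjI) auto
      next
        fix k assume k: "0 \<le> k" "k < 2 * \<kappa>" "[i - (1 + (\<kappa> - 1) * d) = k * - d] (mod N)"
        have eq: "\<kappa> - 1 - (\<kappa> - 1 - k) = k" "2 * \<kappa> - 1 - (2 * \<kappa> - 1 - k) = k" by auto
        show "(\<exists>k. 0 \<le> k \<and> k < \<kappa> \<and> [i - (1 + (\<kappa> - 1) * d) = (\<kappa> - 1 - k) * - d] (mod N)) \<or>
          (\<exists>k. 0 \<le> k \<and> k < \<kappa> \<and> [i - (1 + (\<kappa> - 1) * d) = (2 * \<kappa> - 1 - k) * - d] (mod N))"
        proof (cases "k < \<kappa>")
          case True
          then show ?thesis using k by (intro disjI1 exI[of _ "\<kappa> - 1 - k"] conjI) (linarith | simp only: eq)+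
        next
          case False
          then show ?thesis using k by (intro disjI2 exI[of _ "2 * \<kappa> - 1 - k"] conjI) (linarith | simp only: eq)+
        qed
      qed
    qed
    moreover have "0 \<le> 2 * \<kappa>" "1 \<le> N" using \<kappa>(1) N by auto
    note unit_multiples_mod[OF pos this(1) \<kappa>2 this(2)]
    ultimately have "y i = y 1 \<longleftrightarrow> ((i - (1 + (\<kappa> - 1) * d)) * \<kappa>) mod N < 2 * \<kappa>" for i
      by (simp only:)
    then have "y i = y 1 \<longleftrightarrow> (- (1 + (\<kappa> - 1) * d) * \<kappa> + i * \<kappa>) mod N < 2 * \<kappa>" for i
      by (simp add: algebra_simps)
    then show ?thesis using \<kappa> \<kappa>2 by (intro coded_double[of \<kappa> N y "y 1"]) auto
  qed
qed

text \<open>The cases are the holes \<open>m\<close> to which hole 0 can return. Hole 0 then shares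
  its letter with the hole \<open>3 - m\<close>, and as there are only two letters, the other two
  holes share the other one, which constrains a second orbit. For \<open>m = 3\<close> hole 0 is
  alone and three holes are left for one letter, which is impossible.\<close>

lemma coded_four_holes:
  assumes G: "punctured_generic N 4 e y" and N: "4 \<le> N"
  shows "coded y"
proof -
  define d where "d = 4 - 1 - e"
  have g: "1 \<le> gcd d N" using N by (simp add: int_one_le_iff_zero_less)
  obtain p where p: "1 \<le> p" "p \<le> N" "(0 + p * d) mod N < 4"
    "\<And>k. 1 \<le> k \<Longrightarrow> k < p \<Longrightarrow> 4 \<le> (0 + k * d) mod N"
    "\<And>i. y i = y 0 \<longleftrightarrow> (\<exists>k. 0 \<le> k \<and> k < p \<and> [i = 0 + k * d] (mod N)) \<or>
      (\<exists>k. 0 \<le> k \<and> k < p \<and> [i = 4 - 1 - 0 - p * d + k * d] (mod N))"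
    "\<And>i. 0 \<le> i \<Longrightarrow> i < 4 \<Longrightarrow> y i = y 0 \<longleftrightarrow> i = 0 \<or> i = (4 - 1 - 0 - p * d) mod N"
    by (rule first_return[OF G _ N _ _ d_def, of 0]) simp_all
  obtain q where q: "1 \<le> q" "q \<le> N" "(1 + q * d) mod N < 4"
    "\<And>k. 1 \<le> k \<Longrightarrow> k < q \<Longrightarrow> 4 \<le> (1 + k * d) mod N"
    "\<And>i. y i = y 1 \<longleftrightarrow> (\<exists>k. 0 \<le> k \<and> k < q \<and> [i = 1 + k * d] (mod N)) \<or>
      (\<exists>k. 0 \<le> k \<and> k < q \<and> [i = 4 - 1 - 1 - q * d + k * d] (mod N))"
    "\<And>i. 0 \<le> i \<Longrightarrow> i < 4 \<Longrightarrow> y i = y 1 \<longleftrightarrow> i = 1 \<or> i = (4 - 1 - 1 - q * d) mod N"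
    by (rule first_return[OF G _ N _ _ d_def, of 1]) simp_all
  obtain r where r: "1 \<le> r" "r \<le> N" "(2 + r * d) mod N < 4"
    "\<And>k. 1 \<le> k \<Longrightarrow> k < r \<Longrightarrow> 4 \<le> (2 + k * d) mod N"
    "\<And>i. y i = y 2 \<longleftrightarrow> (\<exists>k. 0 \<le> k \<and> k < r \<and> [i = 2 + k * d] (mod N)) \<or>
      (\<exists>k. 0 \<le> k \<and> k < r \<and> [i = 4 - 1 - 2 - r * d + k * d] (mod N))"
    "\<And>i. 0 \<le> i \<Longrightarrow> i < 4 \<Longrightarrow> y i = y 2 \<longleftrightarrow> i = 2 \<or> i = (4 - 1 - 2 - r * d) mod N"
    by (rule first_return[OF G _ N _ _ d_def, of 2]) simp_all
  have small: "x mod N = x" if "0 \<le> x" "x < 4" for x using that N by simp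
  have partner: "(4 - 1 - j - x) mod N = (3 - j - m) mod N" if "[x = m] (mod N)" for j x m
  proof -
    have "[4 - 1 - j - x = 4 - 1 - j - m] (mod N)" using that by (intro cong_diff cong_refl)
    then show ?thesis by (simp add: cong_iff_mod_eq)
  qed
  have "0 \<le> (0 + p * d) mod N" using N by simp
  then have "(p * d) mod N = 0 \<or> (p * d) mod N = 1 \<or> (p * d) mod N = 2 \<or> (p * d) mod N = 3"
    using p(3) unfolding add_0 by linarith
  then consider "[p * d = 0] (mod N)" | "[p * d = 1] (mod N)" | "[p * d = 2] (mod N)" | "[p * d = 3] (mod N)"
    using small by (auto simp: cong_iff_mod_eq)
  then show ?thesis
  proof cases
    case 1
    have "y i = y 0 \<longleftrightarrow> i = 0 \<or> i = 3" if "0 \<le> i" "i < 4" for i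
      using p(6)[OF that] partner[OF 1, of 0] small[of 3] by simp
    then have "y 1 \<noteq> y 0" "y 2 \<noteq> y 0" by simp_all
    then have "y 2 = y 1" by auto
    then have "(4 - 1 - 1 - q * d) mod N = 2" using q(6)[of 2] by simp
    then have "[4 - 1 - 1 - q * d = 2] (mod N)" using small[of 2] by (simp add: cong_iff_mod_eq)
    then have z: "[q * d = 0] (mod N)" by (simp add: cong_iff_dvd_diff)
    have *: "[i = 4 - 1 - 1 - q * d + k * d] (mod N) \<longleftrightarrow> [i = (1 + 1) + k * d] (mod N)" for i k
    proof -
      have "[4 - 1 - 1 - q * d + k * d = 4 - 1 - 1 - 0 + k * d] (mod N)"
        using z by (intro cong_add cong_diff cong_refl)
      then show ?thesis by (simp add: cong_iff_mod_eq)
    qed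
    have "y i = y 1 \<longleftrightarrow> gcd d N dvd i - 1 \<or> gcd d N dvd i - (1 + 1)" for i
      by (simp only: q(5) * multiples_mod_shift[OF z q(1)])
    then show ?thesis using g by (rule coded_dvd_pair)
  next
    \<comment> \<open>This case is contradictory. Here \<open>p\<close> inverts \<open>d\<close> and
      \<open>q\<close> inverts \<open>- d\<close>, and minimality gives \<open>p + q = N\<close>. If
      \<open>2 * p > N\<close>, the orbit of 0 meets hole 2 too early, at time
      \<open>2 * p - N\<close>; if \<open>2 * p < N\<close>, the orbit of 1 meets hole 2 too early,
      at time \<open>p\<close>; equality would make \<open>N\<close> divide 2.\<close>
    case 2
    have "y i = y 0 \<longleftrightarrow> i = 0 \<or> i = 2" if "0 \<le> i" "i < 4" for i
      using p(6)[OF that] partner[OF 2, of 0] small[of 2] by simp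
    then have "y 1 \<noteq> y 0" "y 3 \<noteq> y 0" by simp_all
    then have "y 3 = y 1" by auto
    then have "(4 - 1 - 1 - q * d) mod N = 3" using q(6)[of 3] by simp
    then have "[4 - 1 - 1 - q * d = 3] (mod N)" using small[of 3] by (simp add: cong_iff_mod_eq)
    then have "N dvd 4 - 1 - 1 - q * d - 3" by (simp only: cong_iff_dvd_diff)
    moreover have "4 - 1 - 1 - q * d - 3 = - (q * d + 1)" by simp
    ultimately have qd: "N dvd q * d + 1" by (metis dvd_minus_iff)
    have pd: "N dvd p * d - 1" using 2 by (simp add: cong_iff_dvd_diff)
    have "p \<noteq> N"
    proof
      assume "p = N"
      then have "[0 = 1] (mod N)" using 2 by (simp add: cong_iff_mod_eq)
      then show False using small[of 1] by (simp add: cong_iff_mod_eq)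
    qed
    have "[1 + (N - p) * d = 0] (mod N)"
    proof -
      have "1 + (N - p) * d = N * d - (p * d - 1)" by (simp add: algebra_simps)
      moreover have "N dvd N * d - (p * d - 1)" by (rule dvd_diff[OF dvd_triv_left pd])
      ultimately show ?thesis by (simp only: cong_0_iff)
    qed
    then have "\<not> N - p < q" using q(4)[of "N - p"] p(2) \<open>p \<noteq> N\<close> by (auto simp: cong_iff_mod_eq)
    moreover have "N dvd p + q"
    proof -
      have "p + q = p * (q * d + 1) - q * (p * d - 1)" by (simp add: algebra_simps)
      then show ?thesis using pd qd by (metis dvd_diff dvd_mult)
    qed
    then have "N \<le> p + q" using p(1) q(1) by (intro zdvd_imp_le) auto
    ultimately have pq: "p + q = N" by simp
    have "2 * p < N"
    proof (rule ccontr)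
      assume "\<not> 2 * p < N"
      moreover have "[(2 * p - N) * d = 2] (mod N)"
      proof -
        have "(2 * p - N) * d - 2 = 2 * (p * d - 1) - d * N" by (simp add: algebra_simps)
        then show ?thesis using pd by (metis cong_iff_dvd_diff dvd_diff dvd_mult dvd_triv_right)
      qed
      then have *: "((2 * p - N) * d) mod N = 2" using small[of 2] by (simp add: cong_iff_mod_eq)
      moreover have "2 * p \<noteq> N" using * by auto
      ultimately show False using p(4)[of "2 * p - N"] p(2) \<open>p \<noteq> N\<close> by auto
    qed
    moreover have "[1 + p * d = 1 + 1] (mod N)" using 2 by (intro cong_add cong_refl)
    then have "(1 + p * d) mod N = 2" using small[of 2] by (simp add: cong_iff_mod_eq)
    ultimately show ?thesis using q(4)[of p] p(1) pq by simp
  next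
    case 3
    have *: "y i = y 0 \<longleftrightarrow> i = 0 \<or> i = 1" if "0 \<le> i" "i < 4" for i
      using p(6)[OF that] partner[OF 3, of 0] small[of 1] by simp
    then have "y 2 \<noteq> y 0" "y 3 \<noteq> y 0" by simp_all
    then have "y 3 = y 2" by auto
    then have "(4 - 1 - 2 - r * d) mod N = 3" using r(6)[of 3] by simp
    then have "[4 - 1 - 2 - r * d = 3] (mod N)" using small[of 3] by (simp add: cong_iff_mod_eq)
    then have "N dvd 4 - 1 - 2 - r * d - 3" by (simp only: cong_iff_dvd_diff)
    moreover have "4 - 1 - 2 - r * d - 3 = - (r * d + 2)" by simp
    ultimately have rd: "N dvd r * d + 2" by (metis dvd_minus_iff)
    have pd: "N dvd p * d - 2" using 3 by (simp add: cong_iff_dvd_diff)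
    have "gcd d N dvd p * d - (p * d - 2)"
      using pd by (meson dvd_diff dvd_mult dvd_trans gcd_dvd1 gcd_dvd2)
    then have "gcd d N dvd 2" by simp
    then have "gcd d N \<le> 2" by (rule zdvd_imp_le) simp
    then consider "gcd d N = 1" | "gcd d N = 2" using g by linarith
    then show ?thesis
    proof cases
      case 1
      then obtain x where "[d * x = 1] (mod N)" using cong_solve_coprime_int[of d N] by (auto simp: coprime_iff_gcd_eq_1)
      \<comment> \<open>The time at which the orbit of 0 reaches 1. Minimality of \<open>p\<close>
        and \<open>r\<close> gives \<open>p < m\<close> and \<open>r + 2 * m = N\<close>, but
        \<open>2 * m\<close> is congruent to \<open>p\<close>, which forces
        \<open>2 * m \<ge> N + p\<close>.\<close>
      define m where "m = x mod N"
      have "[d * m = d * x] (mod N)" by (simp add: m_def cong_iff_mod_eq mod_simps)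
      then have "[m * d = 1] (mod N)" using \<open>[d * x = 1] (mod N)\<close> by (simp add: cong_iff_mod_eq mult.commute)
      then have md: "N dvd m * d - 1" and md1: "(m * d) mod N = 1"
        using small[of 1] by (simp_all add: cong_iff_dvd_diff[symmetric] cong_iff_mod_eq)
      have m: "0 \<le> m" "m < N" using N by (simp_all add: m_def)
      have "m \<noteq> 0" using md1 by auto
      then have "\<not> m < p" using p(4)[of m] m md1 by auto
      moreover have "p \<noteq> m" using 3 md1 small[of 2] by (auto simp: cong_iff_mod_eq)
      ultimately have "p < m" by simp
      have "N dvd 2 * m - p"
      proof -
        have "2 * m - p = p * (m * d - 1) - m * (p * d - 2)" by (simp add: algebra_simps)
        then show ?thesis using md pd by (metis dvd_diff dvd_mult)
      qed
      then have "N \<le> 2 * m - p" using \<open>p < m\<close> p(1) by (intro zdvd_imp_le) auto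
      have "N dvd r + 2 * m"
      proof -
        have "r + 2 * m = m * (r * d + 2) - r * (m * d - 1)" by (simp add: algebra_simps)
        then show ?thesis using md rd by (metis dvd_diff dvd_mult)
      qed
      then have "N \<le> r + 2 * m" using m r(1) by (intro zdvd_imp_le) auto
      have "[2 + (N - m) * d = 1] (mod N)"
      proof -
        have "2 + (N - m) * d - 1 = N * d - (m * d - 1)" by (simp add: algebra_simps)
        moreover have "N dvd N * d - (m * d - 1)" by (rule dvd_diff[OF dvd_triv_left md])
        ultimately show ?thesis by (simp only: cong_iff_dvd_diff)
      qed
      then have "(2 + (N - m) * d) mod N = 1" using small[of 1] by (simp add: cong_iff_mod_eq)
      then have "r \<le> N - m" using r(4)[of "N - m"] m by force
      have "N dvd r + 2 * m - N" using \<open>N dvd r + 2 * m\<close> by simp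
      moreover have "r + 2 * m - N < N" using \<open>r \<le> N - m\<close> m by simp
      ultimately have "r + 2 * m = N"
        using \<open>N \<le> r + 2 * m\<close> zdvd_not_zless[of "r + 2 * m - N" N] by force
      then show ?thesis using \<open>N \<le> 2 * m - p\<close> p(1) r(1) by simp
    next
      \<comment> \<open>The two orbit segments are the even and the odd positions over one and the
        same progression modulo \<open>N'\<close>: both letters are doubled.\<close>
      case 2
      then have "2 dvd d" "2 dvd N" by (metis gcd_dvd1, metis gcd_dvd2)
      then obtain d' N' where d': "d = 2 * d'" and N': "N = 2 * N'" by blast
      have N'2: "2 \<le> N'" using N N' by simp
      have pd': "[p * d' = 1] (mod N')"
      proof -
        have "2 * N' dvd 2 * (p * d' - 1)" using pd by (simp add: d' N' algebra_simps)
        then have "N' dvd p * d' - 1" unfolding dvd_mult_cancel_left by simp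
        then show ?thesis by (simp only: cong_iff_dvd_diff)
      qed
      have "(N' * d) mod N = 0" by (simp add: d' N' mult.left_commute)
      then have "p \<le> N'" using p(4)[of N'] N'2 by force
      have "0 \<le> p" "1 \<le> N'" using p(1) N'2 by auto
      note unit = unit_multiples_mod[OF pd' this(1) \<open>p \<le> N'\<close> this(2)]
      have even: "[i = 0 + k * d] (mod N) \<longleftrightarrow> even i \<and> [i div 2 = k * d'] (mod N')" for i k
      proof -
        have "even i" if "2 * N' dvd i - k * (2 * d')"
        proof -
          have "even (i - k * (2 * d'))" using that by (rule dvd_mult_left)
          then show ?thesis by simp
        qed
        moreover have "2 * N' dvd i - k * (2 * d') \<longleftrightarrow> N' dvd i div 2 - k * d'" if "even i"
        proof -
          have "i - k * (2 * d') = 2 * (i div 2 - k * d')" using that by simp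
          then show ?thesis by (simp only: dvd_mult_cancel_left) simp
        qed
        ultimately show ?thesis unfolding cong_iff_dvd_diff d' N' add_0 by blast
      qed
      have odd: "[i = 4 - 1 - 0 - p * d + k * d] (mod N) \<longleftrightarrow> odd i \<and> [i div 2 = k * d'] (mod N')" for i k
      proof -
        have "[4 - 1 - 0 - p * d + k * d = 4 - 1 - 0 - 2 + k * d] (mod N)"
          using 3 by (intro cong_add cong_diff cong_refl)
        then have "[i = 4 - 1 - 0 - p * d + k * d] (mod N) \<longleftrightarrow> [i = 1 + k * d] (mod N)"
          by (simp add: cong_iff_mod_eq)
        also have "\<dots> \<longleftrightarrow> [i - 1 = 0 + k * d] (mod N)" by (simp add: cong_iff_dvd_diff algebra_simps)
        also have "\<dots> \<longleftrightarrow> odd i \<and> [(i - 1) div 2 = k * d'] (mod N')" unfolding even by simp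
        also have "\<dots> \<longleftrightarrow> odd i \<and> [i div 2 = k * d'] (mod N')" by (metis odd_two_times_div_two_succ add_diff_cancel_right' nonzero_mult_div_cancel_left zero_neq_numeral)
        finally show ?thesis .
      qed
      have "y i = y 0 \<longleftrightarrow> (\<exists>k. 0 \<le> k \<and> k < p \<and> [i div 2 = k * d'] (mod N'))" for i
        unfolding p(5) even odd by blast
      then have "y i = y 0 \<longleftrightarrow> (0 + (i + 0) div 2 * p) mod N' < p" for i
        unfolding add_0 add_0_right unit .
      then show ?thesis using p(1) \<open>p \<le> N'\<close> by (intro coded_both[of p N' y "y 0" 0 0]) auto
    qed
  next
    case 4
    have "y i = y 0 \<longleftrightarrow> i = 0" if "0 \<le> i" "i < 4" for i
      using p(6)[OF that] partner[OF 4, of 0] small[of 0] by simp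
    then have "y 1 \<noteq> y 0" "y 2 \<noteq> y 0" "y 3 \<noteq> y 0" by simp_all
    then have "y 2 = y 1" "y 3 = y 1" by auto
    then show ?thesis using q(6)[of 2] q(6)[of 3] by simp
  qed
qed

lemma at_most_four_holes:
  fixes y :: "int \<Rightarrow> bool"
  assumes G: "punctured_generic N T e y" and T: "1 \<le> T" "T \<le> N"
  shows "T \<le> 4"
proof (rule ccontr)
  assume "\<not> T \<le> 4"
  define C where "C = (\<lambda>j. {i \<in> {0..4}. y i = y j})"
  have C: "card (C j) \<le> 2" if "j \<in> {0..4}" for j
  proof -
    have "0 \<le> j" "j < T" using that \<open>\<not> T \<le> 4\<close> by auto
    then obtain q where "\<And>i. 0 \<le> i \<Longrightarrow> i < T \<Longrightarrow> y i = y j \<longleftrightarrow> i = j \<or> i = q"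
      using first_return[OF G T _ _ refl, of j] by metis
    then have "C j \<subseteq> {j, q}" using \<open>\<not> T \<le> 4\<close> by (auto simp: C_def)
    then have "card (C j) \<le> card {j, q}" by (intro card_mono) auto
    also have "\<dots> \<le> 2" by (simp add: card_insert_if)
    finally show ?thesis .
  qed
  have "\<exists>j\<in>{0..4}. {0..4} \<subseteq> C 0 \<union> C j"
  proof (cases "\<exists>j\<in>{0..4}. y j \<noteq> y 0")
    case True
    then obtain j where "j \<in> {0..4}" "y j \<noteq> y 0" by blast
    then show ?thesis by (intro bexI[of _ j]) (auto simp: C_def)
  next
    case False
    then have "{0..4} \<subseteq> C 0" unfolding C_def by blast
    then show ?thesis by (intro bexI[of _ 0]) auto
  qed
  then obtain j where j: "j \<in> {0..4}" "{0..4} \<subseteq> C 0 \<union> C j" by blast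
  have "finite (C i)" for i by (rule finite_subset[of _ "{0..4}"]) (auto simp: C_def)
  then have "card {0..4 :: int} \<le> card (C 0 \<union> C j)" using j(2) by (intro card_mono) auto
  also have "\<dots> \<le> card (C 0) + card (C j)" by (rule card_Un_le)
  also have "\<dots> \<le> 4" using C[of 0] C[OF j(1)] by simp
  finally show False by simp
qed

section \<open>Reduction of a periodic pattern to holes\<close>

lemma pattern_shift: "pattern N (e - 2 * h) (a - h) (b - h) (\<lambda>i. v (i + h)) = pattern N e a b v"
proof -
  have "(\<forall>i. v (i + N + h) = v (i + h)) \<longleftrightarrow> (\<forall>i. v (i + N) = v i)"
    by (metis add.commute add.left_commute diff_add_cancel)
  moreover have "(\<forall>i. v (e - 2 * h - i + h) = v (i + h)) \<longleftrightarrow> (\<forall>i. v (e - i) = v i)"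
  proof (intro iffI allI)
    fix i assume "\<forall>i. v (e - 2 * h - i + h) = v (i + h)"
    from this[rule_format, of "i - h"] show "v (e - i) = v i" by (simp add: algebra_simps)
  next
    fix i assume "\<forall>i. v (e - i) = v i"
    from this[rule_format, of "i + h"] show "v (e - 2 * h - i + h) = v (i + h)" by (simp add: algebra_simps)
  qed
  ultimately show ?thesis unfolding pattern_def mirror_on_shift by blast
qed

lemma generic_shift:
  assumes "generic N e a b y"
  shows "generic N (e - 2 * h) (a - h) (b - h) (\<lambda>i. y (i + h))"
  unfolding generic_def
proof (intro conjI allI impI)
  show "pattern N (e - 2 * h) (a - h) (b - h) (\<lambda>i. y (i + h))"
    using assms by (simp add: pattern_shift generic_def)
next
  fix v :: "int \<Rightarrow> nat" and i j
  assume v: "pattern N (e - 2 * h) (a - h) (b - h) v" and ij: "y (i + h) = y (j + h)"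
  have "pattern N e a b (\<lambda>i. v (i - h))"
    using v pattern_shift[of N e h a b "\<lambda>i. v (i - h)"] by simp
  then have "v (i + h - h) = v (j + h - h)" using assms ij unfolding generic_def by blast
  then show "v i = v j" by simp
qed

lemma coded_of_generic:
  fixes y :: "int \<Rightarrow> bool"
  assumes G: "generic N e a b y" and N: "1 \<le> N"
  shows "coded y"
proof (cases "N \<le> b - a + 1")
  case True
  \<comment> \<open>A palindrome that covers a full period reflects the whole line, so there are no
    holes.\<close>
  have iff: "pattern N e a b v \<longleftrightarrow> (\<forall>i. v (i + N) = v i) \<and> (\<forall>i. v (e - i) = v i) \<and> (\<forall>i. v (a + b - i) = v i)"
    for v :: "int \<Rightarrow> 'c"
  proof -
    have "v (a + b - i) = v i" if m: "mirror_on a b v" and per: "\<And>i. v (i + N) = v i" for i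
    proof -
      define i0 where "i0 = a + (i - a) mod N"
      have "0 \<le> (i - a) mod N" "(i - a) mod N < N" using N by simp_all
      then have "a \<le> i0" "i0 \<le> b" using True unfolding i0_def by linarith+
      then have "v (a + b - i0) = v i0" by (rule mirror_onD[OF m])
      moreover have c: "[i0 = i] (mod N)" by (simp add: i0_def cong_iff_mod_eq mod_simps)
      moreover from c have "[a + b - i0 = a + b - i] (mod N)" by (intro cong_diff cong_refl)
      ultimately show ?thesis using period_cong[of v N, OF per] by metis
    qed
    then show ?thesis unfolding pattern_def by (auto simp: mirror_on_def)
  qed
  show ?thesis
    by (rule coded_dihedral[OF N, of y e "a + b"]) (use G[unfolded generic_def iff] in blast)+
next
  case False
  \<comment> \<open>An empty palindrome is normalised to length 0, so that the number of holes does
    not exceed \<open>N\<close>.\<close>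
  define a' where "a' = min a (b + 1)"
  define T where "T = N - (b + 1 - a')"
  \<comment> \<open>This translation moves the holes to 0, ..., \<open>T - 1\<close>.\<close>
  define h where "h = b + 1"
  have T: "1 \<le> T" "T \<le> N" using False N by (auto simp: T_def a'_def min_def)
  have m: "mirror_on a b v = mirror_on a' b v" for v :: "int \<Rightarrow> 'c"
    by (auto simp: mirror_on_def a'_def min_def)
  have "generic N e a' b y" using G unfolding generic_def pattern_def m .
  then have "generic N (e - 2 * h) (a' - h) (b - h) (\<lambda>i. y (i + h))" by (rule generic_shift)
  moreover have "a' - h = T - N" "b - h = - 1" by (auto simp: T_def h_def)
  moreover have "0 \<le> T" using T by simp
  ultimately have P: "punctured_generic N T (e - 2 * h) (\<lambda>i. y (i + h))"
    by (simp only: punctured_generic_iff[OF _ T(2) N])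
  from at_most_four_holes[OF P T] have "T = 1 \<or> T = 2 \<or> T = 3 \<or> T = 4" using T by linarith
  then have "coded (\<lambda>i. y (i + h))"
    using P T coded_one_hole coded_two_holes coded_three_holes coded_four_holes by blast
  then show ?thesis by (rule coded_shift)
qed

section \<open>Sturmian words from irrational rotations\<close>

lemma factor_of_iff:
  "factor_of w x \<longleftrightarrow> (\<exists>k. \<forall>i<length w. w ! i = x !! (k + i))"
  unfolding factor_of_def by (auto simp: list_eq_iff_nth_eq sdrop_snth)

lemma orbit_dense:
  fixes \<theta> \<rho> :: real
  assumes "\<theta> \<notin> \<rat>" "0 \<le> p" "p < q" "q \<le> 1"
  obtains k :: nat where "p < frac (\<rho> + real k * \<theta>)" "frac (\<rho> + real k * \<theta>) < q"
proof -
  define c where "c = (p + q) / 2"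
  obtain k where k: "\<bar>frac (real k * \<theta>) - frac (c - \<rho>)\<bar> < (q - p) / 2"
    using Kronecker_approx_1_explicit[OF assms(1), of "frac (c - \<rho>)" "(q - p) / 2"] assms
      frac_ge_0[of "c - \<rho>"] frac_lt_1[of "c - \<rho>"] by force
  define \<delta> where "\<delta> = frac (real k * \<theta>) - frac (c - \<rho>)"
  have "\<bar>\<delta>\<bar> < (q - p) / 2" using k by (simp add: \<delta>_def)
  then have \<delta>: "p < c + \<delta>" "c + \<delta> < q" unfolding c_def by (simp_all add: abs_less_iff field_simps)
  have eq: "\<rho> + real k * \<theta> = (c + \<delta>) + of_int (\<lfloor>real k * \<theta>\<rfloor> - \<lfloor>c - \<rho>\<rfloor>)"
    unfolding \<delta>_def frac_def by simp
  have "frac (\<rho> + real k * \<theta>) = c + \<delta>"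
    unfolding frac_unique_iff using \<delta> assms by (auto simp: eq)
  then show ?thesis using that \<delta> by metis
qed

text \<open>For \<open>0 < \<theta> < 1\<close> this is the lower mechanical word of slope
  \<open>\<theta>\<close> and intercept \<open>\<rho>\<close>.\<close>

definition rotation_stream :: "real \<Rightarrow> real \<Rightarrow> bool stream" where
  "rotation_stream \<theta> \<rho> = smap (\<lambda>k. \<lfloor>\<rho> + real (Suc k) * \<theta>\<rfloor> \<noteq> \<lfloor>\<rho> + real k * \<theta>\<rfloor>) (fromN 0)"

lemma rotation_stream_nth:
  "rotation_stream \<theta> \<rho> !! k \<longleftrightarrow> \<lfloor>\<rho> + real (Suc k) * \<theta>\<rfloor> \<noteq> \<lfloor>\<rho> + real k * \<theta>\<rfloor>"
  by (simp add: rotation_stream_def)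

text \<open>The factors of length \<open>m\<close> correspond to the \<open>m + 1\<close> intervals into which the points
  \<open>1 - frac (j * \<theta>)\<close>, for \<open>1 \<le> j \<le> m\<close>, cut the circle.\<close>

lemma sturmian_rotation_stream:
  fixes \<theta> \<rho> :: real
  assumes irr: "\<theta> \<notin> \<rat>" and \<theta>: "0 < \<theta>" "\<theta> < 1"
  shows "sturmian (rotation_stream \<theta> \<rho>)"
  unfolding sturmian_def
proof (intro allI impI)
  fix m :: nat assume "1 \<le> m"
  \<comment> \<open>The word of length \<open>m\<close> read from the point \<open>y\<close> of the
    circle.\<close>
  define W where "W = (\<lambda>y. map (\<lambda>i. \<lfloor>y + real (Suc i) * \<theta>\<rfloor> \<noteq> \<lfloor>y + real i * \<theta>\<rfloor>) [0..<m])"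
  define cut where "cut = (\<lambda>j :: nat. 1 - frac (real j * \<theta>))"
  define P where "P = insert 0 (cut ` {1..m})"
  have mult_irr: "real j * \<theta> \<notin> \<rat>" if "j \<ge> 1" for j
  proof
    assume "real j * \<theta> \<in> \<rat>"
    then have "real j * \<theta> / real j \<in> \<rat>" by (intro Rats_divide) auto
    then show False using irr that by simp
  qed
  have cut01: "0 < cut j" "cut j < 1" if "j \<ge> 1" for j
  proof -
    have "frac (real j * \<theta>) \<noteq> 0" using mult_irr[OF that] Ints_subset_Rats by (auto simp: frac_eq_0_iff)
    then show "0 < cut j" "cut j < 1"
      using frac_lt_1[of "real j * \<theta>"] frac_ge_0[of "real j * \<theta>"] by (auto simp: cut_def)
  qed
  have cut_inj: "inj_on cut {1..m}"
  proof (rule linorder_inj_onI')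
    fix i j :: nat assume ij: "i \<in> {1..m}" "j \<in> {1..m}" "i < j"
    show "cut i \<noteq> cut j"
    proof
      assume "cut i = cut j"
      then have "frac (real i * \<theta>) = frac (real j * \<theta>)" by (simp add: cut_def)
      then have "real (j - i) * \<theta> = of_int (\<lfloor>real j * \<theta>\<rfloor> - \<lfloor>real i * \<theta>\<rfloor>)"
        using ij by (simp add: frac_def of_nat_diff algebra_simps)
      then have "real (j - i) * \<theta> \<in> \<rat>" by (metis Rats_of_int)
      moreover have "1 \<le> j - i" using ij by linarith
      ultimately show False using mult_irr by blast
    qed
  qed
  have finP: "finite P" by (simp add: P_def)
  have "0 \<notin> cut ` {1..m}" using cut01 by fastforce
  then have cardP: "card P = m + 1" using cut_inj by (simp add: P_def card_image)
  have P01: "0 \<le> p" "p < 1" if "p \<in> P" for p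
  proof -
    have "p = 0 \<or> (\<exists>j\<ge>1. p = cut j)" using that by (auto simp: P_def)
    then show "0 \<le> p" "p < 1" using cut01 by (auto intro: less_imp_le)
  qed
  have fl: "\<lfloor>y + real j * \<theta>\<rfloor> = \<lfloor>real j * \<theta>\<rfloor> + (if cut j \<le> y then 1 else 0)" if "0 \<le> y" "y < 1" for y j
  proof -
    have "0 \<le> frac (real j * \<theta>)" "frac (real j * \<theta>) < 1" by (simp_all add: frac_lt_1)
    then have f: "\<lfloor>real j * \<theta>\<rfloor> \<le> real j * \<theta>" "real j * \<theta> < \<lfloor>real j * \<theta>\<rfloor> + 1"
      unfolding frac_def by linarith+
    show ?thesis
    proof (cases "cut j \<le> y")
      case True
      then have "\<lfloor>y + real j * \<theta>\<rfloor> = \<lfloor>real j * \<theta>\<rfloor> + 1"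
        using that f unfolding cut_def frac_def by (intro floor_unique) (simp_all, linarith+)
      then show ?thesis using True by simp
    next
      case False
      then have "\<lfloor>y + real j * \<theta>\<rfloor> = \<lfloor>real j * \<theta>\<rfloor>"
        using that f unfolding cut_def frac_def by (intro floor_unique) linarith+
      then show ?thesis using False by simp
    qed
  qed
  \<comment> \<open>The left end of the interval that contains \<open>y\<close>.\<close>
  define base where "base = (\<lambda>y. Max {c \<in> P. c \<le> y})"
  have base: "base y \<in> P" "W y = W (base y)" if y: "0 \<le> y" "y < 1" for y
  proof -
    have fin: "finite {c \<in> P. c \<le> y}" and "0 \<in> {c \<in> P. c \<le> y}" using finP y by (auto simp: P_def)
    then have "base y \<in> {c \<in> P. c \<le> y}" unfolding base_def by (intro Max_in) auto
    then have b: "base y \<in> P" "base y \<le> y" by auto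
    then show "base y \<in> P" by simp
    have "cut j \<le> y \<longleftrightarrow> cut j \<le> base y" if "j \<le> m" for j
    proof (cases "j = 0")
      case True
      then show ?thesis using y P01[OF b(1)] by (simp add: cut_def)
    next
      case False
      then have "cut j \<in> P" using that by (auto simp: P_def)
      then have "cut j \<le> base y" if "cut j \<le> y" using that fin unfolding base_def by (intro Max_ge) auto
      then show ?thesis using b(2) by auto
    qed
    then have "\<lfloor>y + real j * \<theta>\<rfloor> = \<lfloor>base y + real j * \<theta>\<rfloor>" if "j \<le> m" for j
      using that by (simp only: fl[OF y] fl[OF P01[OF b(1)]])
    then show "W y = W (base y)"
      unfolding W_def by (intro map_cong refl) (simp del: of_nat_Suc)
  qed
  have step: "\<lfloor>y + real (Suc i) * \<theta>\<rfloor> = \<lfloor>y + real i * \<theta>\<rfloor> + (if W y ! i then 1 else 0)" if "i < m" for y i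
  proof -
    have "y + real (Suc i) * \<theta> = (y + real i * \<theta>) + \<theta>" by (simp add: algebra_simps)
    then have "\<lfloor>y + real (Suc i) * \<theta>\<rfloor> = \<lfloor>y + real i * \<theta>\<rfloor> \<or> \<lfloor>y + real (Suc i) * \<theta>\<rfloor> = \<lfloor>y + real i * \<theta>\<rfloor> + 1"
      using \<theta> by linarith
    then show ?thesis using that by (auto simp: W_def)
  qed
  have W_inj: "inj_on W P"
  proof (rule linorder_inj_onI')
    fix p q assume pq: "p \<in> P" "q \<in> P" "p < q"
    \<comment> \<open>The \<open>j\<close>-th floors of \<open>p\<close> and \<open>q\<close>
      differ, as \<open>q\<close> has reached the cut \<open>j\<close> and \<open>p\<close> has not,
      while equal words would force all floors to agree.\<close>
    then obtain j where j: "j \<le> m" "q = cut j" using P01[OF pq(1)] by (auto simp: P_def)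
    show "W p \<noteq> W q"
    proof
      assume eq: "W p = W q"
      have "i \<le> m \<Longrightarrow> \<lfloor>p + real i * \<theta>\<rfloor> = \<lfloor>q + real i * \<theta>\<rfloor>" for i
      proof (induction i)
        case 0
        have "\<lfloor>p\<rfloor> = 0" "\<lfloor>q\<rfloor> = 0" using P01[OF pq(1)] P01[OF pq(2)] by linarith+
        then show ?case by simp
      next
        case (Suc i)
        then show ?case using step[of i p] step[of i q] eq by simp
      qed
      from this[OF j(1)] show False
        using fl[of p j] fl[of q j] P01[OF pq(1)] P01[OF pq(2)] j(2) pq(3) by simp
    qed
  qed
  have factor: "factor_of w (rotation_stream \<theta> \<rho>) \<longleftrightarrow> (\<exists>k::nat. w = W (frac (\<rho> + real k * \<theta>)))"
    if len: "length w = m" for w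
  proof -
    have "rotation_stream \<theta> \<rho> !! (k + i) = W (frac (\<rho> + real k * \<theta>)) ! i" if "i < m" for k i
    proof -
      have "\<rho> + real (k + i') * \<theta> = (frac (\<rho> + real k * \<theta>) + real i' * \<theta>) + of_int \<lfloor>\<rho> + real k * \<theta>\<rfloor>" for i'
        by (simp add: frac_def algebra_simps)
      from this[of i] this[of "Suc i"] show ?thesis
        unfolding rotation_stream_nth using that by (simp add: W_def)
    qed
    then show ?thesis
      unfolding factor_of_iff len using len by (auto simp: list_eq_iff_nth_eq W_def)
  qed
  have "{w. length w = m \<and> factor_of w (rotation_stream \<theta> \<rho>)} = W ` P"
  proof (intro equalityI subsetI)
    fix w assume "w \<in> {w. length w = m \<and> factor_of w (rotation_stream \<theta> \<rho>)}"
    then obtain k where "w = W (frac (\<rho> + real k * \<theta>))" using factor by auto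
    then show "w \<in> W ` P" using base[of "frac (\<rho> + real k * \<theta>)"] by (auto simp: frac_lt_1)
  next
    fix w assume "w \<in> W ` P"
    then obtain p where p: "p \<in> P" "w = W p" by blast
    \<comment> \<open>The right end of the interval starting at \<open>p\<close>; density brings the
      orbit into its interior, so \<open>W p\<close> occurs.\<close>
    define q where "q = Min (insert 1 {c \<in> P. p < c})"
    have fin: "finite (insert 1 {c \<in> P. p < c})" using finP by simp
    have "q \<in> insert 1 {c \<in> P. p < c}" unfolding q_def using fin by (intro Min_in) auto
    then have q: "p < q" "q \<le> 1" using P01 p by (auto intro: less_imp_le)
    obtain k :: nat where k: "p < frac (\<rho> + real k * \<theta>)" "frac (\<rho> + real k * \<theta>) < q"
      using orbit_dense[OF irr P01(1)[OF p(1)] q] by blast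
    have "c \<le> p" if "c \<in> P" "c \<le> frac (\<rho> + real k * \<theta>)" for c
    proof (rule ccontr)
      assume "\<not> c \<le> p"
      then have "q \<le> c" unfolding q_def using fin that by (intro Min_le) auto
      then show False using that k by simp
    qed
    then have "base (frac (\<rho> + real k * \<theta>)) = p"
      unfolding base_def using p k finP by (intro Max_eqI) auto
    then have "w = W (frac (\<rho> + real k * \<theta>))"
      using base(2)[of "frac (\<rho> + real k * \<theta>)"] p by (simp add: frac_lt_1)
    moreover have "length w = m" using p by (simp add: W_def)
    ultimately show "w \<in> {w. length w = m \<and> factor_of w (rotation_stream \<theta> \<rho>)}"
      using factor by blast
  qed
  then show "card {w. length w = m \<and> factor_of w (rotation_stream \<theta> \<rho>)} = m + 1"
    using card_image[OF W_inj] cardP by simp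
qed

lemma sturmian_complement:
  assumes "sturmian x"
  shows "sturmian (smap Not x)"
  unfolding sturmian_def
proof (intro allI impI)
  fix m :: nat assume m: "1 \<le> m"
  have NotNot: "map Not (map Not w) = w" for w by (simp add: map_idI)
  have f: "factor_of w (smap Not x) \<longleftrightarrow> factor_of (map Not w) x" for w
    unfolding factor_of_iff by auto
  have "{w. length w = m \<and> factor_of w (smap Not x)} = map Not ` {w. length w = m \<and> factor_of w x}"
  proof (intro equalityI subsetI)
    fix w assume "w \<in> {w. length w = m \<and> factor_of w (smap Not x)}"
    then show "w \<in> map Not ` {w. length w = m \<and> factor_of w x}"
      using f by (intro image_eqI[of _ _ "map Not w"]) (auto simp: NotNot simp del: map_map)
  next
    fix w assume "w \<in> map Not ` {w. length w = m \<and> factor_of w x}"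
    then show "w \<in> {w. length w = m \<and> factor_of w (smap Not x)}"
      using f NotNot by auto
  qed
  moreover have "inj_on (map Not) A" for A by (rule inj_on_inverseI[of _ "map Not"]) (rule NotNot)
  then have "card (map Not ` {w. length w = m \<and> factor_of w x}) = card {w. length w = m \<and> factor_of w x}"
    by (rule card_image)
  ultimately show "card {w. length w = m \<and> factor_of w (smap Not x)} = m + 1"
    using assms m by (simp add: sturmian_def)
qed

text \<open>The slope is raised slightly above \<open>s / N\<close> to an irrational one, and the
  start lies in the middle of a cell of width \<open>1 / N\<close>. Over \<open>L\<close> letters
  the drift stays below half a cell.\<close>

lemma sturmian_rotation_prefix:
  fixes N s t :: int
  assumes s: "0 < s" "s < N"
  obtains x where "sturmian x" "\<And>i. i < L \<Longrightarrow> x !! i \<longleftrightarrow> (t + int i * s) mod N < s"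
proof -
  define \<delta> where "\<delta> = 1 / (2 * real_of_int N * (real L + 1))"
  have N: "0 < real_of_int N" using s by simp
  have \<delta>: "0 < \<delta>" using N by (simp add: \<delta>_def)
  have "uncountable {s / N <..< s / N + \<delta>}" using uncountable_open_interval[of "s / N" "s / N + \<delta>"] \<delta> by simp
  then have "\<not> {s / N <..< s / N + \<delta>} \<subseteq> \<rat>" using countable_rat countable_subset by blast
  then obtain \<theta> where "\<theta> \<in> {s / N <..< s / N + \<delta>}" "\<theta> \<notin> \<rat>" by blast
  then have \<theta>: "s / N < \<theta>" "\<theta> < s / N + \<delta>" "\<theta> \<notin> \<rat>" by auto
  define \<epsilon> where "\<epsilon> = \<theta> - s / N"
  have \<epsilon>: "0 < \<epsilon>" "\<epsilon> < \<delta>" using \<theta> by (auto simp: \<epsilon>_def)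
  have "D * (1 / (2 * N * D)) = 1 / (2 * N)" if "0 < D" for D :: real
    using that N by (simp add: field_simps)
  from this[of "real L + 1"] have L\<delta>: "(real L + 1) * \<delta> = 1 / (2 * N)" by (simp add: \<delta>_def)
  have small: "real k * \<epsilon> < 1 / (2 * N)" if "k \<le> L" for k
  proof -
    have "real k * \<epsilon> \<le> (real L + 1) * \<epsilon>" using that \<epsilon> by (intro mult_right_mono) auto
    also have "\<dots> < (real L + 1) * \<delta>" using \<epsilon> by (intro mult_strict_left_mono) auto
    also note L\<delta>
    finally show ?thesis .
  qed
  have \<epsilon>N: "\<epsilon> < 1 / (2 * N)"
  proof -
    have "1 * \<epsilon> \<le> (real L + 1) * \<epsilon>" using \<epsilon> by (intro mult_right_mono) auto
    also have "\<dots> < (real L + 1) * \<delta>" using \<epsilon> by (intro mult_strict_left_mono) auto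
    also note L\<delta>
    finally show ?thesis by simp
  qed
  have pos: "0 < \<theta>" using \<theta>(1) s N by (smt (verit) divide_pos_pos of_int_0_less_iff)
  have lt1: "\<theta> < 1"
  proof -
    have "\<theta> < s / N + 1 / (2 * N)" using \<epsilon>N by (simp add: \<epsilon>_def)
    also have "\<dots> = (2 * s + 1) / (2 * N)" using N by (simp add: field_simps)
    also have "\<dots> \<le> 1" using s N by (simp add: field_simps)
    finally show ?thesis .
  qed
  \<comment> \<open>The one half centres the point in its cell; \<open>\<theta>\<close> is
    subtracted because the arc test concerns the end of a step and not its start.\<close>
  define \<rho> where "\<rho> = (t + 1/2) / N - \<theta>"
  have "rotation_stream \<theta> \<rho> !! i \<longleftrightarrow> (t + int i * s) mod N < s" if i: "i < L" for i
  proof -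
    define z where "z = t + int i * s"
    define q where "q = z div N"
    define r where "r = z mod N"
    have z: "z = N * q + r" by (simp add: q_def r_def)
    have r: "0 \<le> r" "r < N" using s by (simp_all add: r_def)
    have a: "\<rho> + real (Suc i) * \<theta> = q + (r + 1/2) / N + real i * \<epsilon>"
    proof -
      have "\<rho> + real (Suc i) * \<theta> = (t + 1/2) / N + real i * (s / N + \<epsilon>)"
        by (simp add: \<rho>_def \<epsilon>_def algebra_simps)
      also have "\<dots> = (real_of_int z + 1/2) / N + real i * \<epsilon>"
        by (simp add: z_def add_divide_distrib algebra_simps)
      also have "\<dots> = q + (r + 1/2) / N + real i * \<epsilon>"
        unfolding z using N by (simp add: field_simps)
      finally show ?thesis .
    qed
    have b: "\<rho> + real i * \<theta> = q + (r - s + 1/2) / N + real i * \<epsilon> - \<epsilon>"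
    proof -
      have "\<rho> + real i * \<theta> = (\<rho> + real (Suc i) * \<theta>) - (s / N + \<epsilon>)"
        by (simp add: \<epsilon>_def algebra_simps)
      then show ?thesis unfolding a by (simp add: diff_divide_distrib add_divide_distrib)
    qed
    have iL: "0 \<le> real i * \<epsilon>" "real i * \<epsilon> < 1 / (2 * N)" using \<epsilon> small i by auto
    have "0 \<le> (r + 1/2) / N" using r N by simp
    moreover have "(r + 1/2) / N + 1 / (2 * N) \<le> 1"
    proof -
      have "(r + 1/2) / N + 1 / (2 * N) = (r + 1) / N" using N by (simp add: field_simps)
      also have "\<dots> \<le> 1" using r N by (simp add: field_simps)
      finally show ?thesis .
    qed
    ultimately have fa: "\<lfloor>\<rho> + real (Suc i) * \<theta>\<rfloor> = q"
      unfolding a using iL by (intro floor_unique) linarith+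
    show ?thesis
    proof (cases "r < s")
      case True
      have "(r - s + 1/2) / N + 1 / (2 * N) = (r - s + 1) / N" using N by (simp add: field_simps)
      also have "\<dots> \<le> 0" using True N by (simp add: divide_nonpos_pos)
      finally have "\<rho> + real i * \<theta> < q" unfolding b using iL \<epsilon> by linarith
      then have "\<lfloor>\<rho> + real i * \<theta>\<rfloor> < q" by (simp add: floor_less_iff)
      then show ?thesis unfolding rotation_stream_nth fa using True by (simp add: r_def z_def)
    next
      case False
      have "1 / (2 * N) \<le> (r - s + 1/2) / N" using False N by (simp add: field_simps)
      then have "q \<le> \<rho> + real i * \<theta>" unfolding b using iL \<epsilon>N by linarith
      moreover have "\<rho> + real i * \<theta> \<le> \<rho> + real (Suc i) * \<theta>" using pos by (simp add: algebra_simps)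
      then have "\<lfloor>\<rho> + real i * \<theta>\<rfloor> \<le> q" using fa floor_mono by metis
      ultimately have "\<lfloor>\<rho> + real i * \<theta>\<rfloor> = q" by (simp add: le_floor_iff order_antisym)
      then show ?thesis unfolding rotation_stream_nth fa using False by (simp add: r_def z_def)
    qed
  qed
  then show ?thesis using that sturmian_rotation_stream[OF \<theta>(3) pos lt1] by blast
qed

lemma sturmian_coding_prefix:
  fixes N s t :: int
  assumes s: "0 < s" "s \<le> N"
  obtains x where "sturmian x" "\<And>i. i < L \<Longrightarrow> x !! i = (((t + int i * s) mod N < s) = a)"
proof -
  note witness = that
  \<comment> \<open>Agreement up to a global exchange of the letters is enough, because complements
    of Sturmian words are Sturmian.\<close>
  have signed: ?thesis if "sturmian z" "\<And>i. i < L \<Longrightarrow> z !! i \<longleftrightarrow> (((t + int i * s) mod N < s) = a) = b" for z b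
  proof (cases b)
    case True
    then show ?thesis using that by (intro witness[of z]) auto
  next
    case False
    then show ?thesis using that(2) sturmian_complement[OF that(1)] by (intro witness[of "smap Not z"]) auto
  qed
  show ?thesis
  proof (cases "s = N")
    case True
    then have unary: "(t + int i * s) mod N < s" for i using s by simp
    \<comment> \<open>The constant word is not coded by a rotation with \<open>s < N\<close>. Its
      prefix is imitated by an angle so small that the orbit, started just past the arc, does not
      return within \<open>L\<close> steps.\<close>
    obtain z where "sturmian z" "\<And>i. i < L \<Longrightarrow> z !! i \<longleftrightarrow> (1 + int i * 1) mod (int L + 2) < 1"
      using sturmian_rotation_prefix[of 1 "int L + 2" L 1] by auto
    moreover have "(1 + int i * 1) mod (int L + 2) = 1 + int i" if "i < L" for i
      using that by simp
    ultimately show ?thesis using unary by (intro signed[of z "\<not> a"]) auto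
  next
    case False
    then obtain z where "sturmian z" "\<And>i. i < L \<Longrightarrow> z !! i \<longleftrightarrow> (t + int i * s) mod N < s"
      using sturmian_rotation_prefix[of s N L t] s by auto
    then show ?thesis by (intro signed[of z a]) auto
  qed
qed

lemma factor_of_doubling:
  assumes "sturmian x" "doubling A (stake n x) = q @ u @ r"
  shows "\<exists>y. double_sturmian y \<and> factor_of u y"
proof (intro exI conjI)
  show "double_sturmian (doubling_inf A x)"
    unfolding double_sturmian_def using assms(1) by (intro exI[of _ x] exI[of _ A] exI[of _ 0]) simp
  have "doubling_inf A x = doubling_inf A (stake n x @- sdrop n x)" by (simp add: stake_sdrop)
  also have "\<dots> = q @- u @- r @- doubling_inf A (sdrop n x)"
    unfolding doubling_inf_shift assms(2) by simp
  finally show "factor_of u (doubling_inf A x)"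
    unfolding factor_of_def by (intro exI[of _ "length q"]) (simp add: sdrop_shift stake_shift)
qed

section \<open>Doubled codings\<close>

lemma doubling_Cons: "doubling A (b # w) = (if b \<in> A then [b, b] else [b]) @ doubling A w"
  by (simp add: doubling_def)

text \<open>Deleting the second letter of each doubled block collapses the arc of length \<open>2 * s\<close> to one of
  length \<open>s\<close>: the rotation by \<open>s\<close> modulo \<open>N\<close> induces the rotation by \<open>s\<close> modulo \<open>N - s\<close>.\<close>

lemma doubling_rotation:
  fixes N s \<tau> :: int
  assumes s: "0 < s" "2 * s \<le> N" and \<tau>: "0 \<le> \<tau>" "\<tau> < N - s"
  shows "\<exists>M\<ge>m. doubling {a} (map (\<lambda>i. ((\<tau> + int i * s) mod (N - s) < s) = a) [0..<m]) =
    map (\<lambda>i. (((if \<tau> < s then \<tau> else \<tau> + s) + int i * s) mod N < 2 * s) = a) [0..<M]"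
  using \<tau>
proof (induction m arbitrary: \<tau>)
  case 0
  then show ?case by (intro exI[of _ 0]) (simp add: doubling_def)
next
  case (Suc m)
  define \<tau>' where "\<tau>' = (\<tau> + s) mod (N - s)"
  \<comment> \<open>The position on the larger circle: the arc [0, s) stays, and the rest moves up
    by \<open>s\<close> to make room for the second letters in [s, 2 * s).\<close>
  define \<phi> where "\<phi> = (\<lambda>\<tau>. if \<tau> < s then \<tau> else \<tau> + s)"
  have \<tau>': "0 \<le> \<tau>'" "\<tau>' < N - s" using s by (simp_all add: \<tau>'_def)
  obtain M where M: "m \<le> M" "doubling {a} (map (\<lambda>i. ((\<tau>' + int i * s) mod (N - s) < s) = a) [0..<m]) =
    map (\<lambda>i. ((\<phi> \<tau>' + int i * s) mod N < 2 * s) = a) [0..<M]"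
    using Suc.IH[OF \<tau>'] unfolding \<phi>_def by blast
  have tail: "(\<tau> + int (Suc i) * s) mod (N - s) = (\<tau>' + int i * s) mod (N - s)" for i
    unfolding \<tau>'_def by (simp add: mod_simps algebra_simps)
  \<comment> \<open>A step on the small circle is two steps on the large one at a doubled letter,
    from \<open>\<tau>\<close>, and one step otherwise, from \<open>\<tau> + s\<close>; both lead to
    \<open>\<tau> + 2 * s\<close>.\<close>
  have \<phi>': "[\<phi> \<tau>' = \<tau> + 2 * s] (mod N)"
  proof (cases "\<tau> + s < N - s")
    case True
    then have "\<tau>' = \<tau> + s" using Suc.prems s by (simp add: \<tau>'_def)
    then show ?thesis using Suc.prems by (simp add: \<phi>_def add.commute)
  next
    case False
    have "\<tau>' = (\<tau> + s - (N - s)) mod (N - s)" unfolding \<tau>'_def by (rule minus_mod_self2[symmetric])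
    also have "\<dots> = \<tau> + s - (N - s)" using False Suc.prems s by (intro mod_pos_pos_trivial) auto
    finally have "\<phi> \<tau>' = \<tau> + 2 * s - N" using Suc.prems by (simp add: \<phi>_def)
    then show ?thesis by (simp add: cong_iff_dvd_diff)
  qed
  have rest: "(\<tau> + 2 * s + int i * s) mod N = (\<phi> \<tau>' + int i * s) mod N" for i
    using cong_add[OF \<phi>' cong_refl[of "int i * s"]] unfolding cong_iff_mod_eq by (rule sym)
  have split: "doubling {a} (map (\<lambda>i. ((\<tau> + int i * s) mod (N - s) < s) = a) [0..<Suc m]) =
    (if \<tau> < s then [a, a] else [\<not> a]) @ map (\<lambda>i. ((\<phi> \<tau>' + int i * s) mod N < 2 * s) = a) [0..<M]"
    unfolding M(2)[symmetric] map_upt_Suc tail doubling_Cons using Suc.prems by simp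
  show ?case
  proof (cases "\<tau> < s")
    case True
    have "(\<tau> + int (Suc (Suc i)) * s) mod N = (\<phi> \<tau>' + int i * s) mod N" for i
      unfolding rest[symmetric] by (simp add: algebra_simps)
    moreover have "(\<tau> + int 0 * s) mod N < 2 * s" "(\<tau> + int (Suc 0) * s) mod N < 2 * s"
      using True Suc.prems s by simp_all
    ultimately have "map (\<lambda>i. ((\<tau> + int i * s) mod N < 2 * s) = a) [0..<Suc (Suc M)] =
      [a, a] @ map (\<lambda>i. ((\<phi> \<tau>' + int i * s) mod N < 2 * s) = a) [0..<M]"
      unfolding map_upt_Suc by simp
    then show ?thesis unfolding split using True M(1) by (intro exI[of _ "Suc (Suc M)"]) simp
  next
    case False
    have "(\<tau> + s + int (Suc i) * s) mod N = (\<phi> \<tau>' + int i * s) mod N" for i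
      unfolding rest[symmetric] by (simp add: algebra_simps)
    moreover have "\<not> (\<tau> + s + int 0 * s) mod N < 2 * s"
      using False Suc.prems s by simp
    ultimately have "map (\<lambda>i. ((\<tau> + s + int i * s) mod N < 2 * s) = a) [0..<Suc M] =
      [\<not> a] @ map (\<lambda>i. ((\<phi> \<tau>' + int i * s) mod N < 2 * s) = a) [0..<M]"
      unfolding map_upt_Suc by simp
    then show ?thesis unfolding split using False M(1) by (intro exI[of _ "Suc M"]) simp
  qed
qed

lemma doubling_UNIV: "doubling UNIV (map f [0..<m]) = map (\<lambda>i. f (i div 2)) [0..<2 * m]"
proof (induction m arbitrary: f)
  case 0
  then show ?case by (simp add: doubling_def)
next
  case (Suc m)
  have "[0..<2 * Suc m] = [0..<Suc (Suc (2 * m))]" by simp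
  then show ?case
    unfolding map_upt_Suc[of f m] doubling_Cons Suc.IH by (simp only: map_upt_Suc) simp
qed

lemma window_split:
  assumes "c + L \<le> M"
  shows "map f [0..<M] = map f [0..<c] @ map (\<lambda>i. f (c + i)) [0..<L] @ map f [c + L..<M]"
proof -
  have "[0..<M] = [0..<c] @ [c..<c + L] @ [c + L..<M]"
    using upt_add_eq_append[of 0 c "M - c"] upt_add_eq_append[of c "c + L" "M - c - L"] assms by simp
  moreover have "[c..<c + L] = map (\<lambda>i. c + i) [0..<L]" by (simp add: map_add_upt add.commute)
  ultimately show ?thesis by (simp add: comp_def)
qed

lemma stake_eq_map: "(\<And>i. i < n \<Longrightarrow> x !! i = f i) \<Longrightarrow> stake n x = map f [0..<n]"
  by (simp add: list_eq_iff_nth_eq)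

lemma coded_window_factor:
  assumes "coded y"
  shows "\<exists>z. double_sturmian z \<and> factor_of (map (\<lambda>i. y (k + int i)) [0..<L]) z"
  using assms unfolding coded_def
proof (elim disjE exE conjE)
  fix a N s t assume s: "0 < s" "s \<le> N" and y: "\<forall>i. (y i = a) = ((t + i * s) mod N < s)"
  obtain x where x: "sturmian x" "\<And>i. i < L \<Longrightarrow> x !! i = (((t + k * s + int i * s) mod N < s) = a)"
    using sturmian_coding_prefix[OF s, of L "t + k * s" a] by blast
  have "y (k + int i) = (((t + k * s + int i * s) mod N < s) = a)" for i
    using y[rule_format, of "k + int i"] by (auto simp: algebra_simps)
  then have "stake L x = map (\<lambda>i. y (k + int i)) [0..<L]" using x(2) by (intro stake_eq_map) simp
  moreover have "doubling {} w = w" for w by (induction w) (simp_all add: doubling_def)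
  ultimately have "doubling {} (stake L x) = [] @ map (\<lambda>i. y (k + int i)) [0..<L] @ []" by simp
  then show ?thesis by (rule factor_of_doubling[OF x(1)])
next
  fix a N s t assume s: "0 < s" "2 * s \<le> N" and y: "\<forall>i. (y i = a) = ((t + i * s) mod N < 2 * s)"
  define T where "T = (\<lambda>i. (t + i * s) mod N)"
  \<comment> \<open>A window that starts at the second letter of a doubled block is extended by one
    letter to the left, which completes the block.\<close>
  define c :: nat where "c = (if s \<le> T k \<and> T k < 2 * s then 1 else 0)"
  define k' where "k' = k - int c"
  have T: "0 \<le> T k" "T k < N" using s by (simp_all add: T_def)
  have "T k' = T k - int c * s"
  proof -
    have "T k' = (T k - int c * s) mod N" by (simp add: T_def k'_def mod_simps algebra_simps)
    also have "\<dots> = T k - int c * s" using T s by (intro mod_pos_pos_trivial) (auto simp: c_def)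
    finally show ?thesis .
  qed
  then have T': "0 \<le> T k'" "T k' < N" "T k' < s \<or> 2 * s \<le> T k'" using T s by (auto simp: c_def)
  define \<tau> where "\<tau> = (if T k' < s then T k' else T k' - s)"
  have \<tau>: "0 \<le> \<tau>" "\<tau> < N - s" "(if \<tau> < s then \<tau> else \<tau> + s) = T k'" using T' s by (auto simp: \<tau>_def)
  have s': "s \<le> N - s" using s by simp
  obtain x where x: "sturmian x" "\<And>i. i < Suc L \<Longrightarrow> x !! i = (((\<tau> + int i * s) mod (N - s) < s) = a)"
    using sturmian_coding_prefix[OF s(1) s', of "Suc L" \<tau> a] by blast
  have stake: "stake (Suc L) x = map (\<lambda>i. ((\<tau> + int i * s) mod (N - s) < s) = a) [0..<Suc L]"
    by (rule stake_eq_map) (rule x(2))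
  have "\<exists>M\<ge>Suc L. doubling {a} (stake (Suc L) x) = map (\<lambda>i. ((T k' + int i * s) mod N < 2 * s) = a) [0..<M]"
    using doubling_rotation[OF s \<tau>(1,2), of "Suc L" a] unfolding stake \<tau>(3) .
  then obtain M where M: "Suc L \<le> M" "doubling {a} (stake (Suc L) x) = map (\<lambda>i. ((T k' + int i * s) mod N < 2 * s) = a) [0..<M]"
    by (elim exE conjE)
  have "(((T k' + int i * s) mod N < 2 * s) = a) = y (k' + int i)" for i
  proof -
    have "(T k' + int i * s) mod N = (t + (k' + int i) * s) mod N"
      by (simp add: T_def mod_simps algebra_simps)
    then show ?thesis using y[rule_format, of "k' + int i"] by auto
  qed
  then have "doubling {a} (stake (Suc L) x) = map (\<lambda>i. y (k' + int i)) [0..<M]" using M(2) by simp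
  moreover have cL: "c + L \<le> M" using M(1) by (simp add: c_def)
  moreover have eq: "k' + int (c + i) = k + int i" for i by (simp add: k'_def)
  ultimately have "doubling {a} (stake (Suc L) x) = map (\<lambda>i. y (k' + int i)) [0..<c] @
      map (\<lambda>i. y (k + int i)) [0..<L] @ map (\<lambda>i. y (k' + int i)) [c + L..<M]"
    by (simp only: window_split[OF cL] eq)
  then show ?thesis by (rule factor_of_doubling[OF x(1)])
next
  fix a N s t h assume s: "0 < s" "s \<le> N" and y: "\<forall>i. (y i = a) = ((t + (i + h) div 2 * s) mod N < s)"
  define K where "K = (k + h) div 2"
  define c where "c = nat ((k + h) mod 2)"
  have c: "k + h = 2 * K + int c" "c < 2" by (simp_all add: c_def K_def)
  obtain x where x: "sturmian x" "\<And>i. i < Suc L \<Longrightarrow> x !! i = (((t + K * s + int i * s) mod N < s) = a)"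
    using sturmian_coding_prefix[OF s, of "Suc L" "t + K * s" a] by blast
  have y': "y (k - int c + int i) = (((t + K * s + int (i div 2) * s) mod N < s) = a)" for i
  proof -
    have "k - int c + int i + h = int i + 2 * K" using c by simp
    then have "(k - int c + int i + h) div 2 = K + int (i div 2)" by (simp add: zdiv_int)
    then show ?thesis using y[rule_format, of "k - int c + int i"] by (auto simp: algebra_simps)
  qed
  have "stake (Suc L) x = map (\<lambda>i. ((t + K * s + int i * s) mod N < s) = a) [0..<Suc L]"
    by (rule stake_eq_map) (rule x(2))
  then have "doubling UNIV (stake (Suc L) x) = map (\<lambda>i. y (k - int c + int i)) [0..<2 * Suc L]"
    by (simp only: doubling_UNIV y')
  moreover have cL: "c + L \<le> 2 * Suc L" using c(2) by simp
  moreover have eq: "k - int c + int (c + i) = k + int i" for i by simp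
  ultimately have "doubling UNIV (stake (Suc L) x) = map (\<lambda>i. y (k - int c + int i)) [0..<c] @
      map (\<lambda>i. y (k + int i)) [0..<L] @ map (\<lambda>i. y (k - int c + int i)) [c + L..<2 * Suc L]"
    by (simp only: window_split[OF cL] eq)
  then show ?thesis by (rule factor_of_doubling[OF x(1)])
qed

lemma factor_of_three_gen:
  fixes u :: "bool list"
  assumes "u \<noteq> []" "three_gen 1 (int (length u)) (\<lambda>i. u ! nat (i - 1))"
  shows "\<exists>z. double_sturmian z \<and> factor_of u z"
proof -
  define n where "n = int (length u)"
  define x where "x = (\<lambda>i. u ! nat (i - 1))"
  have n: "1 \<le> n" using assms(1) by (simp add: n_def Suc_le_eq)
  have gen: "three_gen 1 n x" using assms(2) by (simp add: n_def x_def)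
  have "\<exists>y. coded y \<and> (\<forall>i. 1 \<le> i \<longrightarrow> i \<le> n \<longrightarrow> y i = x i)"
  proof (cases rule: three_gen_cases[OF gen n])
    case 1
    \<comment> \<open>Modulo \<open>n\<close> the arc of length 1 is met in the window only at
      \<open>i = n\<close>.\<close>
    define y where "y = (\<lambda>i. ((0 + i * 1) mod n < 1) = x n)"
    have "coded y" using n by (intro coded_single[of 1 n y "x n" 0]) (auto simp: y_def)
    moreover have "y i = x i" if i: "1 \<le> i" "i \<le> n" for i
    proof (cases "i = n")
      case False
      then have "i < n" using i by simp
      then have "x i \<noteq> x n" using 1[of i] i by simp
      then show ?thesis using False i by (auto simp: y_def)
    qed (simp add: y_def)
    ultimately show ?thesis by blast
  next
    case (2 m z)
    \<comment> \<open>With this period the arc of length 1 is met exactly at the ends 1 and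
      \<open>m\<close>; the maximum covers \<open>m = 1\<close>.\<close>
    define N where "N = max 1 (m - 1)"
    define y where "y = (\<lambda>i. ((- 1 + i * 1) mod N < 1) = z 1)"
    have "coded y" by (intro coded_single[of 1 N y "z 1" "- 1"]) (auto simp: y_def N_def)
    moreover have "y i = x i" if i: "1 \<le> i" "i \<le> n" for i
    proof -
      have "(- 1 + i * 1) mod N < 1 \<longleftrightarrow> i = 1 \<or> i = m"
      proof (cases "i = m")
        case True
        then show ?thesis using i by (cases "m = 1") (simp_all add: N_def max_def)
      next
        case False
        then have "(- 1 + i * 1) mod N = i - 1" using i 2(1) unfolding N_def by (intro trans[OF mod_pos_pos_trivial]) auto
        then show ?thesis using i False by auto
      qed
      moreover have "z i = x i" using 2(2) i by blast
      moreover have "z i = z 1 \<longleftrightarrow> i = 1 \<or> i = m" using 2(1) 2(3)[of i] i by linarith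
      ultimately show ?thesis by (auto simp: y_def)
    qed
    ultimately show ?thesis by blast
  next
    case (3 N e a b y)
    then show ?thesis using coded_of_generic[OF 3(2,1)] by blast
  qed
  then obtain y where y: "coded y" "\<And>i. 1 \<le> i \<Longrightarrow> i \<le> n \<Longrightarrow> y i = x i" by blast
  have "map (\<lambda>i. y (1 + int i)) [0..<length u] = u"
    using y(2) by (intro nth_equalityI) (auto simp: n_def x_def)
  then show ?thesis using coded_window_factor[OF y(1), of 1 "length u"] by simp
qed

section \<open>Sturmian words are balanced\<close>

definition window :: "'a stream \<Rightarrow> nat \<Rightarrow> nat \<Rightarrow> 'a list" where
  "window x k m = map (\<lambda>i. x !! (k + i)) [0..<m]"

lemma length_window [simp]: "length (window x k m) = m"
  by (simp add: window_def)

lemma nth_window [simp]: "i < m \<Longrightarrow> window x k m ! i = x !! (k + i)"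
  by (simp add: window_def)

lemma window_Suc: "window x k (Suc m) = window x k m @ [x !! (k + m)]"
  by (simp add: window_def)

lemma window_Suc': "window x k (Suc m) = x !! k # window x (Suc k) m"
  unfolding window_def map_upt_Suc by simp

lemma window_eq_iff: "window x k m = window x l m \<longleftrightarrow> (\<forall>i<m. x !! (k + i) = x !! (l + i))"
  by (auto simp: list_eq_iff_nth_eq)

definition factors :: "'a stream \<Rightarrow> nat \<Rightarrow> 'a list set" where
  "factors x m = range (\<lambda>k. window x k m)"

lemma window_in_factors: "window x k m \<in> factors x m"
  by (simp add: factors_def)

lemma factors_eq: "factors x m = {w. length w = m \<and> factor_of w x}"
  unfolding factors_def factor_of_iff by (auto simp: list_eq_iff_nth_eq)

lemma finite_factors: "finite (factors (x :: bool stream) m)"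
  using finite_lists_length_eq[of "UNIV :: bool set" m] by (rule finite_subset[rotated]) (auto simp: factors_eq)

lemma sturmian_card_factors: "sturmian x \<Longrightarrow> card (factors x m) = m + 1"
proof (cases "m = 0")
  case True
  then have "factors x m = {[]}" by (auto simp: factors_def window_def)
  then show ?thesis using True by simp
qed (simp add: sturmian_def factors_eq)

definition special :: "bool stream \<Rightarrow> nat \<Rightarrow> bool list set" where
  "special x m = {w. w @ [False] \<in> factors x (Suc m) \<and> w @ [True] \<in> factors x (Suc m)}"

text \<open>From length \<open>m\<close> to \<open>m + 1\<close> the number of factors grows by the
  number of right special ones, and a Sturmian word gains exactly one factor.\<close>

lemma sturmian_special:
  assumes "sturmian x"
  obtains z where "special x m = {z}"
proof -
  define A where "A = (\<lambda>b. {w. w @ [b] \<in> factors x (Suc m)})"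
  have "A b \<subseteq> factors x m" for b by (auto simp: A_def factors_def window_Suc)
  then have fin: "finite (A b)" for b using finite_factors finite_subset by blast
  have U: "A False \<union> A True = factors x m"
  proof
    show "factors x m \<subseteq> A False \<union> A True"
    proof
      fix w assume "w \<in> factors x m"
      then obtain k where "w = window x k m" by (auto simp: factors_def)
      then have "w @ [x !! (k + m)] \<in> factors x (Suc m)" by (auto simp: factors_def window_Suc[symmetric])
      then show "w \<in> A False \<union> A True" by (cases "x !! (k + m)") (auto simp: A_def)
    qed
  qed (use \<open>\<And>b. A b \<subseteq> factors x m\<close> in blast)
  have I: "A False \<inter> A True = special x m" by (auto simp: A_def special_def)
  have "factors x (Suc m) = (\<lambda>w. w @ [False]) ` A False \<union> (\<lambda>w. w @ [True]) ` A True"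
  proof (intro equalityI subsetI)
    fix w assume w: "w \<in> factors x (Suc m)"
    then obtain k where k: "w = window x k m @ [x !! (k + m)]" by (auto simp: factors_def window_Suc)
    then show "w \<in> (\<lambda>w. w @ [False]) ` A False \<union> (\<lambda>w. w @ [True]) ` A True"
      using w by (cases "x !! (k + m)") (auto simp: A_def)
  qed (auto simp: A_def)
  then have "card (factors x (Suc m)) = card ((\<lambda>w. w @ [False]) ` A False) + card ((\<lambda>w. w @ [True]) ` A True)"
    using fin by (simp only:) (intro card_Un_disjoint, auto)
  also have "\<dots> = card (A False) + card (A True)" by (simp add: card_image inj_on_def)
  also have "\<dots> = card (factors x m) + card (special x m)"
    using card_Un_Int[OF fin fin, of False True] U I by simp
  finally have "card (special x m) = 1" using sturmian_card_factors[OF assms] by simp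
  then show ?thesis using that card_1_singletonE by blast
qed

definition ones :: "bool stream \<Rightarrow> nat \<Rightarrow> nat \<Rightarrow> int" where
  "ones x k m = (\<Sum>i<m. of_bool (x !! (k + i)))"

lemma ones_0 [simp]: "ones x k 0 = 0"
  by (simp add: ones_def)

lemma ones_Suc: "ones x k (Suc m) = ones x k m + of_bool (x !! (k + m))"
  by (simp add: ones_def)

lemma ones_add: "ones x k (m + n) = ones x k m + ones x (k + m) n"
  by (induction n) (simp_all add: ones_Suc add.assoc)

lemma ones_Suc': "ones x k (Suc m) = of_bool (x !! k) + ones x (Suc k) m"
  using ones_add[of x k 1 m] ones_Suc[of x k 0] by simp

text \<open>A shortest unbalanced pair of factors has the form \<open>1w1\<close>, \<open>0w0\<close> with \<open>w\<close> a palindrome.\<close>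

lemma unbalanced_palindrome:
  assumes "ones x k0 m0 \<ge> ones x l0 m0 + 2"
  obtains k l n where "1 \<le> n" "x !! k" "x !! (k + n)" "\<not> x !! l" "\<not> x !! (l + n)"
    "\<And>i. 1 \<le> i \<Longrightarrow> i < n \<Longrightarrow> x !! (k + i) = x !! (l + i)"
    "\<And>i. 1 \<le> i \<Longrightarrow> i < n \<Longrightarrow> x !! (k + i) = x !! (k + (n - i))"
proof -
  define Q where "Q = (\<lambda>m. \<exists>k l. ones x k m \<ge> ones x l m + 2)"
  define m where "m = (LEAST m. Q m)"
  have "Q m0" using assms by (auto simp: Q_def)
  then have "Q m" unfolding m_def by (rule LeastI)
  then obtain k l where kl: "ones x k m \<ge> ones x l m + 2" by (auto simp: Q_def)
  have short: "ones x i j \<le> ones x i' j + 1" if "j < m" for i i' j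
    using not_less_Least[of j Q] that unfolding m_def Q_def by (smt (verit, best))
  have D: "ones x k j = ones x l j + 1" if "1 \<le> j" "j < m" for j
  proof -
    have "ones x k m = ones x k j + ones x (k + j) (m - j)" "ones x l m = ones x l j + ones x (l + j) (m - j)"
      using ones_add[of x k j "m - j"] ones_add[of x l j "m - j"] that by simp_all
    then show ?thesis using short[of j k l] short[of "m - j" "k + j" "l + j"] that kl by linarith
  qed
  have "\<not> m \<le> 1"
  proof
    assume "m \<le> 1"
    then have "m = 0 \<or> m = 1" by linarith
    then show False using kl by (auto simp: ones_def of_bool_def split: if_splits)
  qed
  then have m: "2 \<le> m" by simp
  define n where "n = m - 1"
  have n: "1 \<le> n" "m = Suc n" using m by (simp_all add: n_def)
  have first: "x !! k" "\<not> x !! l"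
    using D[of 1] m by (auto simp: ones_def of_bool_def split: if_splits)
  have last: "x !! (k + n)" "\<not> x !! (l + n)"
    using D[of n] kl n by (auto simp: ones_Suc of_bool_def split: if_splits)
  have mid: "x !! (k + i) = x !! (l + i)" if i: "1 \<le> i" "i < n" for i
    using D[of i] D[of "Suc i"] that n by (auto simp: ones_Suc of_bool_def split: if_splits)
  \<comment> \<open>Prefixes of each factor are compared with suffixes of the other; minimality of
    \<open>m\<close> gives equal counts, and successive differences then give the palindrome letter
    by letter.\<close>
  have pre: "ones x (k + 1) i = ones x (k + (n - i)) i" if i: "i < n" for i
  proof -
    have same: "ones x (k + j) i = ones x (l + j) i" if "1 \<le> j" "j + i \<le> n" for j
      unfolding ones_def using mid that by (intro sum.cong refl) (auto simp: add.assoc)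
    have "ones x k (Suc i) = 1 + ones x (k + 1) i" "ones x l (Suc i) = ones x (l + 1) i"
      using ones_add[of x k 1 i] ones_add[of x l 1 i] first by (simp_all add: ones_def)
    moreover have "ones x (k + (n - i)) (Suc i) = ones x (k + (n - i)) i + 1"
      "ones x (l + (n - i)) (Suc i) = ones x (l + (n - i)) i"
      using last i by (simp_all add: ones_Suc add.assoc)
    ultimately show ?thesis
      using short[of "Suc i" k "l + (n - i)"] short[of "Suc i" "k + (n - i)" l] same[of 1] same[of "n - i"] i n
      by simp
  qed
  have "x !! (k + i) = x !! (k + (n - i))" if i: "1 \<le> i" "i < n" for i
  proof -
    have "ones x (k + 1) i = ones x (k + 1) (i - 1) + of_bool (x !! (k + i))"
      using i ones_Suc[of x "k + 1" "i - 1"] by simp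
    moreover have "ones x (k + (n - i)) i = of_bool (x !! (k + (n - i))) + ones x (k + (n - (i - 1))) (i - 1)"
    proof -
      have "Suc (k + (n - i)) = k + (n - (i - 1))" "Suc (i - 1) = i" using i by simp_all
      then show ?thesis using ones_Suc'[of x "k + (n - i)" "i - 1"] by (simp only:)
    qed
    ultimately show ?thesis
      using pre[of i] pre[of "i - 1"] i by (simp add: of_bool_def split: if_splits)
  qed
  then show ?thesis using that[OF n(1) first(1) last(1) first(2) last(2) mid] by blast
qed

text \<open>Windows starting at \<open>i + d\<close> or later repeat earlier ones, so at most
  \<open>i + d\<close> factors of that same length are left, one too few.\<close>

lemma eventually_periodic_not_sturmian:
  assumes "\<And>r. x !! (i + r) = x !! (i + d + r)" "1 \<le> d"
  shows "\<not> sturmian x"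
proof
  assume st: "sturmian x"
  define m where "m = i + d"
  have "factors x m \<subseteq> (\<lambda>q. window x q m) ` {..<i + d}"
  proof
    have red: "\<exists>q<i + d. window x k m = window x q m" for k
    proof (induction k rule: less_induct)
      case (less k)
      show ?case
      proof (cases "k < i + d")
        case False
        then obtain r where r: "k = i + d + r" using le_Suc_ex not_less by blast
        have "window x k m = window x (i + r) m"
          unfolding window_eq_iff using assms(1)[of "r + _"] by (simp add: r add.assoc)
        then show ?thesis using less[of "i + r"] r assms(2) by auto
      qed auto
    qed
    fix w assume "w \<in> factors x m"
    then show "w \<in> (\<lambda>q. window x q m) ` {..<i + d}" using red by (auto simp: factors_def)
  qed
  then have "card (factors x m) \<le> card {..<i + d}" by (intro surj_card_le) auto
  then show False using sturmian_card_factors[OF st, of m] by (simp add: m_def)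
qed

text \<open>An unbalanced pair 1w1, 0w0 makes \<open>w\<close> right special, so the right special
  factor \<open>z\<close> of length \<open>n\<close> is one letter followed by \<open>w\<close>. The
  \<open>n + 1\<close> windows met while crossing the block with the opposite outer letter avoid
  \<open>z\<close>. Only \<open>n\<close> factors differ from \<open>z\<close>, so two windows
  coincide; away from \<open>z\<close> a window determines the next letter, and the word is
  eventually periodic.\<close>

lemma sturmian_balanced:
  assumes st: "sturmian x"
  shows "ones x k m \<le> ones x l m + 1"
proof (rule ccontr)
  assume "\<not> ones x k m \<le> ones x l m + 1"
  then have "ones x k m \<ge> ones x l m + 2" by simp
  then obtain k l n where n: "1 \<le> n" and k: "x !! k" "x !! (k + n)" and l: "\<not> x !! l" "\<not> x !! (l + n)"
    and mid: "\<And>i. 1 \<le> i \<Longrightarrow> i < n \<Longrightarrow> x !! (k + i) = x !! (l + i)"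
    and pal: "\<And>i. 1 \<le> i \<Longrightarrow> i < n \<Longrightarrow> x !! (k + i) = x !! (k + (n - i))"
    by (rule unbalanced_palindrome) (rule that, assumption+)
  define w where "w = window x (Suc k) (n - 1)"
  have w': "w = window x (Suc l) (n - 1)"
    unfolding w_def window_eq_iff using mid[of "Suc _"] by auto
  have "Suc q + (n - 1) = q + n" for q using n by simp
  then have "w @ [x !! (k + n)] = window x (Suc k) (Suc (n - 1))" "w @ [x !! (l + n)] = window x (Suc l) (Suc (n - 1))"
    using window_Suc[of x "Suc k" "n - 1"] window_Suc[of x "Suc l" "n - 1"] w' by (simp_all add: w_def)
  then have "w @ [x !! (k + n)] \<in> factors x (Suc (n - 1))" "w @ [x !! (l + n)] \<in> factors x (Suc (n - 1))"
    by (simp_all only: window_in_factors)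
  then have wsp: "w \<in> special x (n - 1)" using k l by (simp add: special_def)
  obtain z where z: "special x n = {z}" using sturmian_special[OF st] .
  have zsp: "z @ [False] \<in> factors x (Suc n)" "z @ [True] \<in> factors x (Suc n)" using z by (auto simp: special_def)
  have zlen: "length z = n" using zsp(1) by (auto simp: factors_eq)
  have suffix: "tl z @ [b] \<in> factors x (Suc (n - 1))" if "z @ [b] \<in> factors x (Suc n)" for b
  proof -
    from that obtain q where q: "z @ [b] = window x q (Suc n)" by (auto simp: factors_def)
    have "z \<noteq> []" using zlen n by auto
    then have "tl z @ [b] = tl (z @ [b])" by simp
    also have "\<dots> = window x (Suc q) n" unfolding q window_Suc' by simp
    finally show ?thesis using n by (auto simp: factors_def)
  qed
  have "tl z \<in> special x (n - 1)" using suffix zsp by (auto simp: special_def)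
  moreover obtain w0 where "special x (n - 1) = {w0}" using sturmian_special[OF st] .
  ultimately have tlz: "tl z = w" using wsp by auto
  define p where "p = (if hd z then l else k)"
  have p: "x !! p \<noteq> hd z" "x !! (p + n) \<noteq> hd z" using k l by (auto simp: p_def)
  have pw: "x !! (p + i) = w ! (i - 1)" if "1 \<le> i" "i < n" for i
    using that mid by (auto simp: p_def w_def)
  have ppal: "x !! (p + i) = x !! (p + (n - i))" if "1 \<le> i" "i < n" for i
  proof -
    have "x !! (k + (n - i)) = x !! (l + (n - i))" using that by (intro mid) auto
    then have "x !! (l + i) = x !! (l + (n - i))" using pal[OF that] mid[OF that] by simp
    then show ?thesis unfolding p_def using pal[OF that] by simp
  qed
  \<comment> \<open>If \<open>z\<close> occurred at offset \<open>t\<close>, the symmetry of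
    \<open>w\<close> would carry its first letter to the end of the block, where the opposite letter
    stands.\<close>
  have avoid: "window x (p + t) n \<noteq> z" if tn: "t \<le> n" for t
  proof
    assume eq: "window x (p + t) n = z"
    have nth: "x !! (p + t + i) = z ! i" if "i < n" for i using nth_window[OF that, of x "p + t"] eq by simp
    have "z \<noteq> []" using zlen n by auto
    then have hd: "x !! (p + t) = hd z" using nth[of 0] n by (simp add: hd_conv_nth)
    have "t \<noteq> 0" "t \<noteq> n" using hd p by (cases "t = 0", simp, simp, cases "t = n", simp, simp)
    with tn have t: "1 \<le> t" "t < n" by linarith+
    have "x !! (p + n) = z ! (n - t)" using nth[of "n - t"] t by simp
    also have "\<dots> = (hd z # w) ! (n - t)" unfolding tlz[symmetric] using \<open>z \<noteq> []\<close> by simp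
    also have "\<dots> = w ! (n - t - 1)" using t by (simp add: nth_Cons')
    also have "\<dots> = x !! (p + (n - t))" using pw[of "n - t"] t by simp
    also have "\<dots> = x !! (p + t)" using ppal[OF t] by simp
    finally show False using hd p by simp
  qed
  have det: "window x (Suc i) n = window x (Suc j) n" if "window x i n = window x j n" "window x i n \<noteq> z" for i j
  proof -
    have "x !! (i + n) = x !! (j + n)"
    proof (rule ccontr)
      assume ne: "x !! (i + n) \<noteq> x !! (j + n)"
      have "window x q n @ [x !! (q + n)] \<in> factors x (Suc n)" for q
        unfolding window_Suc[symmetric] by (rule window_in_factors)
      from this[of i] this[of j] have "window x i n @ [x !! (i + n)] \<in> factors x (Suc n)"
        "window x i n @ [x !! (j + n)] \<in> factors x (Suc n)"
        unfolding that(1) by auto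
      then have "window x i n \<in> special x n" using ne by (cases "x !! (i + n)") (auto simp: special_def)
      then show False using z that(2) by simp
    qed
    then have "window x i (Suc n) = window x j (Suc n)" using that(1) by (simp add: window_Suc)
    then show ?thesis by (simp add: window_Suc')
  qed
  have "\<not> inj_on (\<lambda>t. window x (p + t) n) {..n}"
  proof
    assume "inj_on (\<lambda>t. window x (p + t) n) {..n}"
    then have "card ((\<lambda>t. window x (p + t) n) ` {..n}) = Suc n" by (simp add: card_image)
    moreover have "(\<lambda>t. window x (p + t) n) ` {..n} \<subseteq> factors x n - {z}" using avoid by (auto simp: factors_def)
    then have "card ((\<lambda>t. window x (p + t) n) ` {..n}) \<le> card (factors x n - {z})"
      using finite_factors by (intro card_mono) auto
    moreover have "z \<in> factors x n" using zsp(1) by (auto simp: factors_def window_Suc)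
    then have "card (factors x n - {z}) = n" using sturmian_card_factors[OF st, of n] finite_factors by simp
    ultimately show False by simp
  qed
  then obtain t t' where t: "t < t'" "t' \<le> n" "window x (p + t) n = window x (p + t') n"
    unfolding inj_on_def by (metis atMost_iff linorder_neqE_nat)
  define d where "d = t' - t"
  have rep: "window x (p + t + r) n = window x (p + t + d + r) n \<and> window x (p + t + r) n \<noteq> z" for r
  proof (induction r rule: less_induct)
    case (less r)
    have ne: "window x (p + t + r) n \<noteq> z"
    proof (cases "r < d")
      case True
      then show ?thesis using avoid[of "t + r"] t by (simp add: d_def add.assoc)
    next
      case False
      then have "window x (p + t + (r - d)) n = window x (p + t + d + (r - d)) n \<and> window x (p + t + (r - d)) n \<noteq> z"
        using t by (intro less) (auto simp: d_def)
      moreover have "p + t + d + (r - d) = p + t + r" using False by simp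
      ultimately show ?thesis by auto
    qed
    show ?case
    proof (cases r)
      case 0
      then show ?thesis using ne t by (simp add: d_def)
    next
      case (Suc r')
      then have "window x (Suc (p + t + r')) n = window x (Suc (p + t + d + r')) n"
        using less[of r'] by (intro det) auto
      then show ?thesis using ne Suc by simp
    qed
  qed
  have "x !! (p + t + r) = x !! (p + t + d + r)" for r
  proof -
    have "window x (p + t + r) n ! 0 = window x (p + t + d + r) n ! 0"
      using rep[of r] by simp
    then show ?thesis using n by simp
  qed
  moreover have "1 \<le> d" using t by (simp add: d_def)
  ultimately show False using eventually_periodic_not_sturmian st by blast
qed

section \<open>Windows of Sturmian words as rational codings\<close>

text \<open>After division by \<open>m * m'\<close>: one frequency exceeds another by less than
  \<open>1 / m + 1 / m'\<close>. Balance settles equal lengths, and splitting the shorter length off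
  the longer one is a Euclidean descent.\<close>

lemma sturmian_slopes:
  assumes st: "sturmian x" and "1 \<le> m" "1 \<le> m'"
  shows "ones x k m * int m' - ones x l m' * int m < int m + int m'"
  using assms(2,3)
proof (induction "m + m'" arbitrary: m m' k l rule: less_induct)
  case less
  consider "m = m'" | "m' < m" | "m < m'" by linarith
  then show ?case
  proof cases
    case 1
    have "(ones x k m - ones x l m) * int m \<le> 1 * int m"
      using sturmian_balanced[OF st, of k m l] by (intro mult_right_mono) auto
    then show ?thesis using 1 less.prems by (simp add: algebra_simps)
  next
    case 2
    have split: "ones x k m = ones x k m' + ones x (k + m') (m - m')"
      using ones_add[of x k m' "m - m'"] 2 by simp
    have "(ones x k m' - ones x l m') * int m' \<le> 1 * int m'"
      using sturmian_balanced[OF st, of k m' l] by (intro mult_right_mono) auto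
    moreover have "ones x (k + m') (m - m') * int m' - ones x l m' * int (m - m') < int (m - m') + int m'"
      using 2 less.prems by (intro less.hyps) auto
    ultimately show ?thesis using 2 unfolding split by (simp add: of_nat_diff algebra_simps)
  next
    case 3
    have split: "ones x l m' = ones x l m + ones x (l + m) (m' - m)"
      using ones_add[of x l m "m' - m"] 3 by simp
    have "(ones x k m - ones x l m) * int m \<le> 1 * int m"
      using sturmian_balanced[OF st, of k m l] by (intro mult_right_mono) auto
    moreover have "ones x k m * int (m' - m) - ones x (l + m) (m' - m) * int m < int m + int (m' - m)"
      using 3 less.prems by (intro less.hyps) auto
    ultimately show ?thesis using 3 unfolding split by (simp add: of_nat_diff algebra_simps)
  qed
qed

lemma ones_bounds: "0 \<le> ones x k m" "ones x k m \<le> int m"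
  by (induction m) (auto simp: ones_Suc)

text \<open>Every factor of the prefix bounds the slope from both sides. All lower bounds lie below
  all upper bounds, so a rational number fits in between.\<close>

lemma sturmian_slope:
  assumes st: "sturmian x"
  obtains s N :: int where "0 < s" "s < N" "coprime s N"
    "\<And>k m. 1 \<le> m \<Longrightarrow> k + m \<le> L \<Longrightarrow> (ones x k m - 1) * N < int m * s"
    "\<And>k m. 1 \<le> m \<Longrightarrow> k + m \<le> L \<Longrightarrow> int m * s < (ones x k m + 1) * N"
proof -
  define I where "I = {(k, m). 1 \<le> m \<and> k + m \<le> L}"
  have "I \<subseteq> {..L} \<times> {..L}" by (auto simp: I_def)
  then have fin: "finite I" by (meson finite_SigmaI finite_atMost finite_subset)
  \<comment> \<open>The extra bounds 0 and 1 force \<open>0 < s\<close> and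
    \<open>s < N\<close>.\<close>
  define A where "A = insert 0 ((\<lambda>(k, m). rat_of_int (ones x k m - 1) / rat_of_nat m) ` I)"
  define B where "B = insert 1 ((\<lambda>(k, m). rat_of_int (ones x k m + 1) / rat_of_nat m) ` I)"
  have finAB: "finite A" "finite B" using fin by (auto simp: A_def B_def)
  have AB: "a < b" if "a \<in> A" "b \<in> B" for a b
  proof -
    have lo: "rat_of_int (ones x k m - 1) / rat_of_nat m < 1" if "1 \<le> m" for k m
    proof -
      have "rat_of_int (ones x k m - 1) < rat_of_int (int m)" using ones_bounds(2)[of x k m] unfolding of_int_less_iff by linarith
      then show ?thesis using that by (simp add: divide_simps)
    qed
    have hi: "0 < rat_of_int (ones x k m + 1) / rat_of_nat m" if "1 \<le> m" for k m
    proof -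
      have "0 < rat_of_int (ones x k m + 1)"
        using ones_bounds(1)[of x k m] unfolding of_int_0_less_iff by linarith
      then show ?thesis using that by simp
    qed
    have mixed: "rat_of_int (ones x k m - 1) / rat_of_nat m < rat_of_int (ones x l m' + 1) / rat_of_nat m'"
      if "1 \<le> m" "1 \<le> m'" for k m l m'
    proof -
      have "(ones x k m - 1) * int m' < (ones x l m' + 1) * int m"
        using sturmian_slopes[OF st that, of k l] by (simp add: algebra_simps)
      then have "rat_of_int ((ones x k m - 1) * int m') < rat_of_int ((ones x l m' + 1) * int m)"
        by (simp only: of_int_less_iff)
      then show ?thesis using that by (simp add: divide_simps)
    qed
    show ?thesis using that lo hi mixed unfolding A_def B_def I_def by auto
  qed
  have "Max A < Min B" using AB finAB Max_in[of A] Min_in[of B] by (auto simp: A_def B_def)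
  then obtain \<alpha> where \<alpha>: "Max A < \<alpha>" "\<alpha> < Min B" using dense by blast
  obtain s N where sN: "quotient_of \<alpha> = (s, N)" by fastforce
  have N: "0 < N" "coprime s N" "\<alpha> = rat_of_int s / rat_of_int N"
    using quotient_of_denom_pos[OF sN] quotient_of_coprime[OF sN] quotient_of_div[OF sN] by auto
  have lower: "a < \<alpha>" if "a \<in> A" for a using \<alpha>(1) Max_ge[OF finAB(1) that] by simp
  have upper: "\<alpha> < b" if "b \<in> B" for b using \<alpha>(2) Min_le[OF finAB(2) that] by simp
  have "0 < s" "s < N" using lower[of 0] upper[of 1] N by (auto simp: A_def B_def divide_simps split: if_splits)
  moreover have "(ones x k m - 1) * N < int m * s" if km: "1 \<le> m" "k + m \<le> L" for k m
  proof -
    have "rat_of_int (ones x k m - 1) / rat_of_nat m \<in> A" using km by (force simp: A_def I_def)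
    from lower[OF this] have "rat_of_int (ones x k m - 1) * rat_of_int N < rat_of_nat m * rat_of_int s"
      using km N by (simp add: divide_simps mult.commute)
    then have "rat_of_int ((ones x k m - 1) * N) < rat_of_int (int m * s)" by simp
    then show ?thesis by (simp only: of_int_less_iff)
  qed
  moreover have "int m * s < (ones x k m + 1) * N" if km: "1 \<le> m" "k + m \<le> L" for k m
  proof -
    have "rat_of_int (ones x k m + 1) / rat_of_nat m \<in> B" using km by (force simp: B_def I_def)
    from upper[OF this] have "rat_of_nat m * rat_of_int s < rat_of_int (ones x k m + 1) * rat_of_int N"
      using km N by (simp add: divide_simps mult.commute)
    then have "rat_of_int (int m * s) < rat_of_int ((ones x k m + 1) * N)" by simp
    then show ?thesis by (simp only: of_int_less_iff)
  qed
  ultimately show ?thesis using that N(2) by blast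
qed

lemma sturmian_prefix_coding:
  assumes st: "sturmian x"
  obtains s N t :: int where "0 < s" "s < N" "coprime s N"
    "\<And>i. i < L \<Longrightarrow> x !! i \<longleftrightarrow> (t + int i * s) mod N < s"
proof -
  obtain s N :: int where s: "0 < s" "s < N" "coprime s N"
    and lo: "\<And>k m. 1 \<le> m \<Longrightarrow> k + m \<le> L \<Longrightarrow> (ones x k m - 1) * N < int m * s"
    and hi: "\<And>k m. 1 \<le> m \<Longrightarrow> k + m \<le> L \<Longrightarrow> int m * s < (ones x k m + 1) * N"
    using sturmian_slope[OF st, of L] by metis
  define H where "H = (\<lambda>i. ones x 0 i)"
  \<comment> \<open>The deviation of the letter counts from the line of slope \<open>s / N\<close>,
    scaled by \<open>N\<close>. It varies by less than \<open>N\<close>, so \<open>r - f i\<close>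
    is a point of [0, N) that moves by \<open>s\<close> modulo \<open>N\<close>, and the letter is 1
    exactly when it wraps around.\<close>
  define f where "f = (\<lambda>i. H i * N - int i * s)"
  define r where "r = Max (f ` {..L})"
  have r: "f i \<le> r" if "i \<le> L" for i unfolding r_def using that by (intro Max_ge) auto
  have lt: "f i < f j + N" if "i \<le> L" "j \<le> L" for i j
  proof -
    consider "i = j" | "j < i" | "i < j" by linarith
    then show ?thesis
    proof cases
      case 2
      have "H i = H j + ones x j (i - j)" using ones_add[of x 0 j "i - j"] 2 by (simp add: H_def)
      then show ?thesis using lo[of "i - j" j] 2 that by (simp add: f_def of_nat_diff algebra_simps)
    next
      case 3
      have "H j = H i + ones x i (j - i)" using ones_add[of x 0 i "j - i"] 3 by (simp add: H_def)
      then show ?thesis using hi[of "j - i" i] 3 that by (simp add: f_def of_nat_diff algebra_simps)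
    qed (use s in simp)
  qed
  have "r \<in> f ` {..L}" unfolding r_def by (intro Max_in) auto
  then have r': "r < f i + N" if "i \<le> L" for i using lt that by auto
  have "x !! i \<longleftrightarrow> ((r + s) + int i * s) mod N < s" if i: "i < L" for i
  proof -
    define q where "q = r - f i"
    have q: "0 \<le> q" "q < N" using r[of i] r'[of i] i by (auto simp: q_def)
    have eq: "(r + s) + int i * s = (q + s) + H i * N" by (simp add: q_def f_def algebra_simps)
    have m: "((r + s) + int i * s) mod N = (q + s) mod N" unfolding eq by (rule mod_mult_self1)
    have H: "H (Suc i) = H i + of_bool (x !! i)" by (simp add: H_def ones_Suc)
    show ?thesis
    proof (cases "x !! i")
      case True
      have "f (Suc i) \<le> r" using r[of "Suc i"] i by simp
      then have "N \<le> q + s" using H True by (simp add: q_def f_def algebra_simps)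
      then have "(q + s - N) mod N = q + s - N" using q s by (intro mod_pos_pos_trivial) auto
      then have "(q + s) mod N = q + s - N" by simp
      then show ?thesis using True m q by simp
    next
      case False
      have "r < f (Suc i) + N" using r'[of "Suc i"] i by simp
      then have "q + s < N" using H False by (simp add: q_def f_def algebra_simps)
      then have "(q + s) mod N = q + s" using q s by simp
      then show ?thesis using False m q by simp
    qed
  qed
  then show ?thesis using that[OF s] by blast
qed

text \<open>The arc is attached to a prescribed letter, so that it can be the doubled one.\<close>

lemma sturmian_prefix_coding_letter:
  assumes "sturmian x"
  obtains s N t :: int where "0 < s" "s < N" "coprime s N"
    "\<And>i. i < L \<Longrightarrow> x !! i = (((t + int i * s) mod N < s) = a)"
proof (cases a)
  case True
  then show ?thesis using sturmian_prefix_coding[OF assms, of L] that by (metis (full_types))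
next
  case False
  obtain s N t :: int where "0 < s" "s < N" "coprime s N"
    "\<And>i. i < L \<Longrightarrow> smap Not x !! i \<longleftrightarrow> (t + int i * s) mod N < s"
    using sturmian_prefix_coding[OF sturmian_complement[OF assms], of L] by metis
  then show ?thesis using False by (intro that[of s N t]) auto
qed

section \<open>Palindromes of codings of rotations\<close>

lemma three_gen_of_punctured:
  assumes "punctured_generic N T e y" "0 \<le> T" "T \<le> N" "1 \<le> N"
  shows "three_gen l r y"
  using assms three_gen_of_generic by (simp add: punctured_generic_iff)

lemma three_gen_cong:
  assumes "\<And>i. l \<le> i \<Longrightarrow> i \<le> r \<Longrightarrow> x i = y i" "three_gen l r x"
  shows "three_gen l r y"
proof -
  obtain S where S: "finite S" "card S \<le> 3" "\<forall>(a, b)\<in>S. l \<le> a \<and> b \<le> r" "determines S {l..r} x"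
    using assms(2) unfolding three_gen_def by blast
  have "determines S {l..r} y"
  proof (rule determinesI)
    show "\<forall>(a, b)\<in>S. mirror_on a b y"
    proof clarify
      fix a b assume "(a, b) \<in> S"
      then have "l \<le> a" "b \<le> r" "mirror_on a b x" using S(3,4) by (auto simp: determines_def)
      then show "mirror_on a b y" using mirror_on_cong[of a b x y] assms(1) by auto
    qed
  next
    fix v :: "int \<Rightarrow> nat" and i j
    assume "\<forall>(a, b)\<in>S. mirror_on a b v" "i \<in> {l..r}" "j \<in> {l..r}" "y i = y j"
    then show "v i = v j" using determinesD[OF S(4)] assms(1) by auto
  qed
  then show ?thesis unfolding three_gen_def using S(1-3) by blast
qed

text \<open>Both reflections preserve the arc [0, w), the second one up to the boundary points 0 and
  \<open>w\<close>, which it exchanges. These points become holes.\<close>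

lemma mod_reflect_arc:
  fixes N w \<tau> :: int
  assumes "0 \<le> w" "w \<le> N" "1 \<le> N"
  shows "(w - 1 - \<tau>) mod N < w \<longleftrightarrow> \<tau> mod N < w"
    and "\<tau> mod N \<noteq> 0 \<Longrightarrow> \<tau> mod N \<noteq> w \<Longrightarrow> (w - \<tau>) mod N < w \<longleftrightarrow> \<tau> mod N < w"
proof -
  define \<sigma> where "\<sigma> = \<tau> mod N"
  have \<sigma>: "0 \<le> \<sigma>" "\<sigma> < N" using assms by (simp_all add: \<sigma>_def)
  have red: "(c - \<tau>) mod N = (c - \<sigma>) mod N" for c by (simp add: \<sigma>_def mod_simps)
  have up: "(c - \<sigma>) mod N = (c - \<sigma> + N) mod N" for c by simp
  show "(w - 1 - \<tau>) mod N < w \<longleftrightarrow> \<tau> mod N < w"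
  proof (cases "\<sigma> < w")
    case True
    then have "(w - 1 - \<sigma>) mod N = w - 1 - \<sigma>" using \<sigma> assms by (intro mod_pos_pos_trivial) auto
    then show ?thesis using True \<sigma> unfolding red \<sigma>_def[symmetric] by simp
  next
    case False
    then have "(w - 1 - \<sigma>) mod N = w - 1 - \<sigma> + N"
      unfolding up[of "w - 1"] using \<sigma> assms by (intro mod_pos_pos_trivial) auto
    then show ?thesis using False \<sigma> unfolding red \<sigma>_def[symmetric] by simp
  qed
  assume "\<tau> mod N \<noteq> 0" "\<tau> mod N \<noteq> w"
  then have ne: "\<sigma> \<noteq> 0" "\<sigma> \<noteq> w" by (simp_all add: \<sigma>_def)
  show "(w - \<tau>) mod N < w \<longleftrightarrow> \<tau> mod N < w"
  proof (cases "\<sigma> < w")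
    case True
    then have "(w - \<sigma>) mod N = w - \<sigma>" using \<sigma> ne assms by (intro mod_pos_pos_trivial) auto
    then show ?thesis using True \<sigma> ne unfolding red \<sigma>_def[symmetric] by simp
  next
    case False
    then have "(w - \<sigma>) mod N = w - \<sigma> + N"
      unfolding up[of w] using \<sigma> ne assms by (intro mod_pos_pos_trivial) auto
    then show ?thesis using False \<sigma> ne unfolding red \<sigma>_def[symmetric] by simp
  qed
qed

text \<open>The product of the two reflections is a translation, valid as long as it does not land
  in a hole.\<close>

lemma punctured_step:
  assumes "punctured N T e v" "T \<le> (i + (T - 1 - e)) mod N"
  shows "v (i + (T - 1 - e)) = v i"
proof -
  have "v (T - 1 - (i + (T - 1 - e))) = v (i + (T - 1 - e))" "v (e - i) = v i"
    using assms by (auto simp: punctured_def)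
  then show ?thesis by simp
qed

lemma int_arc_const:
  fixes u :: "int \<Rightarrow> 'a"
  assumes "\<And>t. p < t \<Longrightarrow> t < q \<Longrightarrow> u t = u (t - 1)" "p \<le> t" "t < q"
  shows "u t = u p"
proof -
  have "u (p + int n) = u p" if "p + int n < q" for n
    using that
  proof (induction n)
    case (Suc n)
    have "u (p + int (Suc n)) = u (p + int (Suc n) - 1)" using Suc.prems by (intro assms(1)) auto
    then show ?case using Suc by simp
  qed simp
  from this[of "nat (t - p)"] show ?thesis using assms(2,3) by simp
qed

lemma coprime_inverse_mod:
  fixes s N :: int
  assumes "coprime s N" "1 \<le> N"
  obtains d where "\<And>i c. (i * s) mod N = (c * s) mod N \<longleftrightarrow> i mod N = c mod N"
    "\<And>i. (i * s * d) mod N = i mod N" "\<And>i. (i * d * s) mod N = i mod N"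
    "\<And>c. (c - d * s) mod N = (c - 1) mod N"
proof -
  obtain d where d: "[s * d = 1] (mod N)" using cong_solve_coprime_int[OF assms(1)] by blast
  have "[i * (s * d) = i * 1] (mod N)" for i using d by (intro cong_mult cong_refl)
  then have 1: "(i * s * d) mod N = i mod N" for i
    by (simp add: cong_iff_mod_eq mult.assoc)
  have 2: "(i * d * s) mod N = i mod N" for i
    using 1[of i] by (simp only: mult.assoc mult.commute[of d s])
  have 3: "(c - d * s) mod N = (c - 1) mod N" for c
    using cong_diff[OF cong_refl[of c] d] by (simp only: cong_iff_mod_eq mult.commute[of d s])
  have "(i * s) mod N = (c * s) mod N \<longleftrightarrow> i mod N = c mod N" for i c
    using assms(1) cong_mult_rcancel[of s N i c] by (simp add: cong_iff_mod_eq)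
  then show ?thesis using that 1 2 3 by blast
qed

lemma mod_period_eq:
  fixes v :: "int \<Rightarrow> 'a"
  assumes "\<And>i. v (i + N) = v i" "i mod N = j mod N"
  shows "v i = v j"
  using period_cong[of v N i j, OF assms(1)] assms(2) by (simp add: cong_iff_mod_eq)

lemma two_class_kernel:
  assumes "\<And>i. P i \<Longrightarrow> v i = c" "\<And>i. \<not> P i \<Longrightarrow> v i = c'" "\<And>i. y i = a \<longleftrightarrow> P i" "y i = y j"
  shows "v i = v j"
proof -
  have "P i \<longleftrightarrow> P j" using assms(3)[of i] assms(3)[of j] assms(4) by simp
  then show ?thesis using assms(1,2)[of i] assms(1,2)[of j] by (cases "P i") auto
qed

text \<open>In the coordinate \<open>t = i * s\<close> the two reflections are \<open>t \<mapsto> w - 1 - t\<close> and \<open>t \<mapsto> w - t\<close>, with \<open>w\<close>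
  the length of the arc, so their product is the successor map, cut at the ends of the arc by the holes.\<close>

lemma three_gen_rotation:
  fixes y :: "int \<Rightarrow> bool"
  assumes s: "0 < s" "s < N" "coprime s N" and y: "\<And>i. y i = a \<longleftrightarrow> (i * s) mod N < s"
  shows "three_gen l r y"
proof -
  have N: "2 \<le> N" and N1: "1 \<le> N" using s by simp_all
  obtain d where d: "\<And>i c. (i * s) mod N = (c * s) mod N \<longleftrightarrow> i mod N = c mod N"
    "\<And>i. (i * s * d) mod N = i mod N" "\<And>i. (i * d * s) mod N = i mod N"
    "\<And>c. (c - d * s) mod N = (c - 1) mod N"
    by (rule coprime_inverse_mod[OF s(3) N1]) (rule that, assumption+)
  have yeq: "y i = y j" if "(i * s) mod N < s \<longleftrightarrow> (j * s) mod N < s" for i j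
    using y[of i] y[of j] that by auto
  \<comment> \<open>With \<open>e = 1 - d\<close> the product of the reflections is the translation
    by \<open>d\<close>, the inverse of \<open>s\<close>, hence the successor in the coordinate
    \<open>i * s\<close>.\<close>
  have "punctured N 2 (1 - d) y"
    unfolding punctured_def
  proof (intro conjI allI impI)
    fix i
    show "y (i + N) = y i" by (rule yeq) (simp add: algebra_simps)
    have "(1 - d - i) * s = (s - i * s) - d * s" by (simp add: algebra_simps)
    then have "((1 - d - i) * s) mod N = (s - i * s - 1) mod N" by (simp only: d(4))
    also have "s - i * s - 1 = s - 1 - i * s" by simp
    finally show "y (1 - d - i) = y i" using mod_reflect_arc(1)[of s N "i * s"] s by (intro yeq) simp
    assume i: "2 \<le> i mod N"
    have "(i * s) mod N \<noteq> (0 * s) mod N" "(i * s) mod N \<noteq> (1 * s) mod N" unfolding d(1) using i N by auto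
    then have "(i * s) mod N \<noteq> 0" "(i * s) mod N \<noteq> s" using s by simp_all
    moreover have "(2 - 1 - i) * s = s - i * s" by (simp add: algebra_simps)
    ultimately show "y (2 - 1 - i) = y i" using mod_reflect_arc(2)[of s N "i * s"] s by (intro yeq) simp
  qed
  moreover have "v i = v j" if v: "punctured N 2 (1 - d) v" and ij: "y i = y j" for v :: "int \<Rightarrow> nat" and i j
  proof -
    have per: "v (i + N) = v i" for i using v by (simp add: punctured_def)
    define u where "u = (\<lambda>t. v (t * d))"
    have step: "u t = u (t - 1)" if t: "0 < t" "t < N" "t \<noteq> s" for t
    proof -
      have "(t * d * s) mod N \<noteq> (0 * s) mod N" "(t * d * s) mod N \<noteq> (1 * s) mod N"
        unfolding d(3) using t s by simp_all
      then have "(t * d) mod N \<noteq> 0" "(t * d) mod N \<noteq> 1" unfolding d(1) using N by simp_all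
      moreover have "0 \<le> (t * d) mod N" using N by simp
      moreover have "(t - 1) * d + (2 - 1 - (1 - d)) = t * d" by (simp add: algebra_simps)
      ultimately show ?thesis using punctured_step[OF v, of "(t - 1) * d"] by (simp add: u_def)
    qed
    have vu: "v i = u ((i * s) mod N)" for i
      unfolding u_def using d(2)[of i] by (intro mod_period_eq[of v N, OF per]) (simp add: mod_simps)
    have "v i = u 0" if "(i * s) mod N < s" for i
      unfolding vu[of i] using that N s by (intro int_arc_const[of 0 s u] step) auto
    moreover have "v i = u s" if "\<not> (i * s) mod N < s" for i
      unfolding vu[of i] using that N s by (intro int_arc_const[of s N u] step) auto
    ultimately show ?thesis using two_class_kernel[of "\<lambda>i. (i * s) mod N < s" v "u 0" "u s" y a] y ij by blast
  qed
  ultimately have "punctured_generic N 2 (1 - d) y" unfolding punctured_generic_def by blast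
  then show ?thesis by (rule three_gen_of_punctured) (use N in simp_all)
qed

text \<open>The holes 0, 1, 2 have the coordinates 0, \<open>s\<close>, \<open>2 * s\<close>. The
  middle one separates the halves of the arc; the reflection without holes,
  \<open>t -> 2 * s - 1 - t\<close>, exchanges the halves and so joins them again.\<close>

lemma three_gen_rotation_double:
  fixes y :: "int \<Rightarrow> bool"
  assumes s: "0 < s" "2 * s < N" "coprime s N" and y: "\<And>i. y i = a \<longleftrightarrow> (i * s) mod N < 2 * s"
  shows "three_gen l r y"
proof -
  have N: "3 \<le> N" and N1: "1 \<le> N" using s by simp_all
  obtain d where d: "\<And>i c. (i * s) mod N = (c * s) mod N \<longleftrightarrow> i mod N = c mod N"
    "\<And>i. (i * s * d) mod N = i mod N" "\<And>i. (i * d * s) mod N = i mod N"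
    "\<And>c. (c - d * s) mod N = (c - 1) mod N"
    by (rule coprime_inverse_mod[OF s(3) N1]) (rule that, assumption+)
  have yeq: "y i = y j" if "(i * s) mod N < 2 * s \<longleftrightarrow> (j * s) mod N < 2 * s" for i j
    using y[of i] y[of j] that by auto
  have "punctured N 3 (2 - d) y"
    unfolding punctured_def
  proof (intro conjI allI impI)
    fix i
    show "y (i + N) = y i" by (rule yeq) (simp add: algebra_simps)
    have "(2 - d - i) * s = (2 * s - i * s) - d * s" by (simp add: algebra_simps)
    then have "((2 - d - i) * s) mod N = (2 * s - i * s - 1) mod N" by (simp only: d(4))
    also have "2 * s - i * s - 1 = 2 * s - 1 - i * s" by simp
    finally show "y (2 - d - i) = y i" using mod_reflect_arc(1)[of "2 * s" N "i * s"] s by (intro yeq) simp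
    assume i: "3 \<le> i mod N"
    have "(i * s) mod N \<noteq> (0 * s) mod N" "(i * s) mod N \<noteq> (2 * s) mod N" unfolding d(1) using i N by auto
    then have "(i * s) mod N \<noteq> 0" "(i * s) mod N \<noteq> 2 * s" using s by simp_all
    moreover have "(3 - 1 - i) * s = 2 * s - i * s" by (simp add: algebra_simps)
    ultimately show "y (3 - 1 - i) = y i" using mod_reflect_arc(2)[of "2 * s" N "i * s"] s by (intro yeq) simp
  qed
  moreover have "v i = v j" if v: "punctured N 3 (2 - d) v" and ij: "y i = y j" for v :: "int \<Rightarrow> nat" and i j
  proof -
    have per: "v (i + N) = v i" and refl: "v (2 - d - i) = v i" for i using v by (auto simp: punctured_def)
    define u where "u = (\<lambda>t. v (t * d))"
    have u_mod: "v i = u t" if "(i * s) mod N = t mod N" for i t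
    proof -
      have "(i * s * d) mod N = (t * d) mod N" using that by (metis mod_mult_left_eq)
      then show ?thesis unfolding u_def d(2) by (intro mod_period_eq[of v N, OF per])
    qed
    have step: "u t = u (t - 1)" if t: "0 < t" "t < N" "t \<noteq> s" "t \<noteq> 2 * s" for t
    proof -
      have "(t * d * s) mod N \<noteq> (0 * s) mod N" "(t * d * s) mod N \<noteq> (1 * s) mod N" "(t * d * s) mod N \<noteq> (2 * s) mod N"
        unfolding d(3) using t s by simp_all
      then have "(t * d) mod N \<noteq> 0" "(t * d) mod N \<noteq> 1" "(t * d) mod N \<noteq> 2" unfolding d(1) using N by simp_all
      moreover have "0 \<le> (t * d) mod N" using N by simp
      moreover have "(t - 1) * d + (3 - 1 - (2 - d)) = t * d" by (simp add: algebra_simps)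
      ultimately show ?thesis using punctured_step[OF v, of "(t - 1) * d"] by (simp add: u_def)
    qed
    have arc: "u t = u 0" if "0 \<le> t" "t < s" for t
      using that s by (intro int_arc_const[of 0 s u] step) auto
    have arc': "u t = u s" if "s \<le> t" "t < 2 * s" for t
      using that s by (intro int_arc_const[of s "2 * s" u] step) auto
    have "u 0 = v (2 - d - 0)" unfolding refl by (simp add: u_def)
    also have "\<dots> = u (2 * s - 1)"
    proof (rule u_mod)
      have "(2 - d - 0) * s = 2 * s - d * s" by (simp add: algebra_simps)
      then show "((2 - d - 0) * s) mod N = (2 * s - 1) mod N" by (simp only: d(4))
    qed
    finally have "u 0 = u s" using arc'[of "2 * s - 1"] s by simp
    have vu: "v i = u ((i * s) mod N)" for i by (rule u_mod) simp
    have "v i = u 0" if "(i * s) mod N < 2 * s" for i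
      unfolding vu[of i] using that N arc[of "(i * s) mod N"] arc'[of "(i * s) mod N"] \<open>u 0 = u s\<close>
      by (cases "(i * s) mod N < s") auto
    moreover have "v i = u (2 * s)" if "\<not> (i * s) mod N < 2 * s" for i
      unfolding vu[of i] using that N s by (intro int_arc_const[of "2 * s" N u] step) auto
    ultimately show ?thesis
      using two_class_kernel[of "\<lambda>i. (i * s) mod N < 2 * s" v "u 0" "u (2 * s)" y a] y ij by blast
  qed
  ultimately have "punctured_generic N 3 (2 - d) y" unfolding punctured_generic_def by blast
  then show ?thesis by (rule three_gen_of_punctured) (use N in simp_all)
qed

text \<open>A position is a half \<open>i div 2\<close> with a parity. The translation by
  \<open>2 * d\<close> keeps the parity; the reflection \<open>i -> e - i\<close>, with
  \<open>e\<close> odd, exchanges the parities. So a class is one arc for each parity, and that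
  reflection links the two.\<close>

lemma three_gen_rotation_both:
  fixes y :: "int \<Rightarrow> bool"
  assumes s: "0 < s" "s < N" "coprime s N" and y: "\<And>i. y i = a \<longleftrightarrow> (i div 2 * s) mod N < s"
  shows "three_gen l r y"
proof -
  have N: "2 \<le> N" and N1: "1 \<le> N" using s by simp_all
  obtain d where d: "\<And>i c. (i * s) mod N = (c * s) mod N \<longleftrightarrow> i mod N = c mod N"
    "\<And>i. (i * s * d) mod N = i mod N" "\<And>i. (i * d * s) mod N = i mod N"
    "\<And>c. (c - d * s) mod N = (c - 1) mod N"
    by (rule coprime_inverse_mod[OF s(3) N1]) (rule that, assumption+)
  have yeq: "y i = y j" if "(i div 2 * s) mod N < s \<longleftrightarrow> (j div 2 * s) mod N < s" for i j
    using y[of i] y[of j] that by auto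
  have half: "(2 * c + 1 - i) div 2 = c - i div 2" for c i :: int by presburger
  have halfmod: "4 \<le> i mod (2 * N) \<longleftrightarrow> 2 \<le> (i div 2) mod N" for i
  proof -
    have "i mod (2 * N) = 2 * ((i div 2) mod N) + i mod 2"
      using zmod_zmult2_eq[of N i 2] N by simp
    moreover have "i mod 2 = 0 \<or> i mod 2 = 1" by presburger
    ultimately show ?thesis by auto
  qed
  have "punctured (2 * N) 4 (2 * (1 - d) + 1) y"
    unfolding punctured_def
  proof (intro conjI allI impI)
    fix i
    show "y (i + 2 * N) = y i" by (rule yeq) (simp add: algebra_simps)
    have "(1 - d - i div 2) * s = (s - i div 2 * s) - d * s" by (simp add: algebra_simps)
    then have "((1 - d - i div 2) * s) mod N = (s - i div 2 * s - 1) mod N" by (simp only: d(4))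
    also have "s - i div 2 * s - 1 = s - 1 - i div 2 * s" by simp
    finally have "((1 - d - i div 2) * s) mod N < s \<longleftrightarrow> (i div 2 * s) mod N < s"
      using mod_reflect_arc(1)[of s N "i div 2 * s"] s by simp
    then show "y (2 * (1 - d) + 1 - i) = y i" by (intro yeq) (simp only: half)
    assume "4 \<le> i mod (2 * N)"
    then have i: "2 \<le> (i div 2) mod N" by (simp add: halfmod)
    have "(i div 2 * s) mod N \<noteq> (0 * s) mod N" "(i div 2 * s) mod N \<noteq> (1 * s) mod N" unfolding d(1) using i N by auto
    then have "(i div 2 * s) mod N \<noteq> 0" "(i div 2 * s) mod N \<noteq> s" using s by simp_all
    moreover have "(4 - 1 - i) div 2 = 1 - i div 2" by presburger
    moreover have "(1 - i div 2) * s = s - i div 2 * s" by (simp add: algebra_simps)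
    ultimately show "y (4 - 1 - i) = y i"
      using mod_reflect_arc(2)[of s N "i div 2 * s"] s by (intro yeq) simp
  qed
  moreover have "v i = v j" if v: "punctured (2 * N) 4 (2 * (1 - d) + 1) v" and ij: "y i = y j" for v :: "int \<Rightarrow> nat" and i j
  proof -
    have per: "v (i + 2 * N) = v i" and refl: "v (2 * (1 - d) + 1 - i) = v i" for i
      using v by (auto simp: punctured_def)
    define u where "u = (\<lambda>r t. v (2 * (t * d) + r))"
    have u_mod: "v (2 * q + r) = u r t" if "(q * s) mod N = t mod N" for q r t
    proof -
      have "(q * s * d) mod N = (t * d) mod N" using that by (metis mod_mult_left_eq)
      then have "N dvd q - t * d" unfolding d(2) by (simp add: mod_eq_dvd_iff)
      moreover have "(2 * q + r) - (2 * (t * d) + r) = 2 * (q - t * d)" by simp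
      ultimately have "2 * N dvd (2 * q + r) - (2 * (t * d) + r)" by (metis dvd_refl mult_dvd_mono)
      then show ?thesis unfolding u_def
        by (intro mod_period_eq[of v "2 * N", OF per]) (simp only: mod_eq_dvd_iff)
    qed
    have step: "u r t = u r (t - 1)" if t: "0 < t" "t < N" "t \<noteq> s" and r: "r = 0 \<or> r = 1" for r t
    proof -
      have "(t * d * s) mod N \<noteq> (0 * s) mod N" "(t * d * s) mod N \<noteq> (1 * s) mod N"
        unfolding d(3) using t s by simp_all
      then have "(t * d) mod N \<noteq> 0" "(t * d) mod N \<noteq> 1" unfolding d(1) using N by simp_all
      moreover have "0 \<le> (t * d) mod N" using N by simp
      ultimately have "2 \<le> (t * d) mod N" by linarith
      moreover have "(2 * (t * d) + r) div 2 = t * d" using r by auto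
      ultimately have "4 \<le> (2 * (t * d) + r) mod (2 * N)" unfolding halfmod by simp
      moreover have "2 * ((t - 1) * d) + r + (4 - 1 - (2 * (1 - d) + 1)) = 2 * (t * d) + r"
        by (simp add: algebra_simps)
      ultimately show ?thesis using punctured_step[OF v, of "2 * ((t - 1) * d) + r"] by (simp only: u_def)
    qed
    have arc: "u r t = u r 0" if "0 \<le> t" "t < s" "r = 0 \<or> r = 1" for r t
      using that s by (intro int_arc_const[of 0 s "u r"] step) auto
    have arc': "u r t = u r s" if "s \<le> t" "t < N" "r = 0 \<or> r = 1" for r t
      using that s by (intro int_arc_const[of s N "u r"] step) auto
    have swap: "u 1 t = u 0 (s - 1 - t)" for t
    proof -
      have "u 1 t = v (2 * (1 - d) + 1 - (2 * (t * d) + 1))" unfolding refl by (simp add: u_def)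
      also have "\<dots> = v (2 * (1 - d - t * d) + 0)" by (simp add: algebra_simps)
      also have "\<dots> = u 0 (s - 1 - t)"
      proof (rule u_mod)
        have "(1 - d - t * d) * s = (s - t * d * s) - d * s" by (simp add: algebra_simps)
        then have "((1 - d - t * d) * s) mod N = (s - t * d * s - 1) mod N" by (simp only: d(4))
        also have "s - t * d * s - 1 = s - 1 - t * d * s" by simp
        also have "(s - 1 - t * d * s) mod N = (s - 1 - (t * d * s) mod N) mod N"
          by (rule mod_diff_right_eq[symmetric])
        also have "\<dots> = (s - 1 - t) mod N" unfolding d(3) by (rule mod_diff_right_eq)
        finally show "((1 - d - t * d) * s) mod N = (s - 1 - t) mod N" .
      qed
      finally show ?thesis .
    qed
    \<comment> \<open>The reflection sends the coordinate \<open>s\<close> to -1, the last point of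
      the complementary arc.\<close>
    have "u 0 (- 1) = u 0 (N - 1)"
    proof -
      have "((- 1) * d * s) mod N = (N - 1) mod N" unfolding d(3) by (simp add: mod_simps)
      then show ?thesis using u_mod[of "- 1 * d" "N - 1" 0] by (simp add: u_def)
    qed
    then have links: "u 1 0 = u 0 0" "u 1 s = u 0 s"
      using swap[of 0] swap[of s] arc[of "s - 1" 0] arc'[of "N - 1" 0] s by simp_all
    have vu: "v i = u (i mod 2) ((i div 2 * s) mod N)" for i
      using u_mod[of "i div 2" "(i div 2 * s) mod N" "i mod 2"] by simp
    have r01: "i mod 2 = 0 \<or> i mod 2 = 1" for i :: int by presburger
    have "v i = u 0 0" if "(i div 2 * s) mod N < s" for i
      unfolding vu[of i] using that N r01[of i] arc[of "(i div 2 * s) mod N" "i mod 2"] links by auto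
    moreover have "v i = u 0 s" if "\<not> (i div 2 * s) mod N < s" for i
      unfolding vu[of i] using that N r01[of i] arc'[of "(i div 2 * s) mod N" "i mod 2"] links by auto
    ultimately show ?thesis
      using two_class_kernel[of "\<lambda>i. (i div 2 * s) mod N < s" v "u 0 0" "u 0 s" y a] y ij by blast
  qed
  ultimately have "punctured_generic (2 * N) 4 (2 * (1 - d) + 1) y" unfolding punctured_generic_def by blast
  then show ?thesis by (rule three_gen_of_punctured) (use N in simp_all)
qed

section \<open>From factors of double Sturmian words to codings with phase 0\<close>

lemma three_gen_list_shift:
  assumes "\<And>l r. three_gen l r y" "\<And>i. i < length u \<Longrightarrow> u ! i = y (c + int i)"
  shows "three_gen 1 (int (length u)) (\<lambda>i. u ! nat (i - 1))"
proof -
  have "three_gen (c - (c - 1)) (c + int (length u) - 1 - (c - 1)) (\<lambda>i. y (i + (c - 1)))"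
    by (rule three_gen_shift) (rule assms(1))
  then have "three_gen 1 (int (length u)) (\<lambda>i. y (i + (c - 1)))" by simp
  moreover have "y (i + (c - 1)) = u ! nat (i - 1)" if "1 \<le> i" "i \<le> int (length u)" for i
    using assms(2)[of "nat (i - 1)"] that by (simp add: algebra_simps)
  ultimately show ?thesis
    using three_gen_cong[of 1 "int (length u)" "\<lambda>i. y (i + (c - 1))" "\<lambda>i. u ! nat (i - 1)"] by blast
qed

lemma three_gen_double_sturmian_factor:
  assumes "double_sturmian z" "factor_of u z"
  shows "three_gen 1 (int (length u)) (\<lambda>i. u ! nat (i - 1))"
proof -
  obtain x A k where x: "sturmian x" "z = sdrop k (doubling_inf A x)"
    using assms(1) unfolding double_sturmian_def by blast
  obtain k' where k': "\<And>i. i < length u \<Longrightarrow> u ! i = z !! (k' + i)"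
    using assms(2) unfolding factor_of_iff by blast
  define K where "K = k + k'"
  have u: "u ! i = doubling_inf A x !! (K + i)" if "i < length u" for i
    using k'[OF that] by (simp add: x(2) K_def sdrop_snth add.assoc)
  \<comment> \<open>Doubling never shortens a word, so \<open>m\<close> letters of \<open>x\<close>
    cover the window.\<close>
  define m where "m = K + length u"
  \<comment> \<open>\<open>a\<close> is the doubled letter if there is exactly one, and arbitrary
    otherwise.\<close>
  obtain a where A: "A = {} \<or> A = {a} \<or> A = UNIV"
  proof -
    have "A = {} \<or> A = {False} \<or> A = {True} \<or> A = UNIV" unfolding set_eq_iff all_bool_eq by auto
    then show ?thesis using that by blast
  qed
  obtain s N t :: int where s: "0 < s" "s < N" "coprime s N"
    and code: "\<And>i. i < m \<Longrightarrow> x !! i = (((t + int i * s) mod N < s) = a)"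
    using sturmian_prefix_coding_letter[OF x(1), of m a] by metis
  have stake: "stake m x = map (\<lambda>i. ((t + int i * s) mod N < s) = a) [0..<m]"
    by (rule stake_eq_map) (rule code)
  have "length w \<le> length (doubling A w)" for w by (induction w) (auto simp: doubling_def)
  from this[of "stake m x"] have len: "m \<le> length (doubling A (stake m x))" by simp
  have "doubling_inf A x = doubling A (stake m x) @- doubling_inf A (sdrop m x)"
    using doubling_inf_shift[of A "stake m x" "sdrop m x"] by (simp add: stake_sdrop)
  then have u': "u ! i = doubling A (stake m x) ! (K + i)" if "i < length u" for i
    using u[OF that] that len by (simp add: m_def shift_snth)
  have solve: "\<exists>c. (c * s') mod N' = t' mod N'" if "coprime s' N'" for s' N' t' :: int
  proof -
    from cong_solve_coprime_int[OF that] obtain e where "[s' * e = 1] (mod N')" by blast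
    then have "[t' * (s' * e) = t' * 1] (mod N')" by (intro cong_mult cong_refl)
    then show ?thesis
      by (intro exI[of _ "t' * e"]) (simp add: cong_iff_mod_eq mult.assoc mult.left_commute mult.commute)
  qed
  have start: "(c * s' + j * s') mod N' = (t' + j * s') mod N'" if "(c * s') mod N' = t' mod N'" for c s' N' t' j :: int
    using that by (metis mod_add_left_eq)
  from A show ?thesis
  proof (elim disjE)
    assume "A = {}"
    obtain c where c: "(c * s) mod N = t mod N" using solve[OF s(3)] by blast
    define y where "y = (\<lambda>i. ((i * s) mod N < s) = a)"
    have "u ! i = y (c + int K + int i)" if "i < length u" for i
    proof -
      have "doubling {} w = w" for w by (induction w) (simp_all add: doubling_def)
      then have "u ! i = x !! (K + i)" using u'[OF that] \<open>A = {}\<close> that by (simp add: m_def)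
      also have "\<dots> = (((t + int (K + i) * s) mod N < s) = a)" using that by (intro code) (simp add: m_def)
      also have "(t + int (K + i) * s) mod N = (c * s + int (K + i) * s) mod N" using start[OF c] by simp
      finally show ?thesis by (simp add: y_def algebra_simps)
    qed
    moreover have "three_gen l r y" for l r by (rule three_gen_rotation[OF s, of y a]) (auto simp: y_def)
    ultimately show ?thesis using three_gen_list_shift by blast
  next
    assume "A = {a}"
    define \<tau> where "\<tau> = t mod N"
    \<comment> \<open>This undoes the collapse: the larger circle has room for the second letters of
      the doubled blocks.\<close>
    define M where "M = N + s"
    have \<tau>: "0 \<le> \<tau>" "\<tau> < M - s" using s by (simp_all add: \<tau>_def M_def)
    have s': "2 * s \<le> M" "2 * s < M" "coprime s M"
      using s by (simp_all add: M_def) (metis coprime_iff_gcd_eq_1 gcd.commute gcd_add1)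
    have "stake m x = map (\<lambda>i. ((\<tau> + int i * s) mod (M - s) < s) = a) [0..<m]"
      unfolding stake by (simp add: \<tau>_def M_def mod_simps)
    then obtain L where L: "doubling {a} (stake m x) =
        map (\<lambda>i. (((if \<tau> < s then \<tau> else \<tau> + s) + int i * s) mod M < 2 * s) = a) [0..<L]"
      using doubling_rotation[OF s(1) s'(1) \<tau>, of m a] by auto
    define t' where "t' = (if \<tau> < s then \<tau> else \<tau> + s)"
    obtain c where c: "(c * s) mod M = t' mod M" using solve[OF s'(3)] by blast
    define y where "y = (\<lambda>i. ((i * s) mod M < 2 * s) = a)"
    have "u ! i = y (c + int K + int i)" if "i < length u" for i
    proof -
      have "K + i < L" using len that \<open>A = {a}\<close> L by (simp add: m_def)
      then have "u ! i = (((t' + int (K + i) * s) mod M < 2 * s) = a)"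
        using u'[OF that] \<open>A = {a}\<close> L by (simp add: t'_def)
      also have "(t' + int (K + i) * s) mod M = (c * s + int (K + i) * s) mod M" using start[OF c] by simp
      finally show ?thesis by (simp add: y_def algebra_simps)
    qed
    moreover have "three_gen l r y" for l r
      by (rule three_gen_rotation_double[OF s(1) s'(2,3), of y a]) (auto simp: y_def)
    ultimately show ?thesis using three_gen_list_shift by blast
  next
    assume "A = UNIV"
    obtain c where c: "(c * s) mod N = t mod N" using solve[OF s(3)] by blast
    define y where "y = (\<lambda>i. ((i div 2 * s) mod N < s) = a)"
    have "u ! i = y (2 * c + int K + int i)" if "i < length u" for i
    proof -
      have "K + i < 2 * m" using that by (simp add: m_def)
      then have "u ! i = (((t + int ((K + i) div 2) * s) mod N < s) = a)"
        using u'[OF that] unfolding \<open>A = UNIV\<close> stake doubling_UNIV by simp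
      also have "(t + int ((K + i) div 2) * s) mod N = (c * s + int ((K + i) div 2) * s) mod N" using start[OF c] by simp
      also have "c * s + int ((K + i) div 2) * s = (2 * c + int K + int i) div 2 * s"
      proof -
        have "(2 * c + int K + int i) div 2 = c + (int K + int i) div 2" by presburger
        then show ?thesis by (simp add: zdiv_int distrib_right)
      qed
      finally show ?thesis by (simp add: y_def)
    qed
    moreover have "three_gen l r y" for l r by (rule three_gen_rotation_both[OF s, of y a]) (auto simp: y_def)
    ultimately show ?thesis using three_gen_list_shift by blast
  qed
qed

theorem theorem1:
  fixes u :: "bool list"
  assumes "u \<noteq> []"
  shows "pal_mu u \<le> 3 \<longleftrightarrow> (\<exists>y. double_sturmian y \<and> factor_of u y)"
  unfolding pal_mu_le_3_iff using factor_of_three_gen[OF assms] three_gen_double_sturmian_factor by blast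

end
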